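(* Let $\gamma = \lim_{n\to\infty} (\mathcal{W}_2(1,n)/n!)^{1/n} = 1.1926743412\ldots$. There exists a constant $\alpha = 0.2963720490\ldots$ such that, with $\kappa = 2/(3\gamma) < 1$, $$\frac{\mathcal{W}_2(1,n)}{n!} = \alpha\,\gamma^{n-1}\bigl(1 + O(\kappa^n)\bigr) \quad (n\to\infty).$$ More generally, for every fixed integer $s \ge 1$, there exists a polynomial $P_s(n)$ with leading term $(\alpha/\gamma)^s\, n^{s-1}/(s-1)!$ such that $$\frac{\mathcal{W}_2(s,n)}{n!} = P_s(n)\,\gamma^{n}\bigl(1 + O(\kappa^n)\bigr) \quad (n\to\infty).$$
   Context: $\mathbb{N}_0$ denotes the nonnegative integers. For positive integers $\ell, n$, let $$\mathcal{U}_2(\ell,n) = \#\{(a_1,\ldots,a_n)\in\mathbb{N}_0^n : 2^{a_1}+2^{a_2}+\cdots+2^{a_n}=\ell\}$$ be the number of representations of $\ell$ as an ordered sum of $n$ powers of $2$. For a positive integer $s$, $\mathcal{W}_2(s,n)$ is the maximum of $\mathcal{U}_2(\ell,n)$ over all positive integers $\ell$ whose binary sum of digits equals $s$. (Equivalently, $\mathcal{W}_2(1,n)$ is the number of $n$-tuples $(k_1,\ldots,k_n)$ of nonnegative integers with $2^{-k_1}+\cdots+2^{-k_n}=1$.) It is known (Molteni) that the limit $\lim_{n\to\infty}(\mathcal{W}_2(1,n)/n!)^{1/n}$ exists. The implied constants in the $O$-terms may depend on $s$. *)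

theory Defs
  imports
    Complex_Main
    "HOL-Computational_Algebra.Polynomial"
    "HOL-Library.Landau_Symbols"
begin

fun binary_digit_sum :: "nat \<Rightarrow> nat" where
  "binary_digit_sum 0 = 0"
| "binary_digit_sum (Suc m) = Suc m mod 2 + binary_digit_sum (Suc m div 2)"

definition reps2 :: "nat \<Rightarrow> nat \<Rightarrow> nat list set" where
  "reps2 l n = {as. length as = n \<and> (\<Sum>a\<leftarrow>as. 2 ^ a) = l}"

definition U2 :: "nat \<Rightarrow> nat \<Rightarrow> nat" where
  "U2 l n = card (reps2 l n)"

text \<open>\<^term>\<open>Max\<close> is only meaningful on finite nonempty sets, and here infinitely many \<open>l\<close> are
  admitted; the set of values is nevertheless finite, see \<open>W2_attained\<close> and \<open>U2_le_W2\<close> below.\<close>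

definition W2 :: "nat \<Rightarrow> nat \<Rightarrow> nat" where
  "W2 s n = Max {U2 l n |l. l > 0 \<and> binary_digit_sum l = s}"

definition gamma2 :: real where
  "gamma2 = lim (\<lambda>n. root n (real (W2 1 n) / fact n))"

lemma finite_reps2: "finite (reps2 l n)"
proof (rule finite_subset)
  show "reps2 l n \<subseteq> {as. set as \<subseteq> {..l} \<and> length as = n}"
  proof safe
    fix as a assume as: "as \<in> reps2 l n" and a: "a \<in> set as"
    have "a < 2 ^ a" by (rule less_exp)
    also have "(2::nat) ^ a \<le> (\<Sum>a\<leftarrow>as. 2 ^ a)"
      using a by (intro member_le_sum_list) auto
    finally show "a \<le> l" using as by (simp add: reps2_def)
  qed (simp add: reps2_def)
qed (rule finite_lists_length_eq, simp)

lemma U2_bounded: "\<exists>B. \<forall>l. U2 l n \<le> B"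
proof (induction n)
  case 0
  have "reps2 l 0 \<subseteq> {[]}" for l by (auto simp: reps2_def)
  hence "U2 l 0 \<le> 1" for l
    unfolding U2_def by (metis card_mono finite.emptyI finite_insert card.empty card_insert_disjoint
      empty_iff One_nat_def)
  thus ?case by blast
next
  case (Suc n)
  then obtain B where B: "\<And>l. U2 l n \<le> B" by blast
  have "U2 l (Suc n) \<le> Suc n * ((n + 2) * B)" for l
  proof -
    define A where "A = {a. (2::nat) ^ a \<le> l \<and> l \<le> Suc n * 2 ^ a}"
    define ins where "ins = (\<lambda>i a as. take i as @ (a::nat) # drop i as)"
    define a0 where "a0 = (LEAST a. a \<in> A)"
    have A_sub: "A \<subseteq> {a0..<a0 + (n + 2)}"
    proof
      fix a assume a: "a \<in> A"
      have a0: "a0 \<in> A" "a0 \<le> a" unfolding a0_def using a by (auto intro: LeastI Least_le)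
      have "(2::nat) ^ a \<le> Suc n * 2 ^ a0" using a a0 by (auto simp: A_def)
      also have "\<dots> < 2 ^ Suc n * 2 ^ a0" by (intro mult_strict_right_mono less_exp) auto
      finally have "(2::nat) ^ a < 2 ^ (Suc n + a0)" by (simp add: power_add)
      hence "a < Suc n + a0" by (rule power_less_imp_less_exp[rotated]) simp
      thus "a \<in> {a0..<a0 + (n + 2)}" using a0 by simp
    qed
    have finA: "finite A" using A_sub by (rule finite_subset) simp
    have cardA: "card A \<le> n + 2"
      using card_mono[OF _ A_sub] by simp
    have sub: "reps2 l (Suc n) \<subseteq> (\<Union>i<Suc n. \<Union>a\<in>A. ins i a ` reps2 (l - 2 ^ a) n)"
    proof
      fix as assume as: "as \<in> reps2 l (Suc n)"
      hence len: "length as = Suc n" and sm: "(\<Sum>a\<leftarrow>as. 2 ^ a) = l" by (auto simp: reps2_def)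
      define a where "a = Max (set as)"
      have ne: "as \<noteq> []" using len by auto
      have "a \<in> set as" unfolding a_def using ne by (intro Max_in) auto
      then obtain i where i: "i < Suc n" "as ! i = a" using len by (metis in_set_conv_nth)
      have spl: "as = take i as @ a # drop (Suc i) as"
        using i len by (metis id_take_nth_drop)
      define bs where "bs = take i as @ drop (Suc i) as"
      have sum_eq: "l = 2 ^ a + (\<Sum>a\<leftarrow>bs. 2 ^ a)"
        unfolding sm[symmetric] bs_def by (subst spl) simp
      have "bs \<in> reps2 (l - 2 ^ a) n"
        using i len sum_eq by (auto simp: reps2_def bs_def)
      moreover have "as = ins i a bs"
        using i len by (subst spl) (simp add: ins_def bs_def)
      moreover have "a \<in> A"
      proof -
        have "(\<Sum>b\<leftarrow>as. (2::nat) ^ b) \<le> (\<Sum>b\<leftarrow>as. 2 ^ a)"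
          by (intro sum_list_mono power_increasing) (auto simp: a_def)
        also have "\<dots> = Suc n * 2 ^ a" using len by (simp add: sum_list_triv)
        finally show ?thesis using sm sum_eq by (simp add: A_def)
      qed
      ultimately show "as \<in> (\<Union>i<Suc n. \<Union>a\<in>A. ins i a ` reps2 (l - 2 ^ a) n)"
        using i by blast
    qed
    have inner: "card (\<Union>a\<in>A. ins i a ` reps2 (l - 2 ^ a) n) \<le> (n + 2) * B" for i
    proof -
      have "card (\<Union>a\<in>A. ins i a ` reps2 (l - 2 ^ a) n)
          \<le> (\<Sum>a\<in>A. card (ins i a ` reps2 (l - 2 ^ a) n))"
        by (rule card_UN_le[OF finA])
      also have "\<dots> \<le> (\<Sum>a\<in>A. B)"
      proof (rule sum_mono)
        fix a
        show "card (ins i a ` reps2 (l - 2 ^ a) n) \<le> B"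
          using card_image_le[OF finite_reps2] B unfolding U2_def by (meson order_trans)
      qed
      also have "\<dots> \<le> (n + 2) * B" using mult_right_mono[OF cardA, of B] by simp
      finally show ?thesis .
    qed
    have "U2 l (Suc n) \<le> card (\<Union>i<Suc n. \<Union>a\<in>A. ins i a ` reps2 (l - 2 ^ a) n)"
      unfolding U2_def using sub finA by (intro card_mono) (auto intro!: finite_imageI finite_reps2)
    also have "\<dots> \<le> (\<Sum>i<Suc n. card (\<Union>a\<in>A. ins i a ` reps2 (l - 2 ^ a) n))"
      by (rule card_UN_le) simp
    also have "\<dots> \<le> (\<Sum>i<Suc n. (n + 2) * B)" by (intro sum_mono inner)
    also have "\<dots> = Suc n * ((n + 2) * B)" by simp
    finally show ?thesis .
  qed
  thus ?case by blast
qed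

lemma binary_digit_sum_surj: "\<exists>l>0. binary_digit_sum l = Suc s"
proof (induction s)
  case 0
  have "binary_digit_sum 1 = Suc 0" by (simp add: One_nat_def del: One_nat_def[symmetric])
  thus ?case by (intro exI[of _ 1]) simp
next
  case (Suc s)
  then obtain l where l: "l > 0" "binary_digit_sum l = Suc s" by blast
  have "binary_digit_sum (Suc (2 * l)) = Suc (2 * l) mod 2 + binary_digit_sum (Suc (2 * l) div 2)"
    by (rule binary_digit_sum.simps)
  also have "\<dots> = Suc (Suc s)" using l by simp
  finally show ?case by blast
qed

lemma finite_U2_values: "finite {U2 l n |l. l > 0 \<and> binary_digit_sum l = s}"
proof -
  obtain B where "\<And>l. U2 l n \<le> B" using U2_bounded by blast
  thus ?thesis by (intro finite_subset[OF _ finite_atMost[of B]]) auto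
qed

lemma U2_le_W2: "l > 0 \<Longrightarrow> binary_digit_sum l = s \<Longrightarrow> U2 l n \<le> W2 s n"
  unfolding W2_def by (rule Max_ge[OF finite_U2_values]) blast

lemma W2_attained:
  assumes "s \<ge> 1"
  shows "\<exists>l>0. binary_digit_sum l = s \<and> U2 l n = W2 s n"
proof -
  obtain l where "l > 0" "binary_digit_sum l = s"
    using binary_digit_sum_surj[of "s - 1"] assms by auto
  hence "W2 s n \<in> {U2 l n |l. l > 0 \<and> binary_digit_sum l = s}"
    unfolding W2_def by (intro Max_in[OF finite_U2_values]) blast
  thus ?thesis by auto
qed

end

theory Submission
  imports Defs "HOL-Computational_Algebra.Formal_Power_Series"
begin

text \<open>
  A list of powers of two with sum \<open>l\<close> splits along the binary digits of \<open>l\<close>, and the splitting is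
  unique when the digits are far apart. Hence \<open>W2 s n / fact n\<close> is the coefficient of \<open>z\<^sup>n\<close> in
  \<open>F\<^sup>s\<close>, where \<open>F\<close> is the exponential generating function of \<open>W2 1\<close>.

  Reading a representation of 1 from the largest part downwards gives
  \<open>F = z (1 + Y\<^sub>1)\<close> with \<open>Y\<^sub>0 = 1\<close> and \<open>Y\<^sub>i = z\<^sup>i (\<Sum>j\<le>2i. Y\<^sub>j / fact (2i - j))\<close>.
  In the disc \<open>|z| \<le> 3/2\<close> the equations with \<open>i \<ge> 3\<close> are contractive, and eliminating them leaves
  \<open>D Y\<^sub>1 = N\<close> with \<open>D\<close> and \<open>N\<close> absolutely convergent in the disc. A polynomial \<open>P\<close> for which \<open>D P\<close> is
  within a small \<open>l\<^sup>1\<close>-distance of a quadratic polynomial with zeros near \<open>0.838\<close> and \<open>1.554\<close> shows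
  that \<open>D\<close> has only one zero in the disc, at \<open>1 / gamma2\<close>, and that the zero is simple. So \<open>F\<close> is a
  simple pole plus a series absolutely convergent in the disc, and the expansion of \<open>F\<^sup>s\<close> follows.
  The digits come from sign changes and secants of \<open>D\<close>, evaluated with a posteriori error bounds.

  Throughout, \<open>z = (3/2) X\<close>, so that the disc becomes the unit disc.
\<close>

section \<open>Representations and generating functions\<close>

text \<open>The radius 3/2 is dictated by the claim: \<open>\<kappa> * gamma2 = 2 / 3\<close>, so it
  suffices that the series without its polar part has coefficients O((2/3) ^ n). Absolute
  convergence on the closed disc gives this without an epsilon in the exponent. Moreover the l1 norm
  is submultiplicative, so zeros can be excluded by inverting series close to 1 instead of by
  contour integrals, and the proof never leaves the real numbers. The obstacle is that the second
  zero of \<open>D\<close>, near 1.554, lies just outside the disc. The comparison with the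
  quadratic polynomial therefore has room for errors of only about three percent, which is why the
  multiplier \<open>P\<close> has so many terms. The maximum in \<open>W2\<close> is never located
  directly: the upper bound holds for every \<open>l\<close>, and for each \<open>n\<close> some
  sufficiently sparse \<open>l\<close> attains it.\<close>

lemma binary_digit_sum_double [simp]: "binary_digit_sum (2 * m) = binary_digit_sum m"
  by (cases m) (simp_all add: binary_digit_sum.simps(2)[of "Suc (2 * k)" for k])

lemma binary_digit_sum_double_Suc [simp]: "binary_digit_sum (Suc (2 * m)) = Suc (binary_digit_sum m)"
  by (simp add: binary_digit_sum.simps(2))

lemma binary_digit_sum_power2_mult [simp]: "binary_digit_sum (2 ^ b * m) = binary_digit_sum m"
  by (induction b) (simp_all add: mult.assoc)

lemma odd_part_exists:
  assumes "(l::nat) > 0"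
  shows "\<exists>b m. l = 2 ^ b * Suc (2 * m)"
  using assms
proof (induction l rule: less_induct)
  case (less l)
  show ?case
  proof (cases "even l")
    case True
    then obtain k where k: "l = 2 * k" by blast
    with less.prems have "k < l" "k > 0" by auto
    then obtain b m where "k = 2 ^ b * Suc (2 * m)" using less.IH by blast
    then have "l = 2 ^ Suc b * Suc (2 * m)" using k by simp
    then show ?thesis by blast
  next
    case False
    then obtain m where "l = 2 ^ 0 * Suc (2 * m)" by (auto elim: oddE)
    then show ?thesis by blast
  qed
qed

lemma binary_digit_sum_eq_0_iff [simp]: "binary_digit_sum l = 0 \<longleftrightarrow> l = 0"
proof
  assume "binary_digit_sum l = 0"
  then show "l = 0"
    using odd_part_exists[of l] by (metis Zero_not_Suc binary_digit_sum_double_Suc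
        binary_digit_sum_power2_mult gr0I)
qed simp

section \<open>Counting representations by coefficients of polynomial powers\<close>

definition reps_in :: "nat set \<Rightarrow> nat \<Rightarrow> nat \<Rightarrow> nat list set" where
  "reps_in A l n = {as. length as = n \<and> set as \<subseteq> A \<and> (\<Sum>a\<leftarrow>as. 2 ^ a) = l}"

definition power_sum_poly :: "nat set \<Rightarrow> nat poly" where
  "power_sum_poly A = (\<Sum>a\<in>A. monom 1 (2 ^ a))"

lemma finite_reps_in: "finite (reps_in A l n)"
  by (rule finite_subset[OF _ finite_reps2[of l n]]) (auto simp: reps_in_def reps2_def)

lemma reps_in_Suc:
  "reps_in A l (Suc n) = (\<Union>a\<in>{a\<in>A. 2 ^ a \<le> l}. (#) a ` reps_in A (l - 2 ^ a) n)"
proof (intro set_eqI iffI)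
  fix as assume as: "as \<in> reps_in A l (Suc n)"
  then obtain a bs where "as = a # bs" by (cases as) (auto simp: reps_in_def)
  with as show "as \<in> (\<Union>a\<in>{a\<in>A. 2 ^ a \<le> l}. (#) a ` reps_in A (l - 2 ^ a) n)"
    by (auto simp: reps_in_def)
qed (auto simp: reps_in_def)

lemma card_reps_in:
  assumes "finite A"
  shows "card (reps_in A l n) = coeff (power_sum_poly A ^ n) l"
proof (induction n arbitrary: l)
  case 0
  have "reps_in A l 0 = (if l = 0 then {[]} else {})" by (auto simp: reps_in_def)
  then show ?case by (simp add: coeff_1)
next
  case (Suc n)
  have "card (reps_in A l (Suc n)) = (\<Sum>a | a \<in> A \<and> 2 ^ a \<le> l. card ((#) a ` reps_in A (l - 2 ^ a) n))"
    unfolding reps_in_Suc using assms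
    by (subst card_UN_disjoint) (auto intro!: finite_imageI finite_reps_in)
  also have "\<dots> = (\<Sum>a | a \<in> A \<and> 2 ^ a \<le> l. coeff (power_sum_poly A ^ n) (l - 2 ^ a))"
    by (intro sum.cong) (auto simp: card_image Suc)
  also have "\<dots> = coeff (power_sum_poly A ^ Suc n) l"
    using assms unfolding power_Suc
    by (subst (2) power_sum_poly_def)
       (auto simp: sum_distrib_right coeff_sum coeff_monom_mult sum.inter_filter intro!: sum.cong)
  finally show ?case .
qed

lemma reps_in_atMost:
  assumes "l < 2 ^ Suc N"
  shows "reps_in {..N} l n = reps2 l n"
proof -
  have "a \<le> N" if "as \<in> reps2 l n" "a \<in> set as" for as a
  proof -
    have "(2::nat) ^ a \<le> (\<Sum>a\<leftarrow>as. 2 ^ a)"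
      using that by (intro member_le_sum_list) auto
    then have "(2::nat) ^ a < 2 ^ Suc N" using that assms by (simp add: reps2_def)
    then show "a \<le> N"
      using power_less_imp_less_exp[of "2::nat" a "Suc N"] by simp
  qed
  then show ?thesis by (auto simp: reps_in_def reps2_def)
qed

lemma U2_eq_coeff: "l < 2 ^ Suc N \<Longrightarrow> U2 l n = coeff (power_sum_poly {..N} ^ n) l"
  by (simp add: U2_def card_reps_in flip: reps_in_atMost)

text \<open>\<open>trunc_coeff r N n\<close> is \<open>1 / n!\<close> times the number of ways to write \<open>r * 2 ^ N\<close> as an ordered
  sum of \<open>n\<close> powers \<open>2 ^ a\<close> with \<open>a \<le> N\<close>, i.e. \<open>r\<close> as a sum of powers with exponents in \<open>[-N, 0]\<close>.\<close>

definition trunc_coeff :: "nat \<Rightarrow> nat \<Rightarrow> nat \<Rightarrow> real" where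
  "trunc_coeff r N n = real (coeff (power_sum_poly {..N} ^ n) (r * 2 ^ N)) / fact n"

lemma trunc_coeff_0: "trunc_coeff r 0 n = (if n = r then 1 / fact n else 0)"
  by (simp add: trunc_coeff_def power_sum_poly_def monom_power)

lemma trunc_coeff_zero: "trunc_coeff 0 N n = (if n = 0 then 1 else 0)"
proof -
  have "coeff (power_sum_poly {..N}) 0 = 0"
    by (simp add: power_sum_poly_def coeff_sum)
  then show ?thesis by (auto simp: trunc_coeff_def coeff_0_power)
qed

text \<open>Choose which \<open>l\<close> of the \<open>n\<close> parts equal the largest admissible
  power \<open>2 ^ Suc N\<close>. The others have exponents at most \<open>N\<close> and sum to
  \<open>(r - l) * 2 ^ Suc N = 2 * (r - l) * 2 ^ N\<close>; the factorials turn the binomial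
  coefficient into \<open>1 / fact l\<close>.\<close>

lemma trunc_coeff_Suc:
  "trunc_coeff r (Suc N) n = (\<Sum>l\<le>min r n. trunc_coeff (2 * (r - l)) N (n - l) / fact l)"
proof -
  let ?p = "power_sum_poly {..N}"
  have p: "power_sum_poly {..Suc N} = monom 1 (2 ^ Suc N) + ?p"
    by (simp add: power_sum_poly_def atMost_Suc)
  have "coeff (power_sum_poly {..Suc N} ^ n) (r * 2 ^ Suc N)
      = (\<Sum>l\<le>n. (n choose l) * (if l \<le> r then coeff (?p ^ (n - l)) (2 * (r - l) * 2 ^ N) else 0))"
    unfolding p binomial_ring coeff_sum
  proof (rule sum.cong)
    fix l assume "l \<in> {..n}"
    have eq: "of_nat (n choose l) * monom 1 (2 ^ Suc N) ^ l * ?p ^ (n - l)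
        = smult (n choose l) (monom 1 (l * 2 ^ Suc N) * ?p ^ (n - l))"
      by (simp add: monom_power of_nat_poly mult_ac)
    have "coeff (of_nat (n choose l) * monom 1 (2 ^ Suc N) ^ l * ?p ^ (n - l)) (r * 2 ^ Suc N)
        = (n choose l) * (if l * 2 ^ Suc N \<le> r * 2 ^ Suc N
             then coeff (?p ^ (n - l)) (r * 2 ^ Suc N - l * 2 ^ Suc N) else 0)"
      unfolding eq coeff_smult coeff_monom_mult by (simp del: power_Suc)
    also have "r * 2 ^ Suc N - l * 2 ^ Suc N = 2 * (r - l) * 2 ^ N"
      by (simp add: diff_mult_distrib algebra_simps)
    also have "l * 2 ^ Suc N \<le> r * 2 ^ Suc N \<longleftrightarrow> l \<le> r" by simp
    finally show "coeff (of_nat (n choose l) * monom 1 (2 ^ Suc N) ^ l * ?p ^ (n - l)) (r * 2 ^ Suc N)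
        = (n choose l) * (if l \<le> r then coeff (?p ^ (n - l)) (2 * (r - l) * 2 ^ N) else 0)" .
  qed simp
  also have "\<dots> = (\<Sum>l\<le>min r n. (n choose l) * coeff (?p ^ (n - l)) (2 * (r - l) * 2 ^ N))"
    by (rule sum.mono_neutral_cong_right) auto
  finally have "trunc_coeff r (Suc N) n = (\<Sum>l\<le>min r n. real (n choose l) *
      real (coeff (?p ^ (n - l)) (2 * (r - l) * 2 ^ N)) / fact n)"
    by (simp add: trunc_coeff_def sum_divide_distrib)
  also have "\<dots> = (\<Sum>l\<le>min r n. trunc_coeff (2 * (r - l)) N (n - l) / fact l)"
    by (rule sum.cong) (auto simp: trunc_coeff_def binomial_fact field_simps)
  finally show ?thesis .
qed

text \<open>Reaching the exponent \<open>-(N + 1)\<close> from \<open>r\<close> parts equal to 1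
  takes at least \<open>N + 1\<close> halvings, each adding a part, so it needs
  \<open>n \<ge> r + N + 1\<close>. In the recursion the excess \<open>n - r\<close> drops by
  \<open>r - l\<close>, which is positive except when nothing is left to represent.\<close>

lemma trunc_coeff_stable:
  assumes "n - r \<le> N"
  shows "trunc_coeff r (Suc N) n = trunc_coeff r N n"
  using assms
proof (induction N arbitrary: r n)
  case 0
  then have "n \<le> r" by simp
  have "trunc_coeff r (Suc 0) n = (\<Sum>l\<le>n. if l = r then trunc_coeff r 0 n else 0)"
    unfolding trunc_coeff_Suc using \<open>n \<le> r\<close> by (intro sum.cong) (auto simp: trunc_coeff_0)
  also have "\<dots> = trunc_coeff r 0 n" using \<open>n \<le> r\<close> by (auto simp: trunc_coeff_0)
  finally show ?case .
next
  case (Suc N)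
  show ?case
    unfolding trunc_coeff_Suc[of r "Suc N"] trunc_coeff_Suc[of r N]
  proof (intro sum.cong refl)
    fix l assume l: "l \<in> {..min r n}"
    have "trunc_coeff (2 * (r - l)) (Suc N) (n - l) = trunc_coeff (2 * (r - l)) N (n - l)"
    proof (cases "l = r")
      case True
      then show ?thesis by (simp add: trunc_coeff_zero)
    next
      case False
      with l Suc.prems have "(n - l) - 2 * (r - l) \<le> N" by auto
      then show ?thesis by (rule Suc.IH)
    qed
    then show "trunc_coeff (2 * (r - l)) (Suc N) (n - l) / fact l
        = trunc_coeff (2 * (r - l)) N (n - l) / fact l" by simp
  qed
qed

definition lim_coeff :: "nat \<Rightarrow> nat \<Rightarrow> real" where
  "lim_coeff r n = trunc_coeff r n n"

lemma trunc_coeff_eq_lim_coeff: "n \<le> N \<Longrightarrow> trunc_coeff r N n = lim_coeff r n"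
proof (induction N rule: dec_induct)
  case (step N)
  then show ?case by (simp add: trunc_coeff_stable)
qed (simp add: lim_coeff_def)

lemma lim_coeff_rec:
  "lim_coeff r n = (\<Sum>l\<le>min r n. lim_coeff (2 * (r - l)) (n - l) / fact l)"
proof -
  have "lim_coeff r n = trunc_coeff r (Suc n) n"
    by (simp add: trunc_coeff_eq_lim_coeff)
  also have "\<dots> = (\<Sum>l\<le>min r n. lim_coeff (2 * (r - l)) (n - l) / fact l)"
    unfolding trunc_coeff_Suc by (simp add: trunc_coeff_eq_lim_coeff)
  finally show ?thesis .
qed

lemma lim_coeff_zero [simp]: "lim_coeff 0 n = (if n = 0 then 1 else 0)"
  by (simp add: lim_coeff_def trunc_coeff_zero)

lemma lim_coeff_eq_0: "n < r \<Longrightarrow> lim_coeff r n = 0"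
proof -
  assume "n < r"
  then have "trunc_coeff r (0 + k) n = 0" for k
    by (induction k) (simp_all add: trunc_coeff_0 trunc_coeff_stable)
  then show ?thesis unfolding lim_coeff_def by (metis add_0)
qed

lemma U2_power2: "real (U2 (2 ^ N) n) / fact n = trunc_coeff 1 N n"
  by (simp add: trunc_coeff_def U2_eq_coeff[of _ N])

lemma U2_power2_eq: "n \<le> N \<Longrightarrow> real (U2 (2 ^ N) n) / fact n = lim_coeff 1 n"
  by (simp add: U2_power2 trunc_coeff_eq_lim_coeff)

section \<open>Shifting exponents and splitting along binary digits\<close>

lemma U2_shift_le: "U2 l n \<le> card (reps_in {M..} (2 ^ M * l) n)"
proof -
  have "(\<Sum>a\<leftarrow>as. 2 ^ (M + a)) = (2::nat) ^ M * (\<Sum>a\<leftarrow>as. 2 ^ a)" for as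
    by (simp add: power_add sum_list_const_mult)
  then have "map ((+) M) ` reps2 l n \<subseteq> reps_in {M..} (2 ^ M * l) n"
    by (auto simp: reps_in_def reps2_def o_def)
  then show ?thesis
    unfolding U2_def by (intro card_inj_on_le[OF _ _ finite_reps_in]) (auto simp: inj_on_def)
qed

text \<open>Only the exponent floor 0 can make \<open>2 ^ b\<close> lose representations. Shifting
  all exponents up by \<open>n\<close> keeps every representation, and for
  \<open>2 ^ (n + b)\<close> the floor is out of the reach of \<open>n\<close> parts.\<close>

lemma U2_power2_le: "real (U2 (2 ^ b) n) / fact n \<le> lim_coeff 1 n"
proof -
  have "U2 (2 ^ b) n \<le> card (reps_in {n..} (2 ^ n * 2 ^ b) n)" by (rule U2_shift_le)
  also have "\<dots> \<le> U2 (2 ^ (n + b)) n"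
    unfolding U2_def by (intro card_mono finite_reps2) (auto simp: reps_in_def reps2_def power_add)
  finally have "real (U2 (2 ^ b) n) / fact n \<le> real (U2 (2 ^ (n + b)) n) / fact n"
    by (intro divide_right_mono) auto
  also have "\<dots> = lim_coeff 1 n" by (rule U2_power2_eq) simp
  finally show ?thesis .
qed

text \<open>An interleaving is fixed by the positions of \<open>xs\<close>. Equal entries can make
  different positions give the same list, hence only an inequality.\<close>

lemma card_shuffles_le:
  "finite (shuffles xs ys) \<and> card (shuffles xs ys) \<le> (length xs + length ys) choose length xs"
proof (induction xs ys rule: shuffles.induct)
  case (3 x xs y ys)
  let ?A = "(#) x ` shuffles xs (y # ys)" and ?B = "(#) y ` shuffles (x # xs) ys"
  have "card (?A \<union> ?B) \<le> card (shuffles xs (y # ys)) + card (shuffles (x # xs) ys)"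
    by (rule order.trans[OF card_Un_le]) (intro add_mono card_image_le; use 3 in simp)
  also have "\<dots> \<le> ((length xs + length (y # ys)) choose length xs)
      + ((length (x # xs) + length ys) choose length (x # xs))"
    using 3 by (intro add_mono) auto
  also have "\<dots> = (length (x # xs) + length (y # ys)) choose length (x # xs)" by simp
  finally show ?case using 3 by simp
qed simp_all

lemma nths_in_shuffles: "xs \<in> shuffles (nths xs I) (nths xs (- I))"
proof (induction xs arbitrary: I)
  case (Cons x xs)
  have "{j. Suc j \<in> - I} = - {j. Suc j \<in> I}" by auto
  then show ?case
    using Cons[of "{j. Suc j \<in> I}"]
    by (auto simp: nths_Cons Cons_in_shuffles_iff)
qed simp

lemma sum_list_nths:
  "(\<Sum>x\<leftarrow>nths xs I. g x) = (\<Sum>i | i \<in> I \<and> i < length xs. g (xs ! i))"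
proof (induction xs arbitrary: I)
  case (Cons x xs)
  have "{i. i \<in> I \<and> i < length (x # xs)}
      = (if 0 \<in> I then {0} else {}) \<union> Suc ` {j. Suc j \<in> I \<and> j < length xs}"
    using less_Suc_eq_0_disj by auto
  then have "(\<Sum>i | i \<in> I \<and> i < length (x # xs). g ((x # xs) ! i))
      = (\<Sum>i\<in>(if 0 \<in> I then {0} else {}). g ((x # xs) ! i))
        + (\<Sum>i\<in>Suc ` {j. Suc j \<in> I \<and> j < length xs}. g ((x # xs) ! i))"
    by (simp only:) (subst sum.union_disjoint, auto)
  then show ?case using Cons[of "{j. Suc j \<in> I}"]
    by (auto simp: nths_Cons sum.reindex)
qed simp

text \<open>Among the index sets whose sum is at least \<open>2 ^ b\<close>, one with the smallest sum has sum exactly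
  \<open>2 ^ b\<close>: both numbers are multiples of the smallest term, so otherwise that term could be dropped.\<close>

lemma ex_subset_sum_power2:
  fixes e :: "'i \<Rightarrow> nat"
  assumes "finite J" and "\<And>i. i \<in> J \<Longrightarrow> e i \<le> b" and "(\<Sum>i\<in>J. 2 ^ e i) \<ge> (2::nat) ^ b"
  shows "\<exists>I\<subseteq>J. (\<Sum>i\<in>I. 2 ^ e i) = (2::nat) ^ b"
proof -
  let ?S = "\<lambda>I. \<Sum>i\<in>I. (2::nat) ^ e i"
  define I where "I = (ARG_MIN ?S I. I \<subseteq> J \<and> ?S I \<ge> 2 ^ b)"
  have I: "I \<subseteq> J" "?S I \<ge> 2 ^ b"
    using arg_min_natI[of "\<lambda>I. I \<subseteq> J \<and> ?S I \<ge> 2 ^ b" J ?S] assms(3) by (auto simp: I_def)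
  have I_min: "?S I \<le> ?S I'" if "I' \<subseteq> J" "?S I' \<ge> 2 ^ b" for I'
    unfolding I_def by (rule arg_min_nat_le) (use that in auto)
  have fin: "finite I" using I(1) assms(1) by (rule finite_subset)
  have "?S I = 2 ^ b"
  proof (rule ccontr)
    assume "?S I \<noteq> 2 ^ b"
    then have gt: "?S I > 2 ^ b" using I by simp
    then have "I \<noteq> {}" by auto
    then obtain k where k: "k \<in> I" "\<And>i. i \<in> I \<Longrightarrow> e k \<le> e i"
      using ex_min_if_finite[of "e ` I"] fin by (auto simp: not_less)
    have "2 ^ e k dvd ?S I" by (intro dvd_sum le_imp_power_dvd k)
    moreover have "(2::nat) ^ e k dvd 2 ^ b" by (intro le_imp_power_dvd assms) (use k I in auto)
    ultimately have "2 ^ e k dvd ?S I - 2 ^ b" by (rule dvd_diff_nat)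
    then have "2 ^ e k \<le> ?S I - 2 ^ b" by (rule dvd_imp_le) (use gt in simp)
    moreover have "?S I = 2 ^ e k + ?S (I - {k})" by (rule sum.remove[OF fin k(1)])
    moreover have "(2::nat) ^ e k > 0" by simp
    ultimately have "?S (I - {k}) \<ge> 2 ^ b" "?S (I - {k}) < ?S I" by linarith+
    then show False using I_min[of "I - {k}"] I by auto
  qed
  then show ?thesis using I by blast
qed

text \<open>The parts with exponent above \<open>b\<close> sum to a multiple of
  \<open>2 ^ Suc b\<close>, so those with exponent at most \<open>b\<close> sum to an odd multiple
  of \<open>2 ^ b\<close>, hence to at least \<open>2 ^ b\<close>. Some of them therefore sum to
  exactly the lowest binary digit, and all remaining parts represent the number without it.\<close>

lemma reps2_split:
  assumes "as \<in> reps2 (2 ^ b * Suc (2 * m)) n"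
  shows "\<exists>k\<le>n. \<exists>xs\<in>reps2 (2 ^ b) k. \<exists>ys\<in>reps2 (2 ^ b * (2 * m)) (n - k). as \<in> shuffles xs ys"
proof -
  have len: "length as = n" and sm: "(\<Sum>a\<leftarrow>as. 2 ^ a) = 2 ^ b * Suc (2 * m)"
    using assms by (auto simp: reps2_def)
  let ?g = "\<lambda>i. (2::nat) ^ (as ! i)"
  define J where "J = {i. i < n \<and> as ! i \<le> b}"
  have "(\<Sum>a\<leftarrow>as. 2 ^ a) = (\<Sum>i<n. ?g i)"
    by (simp add: sum_list_sum_nth len atLeast0LessThan)
  also have "{..<n} = J \<union> {i. i < n \<and> \<not> as ! i \<le> b}" by (auto simp: J_def)
  also have "(\<Sum>i\<in>J \<union> {i. i < n \<and> \<not> as ! i \<le> b}. ?g i)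
      = (\<Sum>i\<in>J. ?g i) + (\<Sum>i | i < n \<and> \<not> as ! i \<le> b. ?g i)"
    by (rule sum.union_disjoint) (auto simp: J_def)
  finally have sum_eq: "2 ^ b * Suc (2 * m) = (\<Sum>i\<in>J. ?g i) + (\<Sum>i | i < n \<and> \<not> as ! i \<le> b. ?g i)"
    using sm by simp
  have "2 ^ Suc b dvd (\<Sum>i | i < n \<and> \<not> as ! i \<le> b. ?g i)"
    by (intro dvd_sum le_imp_power_dvd) auto
  then obtain q where q: "(\<Sum>i | i < n \<and> \<not> as ! i \<le> b. ?g i) = 2 ^ Suc b * q" by blast
  have J_eq: "(\<Sum>i\<in>J. ?g i) = 2 ^ b * (Suc (2 * m) - 2 * q)"
  proof -
    have "2 ^ b * Suc (2 * m) = (\<Sum>i\<in>J. ?g i) + 2 ^ b * (2 * q)"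
      unfolding sum_eq q by (simp only: power_Suc ac_simps)
    then show ?thesis unfolding diff_mult_distrib2 by (simp only: add_diff_cancel_right')
  qed
  have "(2::nat) ^ b * (2 * q) \<le> 2 ^ b * Suc (2 * m)"
    unfolding sum_eq q by (simp only: power_Suc ac_simps)
  then have "2 * q \<le> Suc (2 * m)" by (rule mult_le_cancel1[THEN iffD1, rule_format]) simp
  then have "Suc (2 * m) - 2 * q \<ge> 1" by presburger
  then have "2 ^ b * 1 \<le> (\<Sum>i\<in>J. ?g i)" unfolding J_eq by (rule mult_le_mono2)
  then have J_ge: "(\<Sum>i\<in>J. ?g i) \<ge> 2 ^ b" by simp
  have J: "finite J" "\<And>i. i \<in> J \<Longrightarrow> as ! i \<le> b" by (auto simp: J_def)
  obtain I where I: "I \<subseteq> J" "(\<Sum>i\<in>I. ?g i) = 2 ^ b"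
    using ex_subset_sum_power2[OF J J_ge] by blast
  define xs where "xs = nths as I"
  define ys where "ys = nths as (- I)"
  have "as \<in> shuffles xs ys" unfolding xs_def ys_def by (rule nths_in_shuffles)
  moreover have "length xs + length ys = n"
    using length_shuffles[OF \<open>as \<in> shuffles xs ys\<close>] len by simp
  moreover have xs: "(\<Sum>a\<leftarrow>xs. 2 ^ a) = (2::nat) ^ b"
  proof -
    have "{i. i \<in> I \<and> i < length as} = I" using I(1) by (auto simp: J_def len)
    then show ?thesis using I(2) by (simp add: xs_def sum_list_nths)
  qed
  moreover have "(\<Sum>a\<leftarrow>xs. 2 ^ a) + (\<Sum>a\<leftarrow>ys. 2 ^ a) = (\<Sum>a\<leftarrow>as. (2::nat) ^ a)"
  proof -
    have "mset as = mset xs + mset ys" using \<open>as \<in> shuffles xs ys\<close> by (rule mset_shuffles)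
    moreover have "(\<Sum>a\<leftarrow>zs. 2 ^ a) = (\<Sum>a\<in>#mset zs. (2::nat) ^ a)" for zs
      by (metis mset_map sum_mset_sum_list)
    ultimately show ?thesis by simp
  qed
  ultimately have "xs \<in> reps2 (2 ^ b) (length xs)" "ys \<in> reps2 (2 ^ b * (2 * m)) (n - length xs)"
    "length xs \<le> n" using sm by (auto simp: reps2_def)
  with \<open>as \<in> shuffles xs ys\<close> show ?thesis by blast
qed

lemma U2_split_le:
  "U2 (2 ^ b * Suc (2 * m)) n \<le> (\<Sum>k\<le>n. (n choose k) * U2 (2 ^ b) k * U2 (2 ^ b * (2 * m)) (n - k))"
proof -
  let ?X = "\<lambda>k. reps2 (2 ^ b) k" and ?Y = "\<lambda>k. reps2 (2 ^ b * (2 * m)) (n - k)"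
  have "U2 (2 ^ b * Suc (2 * m)) n \<le> card (\<Union>k\<in>{..n}. \<Union>z\<in>?X k \<times> ?Y k. shuffles (fst z) (snd z))"
    unfolding U2_def
  proof (rule card_mono)
    show "finite (\<Union>k\<in>{..n}. \<Union>z\<in>?X k \<times> ?Y k. shuffles (fst z) (snd z))"
      using card_shuffles_le by (auto intro!: finite_reps2)
  qed (use reps2_split in fastforce)
  also have "\<dots> \<le> (\<Sum>k\<le>n. card (\<Union>z\<in>?X k \<times> ?Y k. shuffles (fst z) (snd z)))"
    by (rule card_UN_le) simp
  also have "\<dots> \<le> (\<Sum>k\<le>n. (n choose k) * U2 (2 ^ b) k * U2 (2 ^ b * (2 * m)) (n - k))"
  proof (rule sum_mono)
    fix k assume k: "k \<in> {..n}"
    have "card (\<Union>z\<in>?X k \<times> ?Y k. shuffles (fst z) (snd z))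
        \<le> (\<Sum>z\<in>?X k \<times> ?Y k. card (shuffles (fst z) (snd z)))"
      by (intro card_UN_le finite_cartesian_product finite_reps2)
    also have "\<dots> \<le> (\<Sum>z\<in>?X k \<times> ?Y k. n choose k)"
    proof (rule sum_mono)
      fix z assume "z \<in> ?X k \<times> ?Y k"
      then have "length (fst z) = k" "length (snd z) = n - k" by (auto simp: reps2_def)
      then show "card (shuffles (fst z) (snd z)) \<le> n choose k"
        using card_shuffles_le[of "fst z" "snd z"] k by simp
    qed
    finally show "card (\<Union>z\<in>?X k \<times> ?Y k. shuffles (fst z) (snd z))
        \<le> (n choose k) * U2 (2 ^ b) k * U2 (2 ^ b * (2 * m)) (n - k)"
      by (simp add: U2_def card_cartesian_product mult_ac)
  qed
  finally show ?thesis .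
qed

text \<open>Parts with exponents at most \<open>n\<close> represent the digit \<open>2 ^ n\<close>,
  parts with exponents above \<open>n\<close> a copy of \<open>l\<close> shifted by
  \<open>Suc n\<close>. The two ranges are disjoint, so all interleavings differ; they are counted
  by a binomial expansion, keeping one product from each convolution.\<close>

lemma U2_split_ge:
  "(\<Sum>j\<le>k. (k choose j) * U2 (2 ^ n) j * U2 l (k - j)) \<le> U2 (2 ^ n * Suc (2 * l)) k"
proof -
  define L where "L = 2 ^ Suc n * l"
  \<comment> \<open>Since \<open>a < 2 ^ a\<close>, the represented number bounds every exponent
    that occurs; the summand \<open>n\<close> makes \<open>{..n} \<subseteq> {..N}\<close>
    evident.\<close>
  define N where "N = 2 ^ n * Suc (2 * l) + n"
  let ?p = "power_sum_poly {..n}" and ?q = "power_sum_poly {Suc n..N}"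
  have pq: "power_sum_poly {..N} = ?p + ?q"
  proof -
    have "{..N} = {..n} \<union> {Suc n..N}" by (auto simp: N_def)
    then show ?thesis unfolding power_sum_poly_def by (simp only:) (rule sum.union_disjoint; auto)
  qed
  have tot: "2 ^ n * Suc (2 * l) = 2 ^ n + L" by (simp add: L_def algebra_simps)
  have LN: "2 ^ n + L \<le> N" unfolding N_def tot by simp
  have "2 ^ n + L < 2 ^ Suc N"
    using LN less_exp[of "Suc N"] by linarith
  then have "U2 (2 ^ n + L) k = coeff ((?p + ?q) ^ k) (2 ^ n + L)"
    by (simp add: U2_eq_coeff[of _ N] pq)
  also have "\<dots> = (\<Sum>j\<le>k. (k choose j) * coeff (?p ^ j * ?q ^ (k - j)) (2 ^ n + L))"
    by (simp add: binomial_ring coeff_sum mult.assoc of_nat_poly)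
  also have "\<dots> \<ge> (\<Sum>j\<le>k. (k choose j) * U2 (2 ^ n) j * U2 l (k - j))"
  proof (rule sum_mono)
    fix j
    have "U2 l (k - j) \<le> card (reps_in {Suc n..} L (k - j))"
      unfolding L_def by (rule U2_shift_le)
    also have "\<dots> \<le> card (reps_in {Suc n..N} L (k - j))"
    proof (intro card_mono finite_reps_in subsetI)
      fix as assume as: "as \<in> reps_in {Suc n..} L (k - j)"
      have "a \<le> N" if "a \<in> set as" for a
      proof -
        have "(2::nat) ^ a \<le> (\<Sum>a\<leftarrow>as. 2 ^ a)" using that by (intro member_le_sum_list) auto
        then have "2 ^ a \<le> N" using as LN by (auto simp: reps_in_def)
        then show ?thesis using less_exp[of a] by linarith
      qed
      then show "as \<in> reps_in {Suc n..N} L (k - j)" using as by (auto simp: reps_in_def)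
    qed
    also have "\<dots> = coeff (?q ^ (k - j)) L" by (simp add: card_reps_in)
    finally have "U2 (2 ^ n) j * U2 l (k - j) \<le> coeff (?p ^ j) (2 ^ n) * coeff (?q ^ (k - j)) L"
      by (intro mult_mono) (simp_all add: U2_eq_coeff[of _ n])
    also have "\<dots> = (\<lambda>i. coeff (?p ^ j) i * coeff (?q ^ (k - j)) (2 ^ n + L - i)) (2 ^ n)" by simp
    also have "\<dots> \<le> (\<Sum>i\<le>2 ^ n + L. coeff (?p ^ j) i * coeff (?q ^ (k - j)) (2 ^ n + L - i))"
      by (rule member_le_sum) auto
    also have "\<dots> = coeff (?p ^ j * ?q ^ (k - j)) (2 ^ n + L)" by (simp add: coeff_mult)
    finally show "(k choose j) * U2 (2 ^ n) j * U2 l (k - j)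
        \<le> (k choose j) * coeff (?p ^ j * ?q ^ (k - j)) (2 ^ n + L)"
      by (simp add: mult.assoc mult_le_mono2)
  qed
  finally show ?thesis by (simp only: tot)
qed

section \<open>Maximal counts as coefficients of powers of one series\<close>

definition lim_fps :: "real fps" where
  "lim_fps = Abs_fps (lim_coeff 1)"

lemma lim_coeff_nonneg: "lim_coeff r n \<ge> 0"
  by (simp add: lim_coeff_def trunc_coeff_def)

lemma lim_fps_power_nonneg: "fps_nth (lim_fps ^ s) n \<ge> 0"
  by (induction s arbitrary: n)
     (auto simp: fps_mult_nth lim_fps_def lim_coeff_nonneg intro!: sum_nonneg mult_nonneg_nonneg)

lemma U2_le_lim_fps_power:
  "binary_digit_sum l = s \<Longrightarrow> real (U2 l n) / fact n \<le> fps_nth (lim_fps ^ s) n"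
proof (induction s arbitrary: l n)
  case 0
  then have "l = 0" by simp
  have "reps2 0 n \<subseteq> (if n = 0 then {[]} else {})" by (auto simp: reps2_def)
  from card_mono[OF _ this] show ?case using \<open>l = 0\<close> by (auto simp: U2_def split: if_splits)
next
  case (Suc s)
  then have "l > 0" by (cases l) auto
  then obtain b m where l: "l = 2 ^ b * Suc (2 * m)" using odd_part_exists by blast
  have "binary_digit_sum (2 ^ b * Suc (2 * m)) = Suc (binary_digit_sum m)"
    by (simp only: binary_digit_sum_power2_mult binary_digit_sum_double_Suc)
  with Suc.prems l have ds: "binary_digit_sum (2 ^ b * (2 * m)) = s"
    by (simp only: binary_digit_sum_power2_mult binary_digit_sum_double)
  have "real (U2 l n) / fact n
      \<le> real (\<Sum>k\<le>n. (n choose k) * U2 (2 ^ b) k * U2 (2 ^ b * (2 * m)) (n - k)) / fact n"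
    unfolding l by (intro divide_right_mono of_nat_mono U2_split_le) simp
  also have "\<dots> = (\<Sum>k\<le>n. (real (U2 (2 ^ b) k) / fact k)
      * (real (U2 (2 ^ b * (2 * m)) (n - k)) / fact (n - k)))"
    unfolding of_nat_sum sum_divide_distrib
    by (rule sum.cong) (auto simp: binomial_fact field_simps)
  also have "\<dots> \<le> (\<Sum>k\<le>n. lim_coeff 1 k * fps_nth (lim_fps ^ s) (n - k))"
    by (intro sum_mono mult_mono U2_power2_le Suc.IH ds) (auto simp: lim_coeff_nonneg)
  also have "\<dots> = fps_nth (lim_fps ^ Suc s) n"
    by (simp add: fps_mult_nth lim_fps_def atLeast0AtMost)
  finally show ?case .
qed

text \<open>The new lowest digit is put at position \<open>n\<close> and the old number is shifted
  up by \<open>n + 1\<close>, so every digit has at least \<open>n\<close> free positions below it.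
  One \<open>l\<close> has to serve all \<open>k \<le> n\<close>, because the convolution involves
  shorter representations.\<close>

lemma ex_U2_ge_lim_fps_power:
  "\<exists>l. binary_digit_sum l = s \<and> (\<forall>k\<le>n. real (U2 l k) / fact k \<ge> fps_nth (lim_fps ^ s) k)"
proof (induction s)
  case 0
  have "U2 0 0 = 1"
  proof -
    have "reps2 0 0 = {[]}" by (auto simp: reps2_def)
    then show ?thesis by (simp add: U2_def)
  qed
  then show ?case by (intro exI[of _ 0]) auto
next
  case (Suc s)
  then obtain l where l: "binary_digit_sum l = s"
    "\<And>k. k \<le> n \<Longrightarrow> real (U2 l k) / fact k \<ge> fps_nth (lim_fps ^ s) k" by blast
  have "fps_nth (lim_fps ^ Suc s) k \<le> real (U2 (2 ^ n * Suc (2 * l)) k) / fact k" if "k \<le> n" for k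
  proof -
    have "fps_nth (lim_fps ^ Suc s) k = (\<Sum>j\<le>k. lim_coeff 1 j * fps_nth (lim_fps ^ s) (k - j))"
      by (simp add: fps_mult_nth lim_fps_def atLeast0AtMost)
    also have "\<dots> \<le> (\<Sum>j\<le>k. (real (U2 (2 ^ n) j) / fact j) * (real (U2 l (k - j)) / fact (k - j)))"
      using that by (intro sum_mono mult_mono l)
        (auto simp: U2_power2_eq lim_coeff_nonneg lim_fps_power_nonneg)
    also have "\<dots> = real (\<Sum>j\<le>k. (k choose j) * U2 (2 ^ n) j * U2 l (k - j)) / fact k"
      unfolding of_nat_sum sum_divide_distrib
      by (rule sum.cong) (auto simp: binomial_fact field_simps)
    also have "\<dots> \<le> real (U2 (2 ^ n * Suc (2 * l)) k) / fact k"
      by (intro divide_right_mono of_nat_mono U2_split_ge) simp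
    finally show ?thesis .
  qed
  moreover have "binary_digit_sum (2 ^ n * Suc (2 * l)) = Suc s"
    by (simp only: binary_digit_sum_power2_mult binary_digit_sum_double_Suc l)
  ultimately show ?case by blast
qed

lemma W2_eq_lim_fps_power:
  assumes "s \<ge> 1"
  shows "real (W2 s n) / fact n = fps_nth (lim_fps ^ s) n"
proof (rule antisym)
  obtain l where l: "binary_digit_sum l = s" "U2 l n = W2 s n"
    using W2_attained[OF assms] by blast
  then show "real (W2 s n) / fact n \<le> fps_nth (lim_fps ^ s) n"
    using U2_le_lim_fps_power[of l s n] by simp
next
  obtain l where l: "binary_digit_sum l = s" "real (U2 l n) / fact n \<ge> fps_nth (lim_fps ^ s) n"
    using ex_U2_ge_lim_fps_power[of s n] by blast
  have "l > 0" using l(1) assms by (cases l) auto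
  then have "U2 l n \<le> W2 s n" using l by (intro U2_le_W2)
  then have "real (U2 l n) / fact n \<le> real (W2 s n) / fact n" by (intro divide_right_mono) auto
  with l show "fps_nth (lim_fps ^ s) n \<le> real (W2 s n) / fact n" by linarith
qed

section \<open>Absolutely summable power series\<close>

text \<open>The algebra of power series absolutely convergent on the closed unit disc. Its members
  have bounded coefficients, which is the error term wanted once \<open>z = (3/2) X\<close> is
  undone.\<close>

definition fps_l1 :: "real fps \<Rightarrow> bool" where
  "fps_l1 f \<longleftrightarrow> summable (\<lambda>n. \<bar>fps_nth f n\<bar>)"

definition fps_norm1 :: "real fps \<Rightarrow> real" where
  "fps_norm1 f = (\<Sum>n. \<bar>fps_nth f n\<bar>)"

definition fps_value :: "real fps \<Rightarrow> real \<Rightarrow> real" where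
  "fps_value f x = (\<Sum>n. fps_nth f n * x ^ n)"

lemma fps_l1I:
  assumes "\<And>N. (\<Sum>n<N. \<bar>fps_nth f n\<bar>) \<le> C"
  shows "fps_l1 f" "fps_norm1 f \<le> C"
proof -
  show "fps_l1 f" unfolding fps_l1_def by (rule summableI_nonneg_bounded[OF _ assms]) simp
  then show "fps_norm1 f \<le> C"
    unfolding fps_l1_def fps_norm1_def by (rule suminf_le_const) (rule assms)
qed

lemma sum_le_fps_norm1: "fps_l1 f \<Longrightarrow> finite A \<Longrightarrow> (\<Sum>n\<in>A. \<bar>fps_nth f n\<bar>) \<le> fps_norm1 f"
  unfolding fps_l1_def fps_norm1_def by (rule sum_le_suminf) auto

lemma fps_nth_le_norm1: "fps_l1 f \<Longrightarrow> \<bar>fps_nth f n\<bar> \<le> fps_norm1 f"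
  using sum_le_fps_norm1[of f "{n}"] by simp

lemma fps_norm1_nonneg: "fps_l1 f \<Longrightarrow> fps_norm1 f \<ge> 0"
  using sum_le_fps_norm1[of f "{}"] by simp

lemma fps_l1_add: "fps_l1 f \<Longrightarrow> fps_l1 g \<Longrightarrow> fps_l1 (f + g)"
  and fps_norm1_add: "fps_l1 f \<Longrightarrow> fps_l1 g \<Longrightarrow> fps_norm1 (f + g) \<le> fps_norm1 f + fps_norm1 g"
proof -
  assume fg: "fps_l1 f" "fps_l1 g"
  have "(\<Sum>n<N. \<bar>fps_nth (f + g) n\<bar>) \<le> fps_norm1 f + fps_norm1 g" for N
  proof -
    have "(\<Sum>n<N. \<bar>fps_nth (f + g) n\<bar>) \<le> (\<Sum>n<N. \<bar>fps_nth f n\<bar> + \<bar>fps_nth g n\<bar>)"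
      by (intro sum_mono) (simp add: abs_triangle_ineq)
    also have "\<dots> = (\<Sum>n<N. \<bar>fps_nth f n\<bar>) + (\<Sum>n<N. \<bar>fps_nth g n\<bar>)" by (rule sum.distrib)
    finally show ?thesis using sum_le_fps_norm1[OF fg(1), of "{..<N}"] sum_le_fps_norm1[OF fg(2), of "{..<N}"]
      by simp
  qed
  from fps_l1I[OF this] show "fps_l1 (f + g)" "fps_norm1 (f + g) \<le> fps_norm1 f + fps_norm1 g" .
qed

lemma fps_l1_const_mult: "fps_l1 f \<Longrightarrow> fps_l1 (fps_const c * f)"
  and fps_norm1_const_mult: "fps_l1 f \<Longrightarrow> fps_norm1 (fps_const c * f) = \<bar>c\<bar> * fps_norm1 f"
  by (auto simp: fps_l1_def fps_norm1_def abs_mult suminf_mult summable_mult)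

lemma fps_l1_minus [simp]: "fps_l1 (- f) = fps_l1 f"
  and fps_norm1_minus [simp]: "fps_norm1 (- f) = fps_norm1 f"
  by (simp_all add: fps_l1_def fps_norm1_def)

lemma fps_l1_diff: "fps_l1 f \<Longrightarrow> fps_l1 g \<Longrightarrow> fps_l1 (f - g)"
  and fps_norm1_diff: "fps_l1 f \<Longrightarrow> fps_l1 g \<Longrightarrow> fps_norm1 (f - g) \<le> fps_norm1 f + fps_norm1 g"
  using fps_l1_add[of f "- g"] fps_norm1_add[of f "- g"] by simp_all

lemma fps_l1_mult: "fps_l1 f \<Longrightarrow> fps_l1 g \<Longrightarrow> fps_l1 (f * g)"
  and fps_norm1_mult: "fps_l1 f \<Longrightarrow> fps_l1 g \<Longrightarrow> fps_norm1 (f * g) \<le> fps_norm1 f * fps_norm1 g"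
proof -
  assume fg: "fps_l1 f" "fps_l1 g"
  let ?c = "\<lambda>n. \<Sum>i\<le>n. \<bar>fps_nth f i\<bar> * \<bar>fps_nth g (n - i)\<bar>"
  have c: "?c sums (fps_norm1 f * fps_norm1 g)"
    using Cauchy_product_sums[of "\<lambda>n. \<bar>fps_nth f n\<bar>" "\<lambda>n. \<bar>fps_nth g n\<bar>"] fg
    by (simp add: fps_l1_def fps_norm1_def)
  have le: "\<bar>fps_nth (f * g) n\<bar> \<le> ?c n" for n
  proof -
    have "\<bar>fps_nth (f * g) n\<bar> \<le> (\<Sum>i\<le>n. \<bar>fps_nth f i * fps_nth g (n - i)\<bar>)"
      unfolding fps_mult_nth atLeast0AtMost by (rule sum_abs)
    then show ?thesis by (simp add: abs_mult)
  qed
  have "(\<Sum>n<N. \<bar>fps_nth (f * g) n\<bar>) \<le> fps_norm1 f * fps_norm1 g" for N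
  proof -
    have "(\<Sum>n<N. \<bar>fps_nth (f * g) n\<bar>) \<le> (\<Sum>n<N. ?c n)" by (intro sum_mono le)
    also have "\<dots> \<le> (\<Sum>n. ?c n)"
      by (rule sum_le_suminf) (use c in \<open>auto simp: sums_iff intro: sum_nonneg\<close>)
    finally show ?thesis using c by (simp add: sums_iff)
  qed
  from fps_l1I[OF this] show "fps_l1 (f * g)" "fps_norm1 (f * g) \<le> fps_norm1 f * fps_norm1 g" .
qed

lemma fps_l1_const: "fps_l1 (fps_const c)"
  and fps_norm1_const: "fps_norm1 (fps_const c) = \<bar>c\<bar>"
proof -
  have "(\<lambda>n. \<bar>fps_nth (fps_const c) n\<bar>) sums (\<Sum>n\<in>{0}. \<bar>fps_nth (fps_const c) n\<bar>)"
    by (rule sums_finite) auto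
  then show "fps_l1 (fps_const c)" "fps_norm1 (fps_const c) = \<bar>c\<bar>"
    by (auto simp: fps_l1_def fps_norm1_def sums_iff)
qed

lemma fps_l1_X: "fps_l1 fps_X"
proof -
  have "(\<lambda>n. \<bar>fps_nth (fps_X :: real fps) n\<bar>) sums (\<Sum>n\<in>{1}. \<bar>fps_nth (fps_X :: real fps) n\<bar>)"
    by (rule sums_finite) auto
  then show ?thesis by (auto simp: fps_l1_def sums_iff)
qed

lemma fps_l1_1: "fps_l1 1"
  using fps_l1_const[of 1] by simp

lemma fps_l1_power: "fps_l1 f \<Longrightarrow> fps_l1 (f ^ n)"
  by (induction n) (auto simp: fps_l1_1 fps_l1_mult)

lemma fps_l1_X_power_mult [simp]: "fps_l1 (fps_X ^ k * f) = fps_l1 f"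
  and fps_norm1_X_power_mult: "fps_l1 f \<Longrightarrow> fps_norm1 (fps_X ^ k * f) = fps_norm1 f"
proof -
  let ?s = "\<lambda>n. \<bar>fps_nth (fps_X ^ k * f) n\<bar>"
  have shift: "?s (n + k) = \<bar>fps_nth f n\<bar>" for n by (simp add: fps_X_power_mult_nth)
  show "fps_l1 (fps_X ^ k * f) = fps_l1 f"
    unfolding fps_l1_def by (subst summable_iff_shift[of ?s k, symmetric]) (simp only: shift)
  assume "fps_l1 f"
  then have "summable ?s"
    unfolding fps_l1_def by (subst summable_iff_shift[of ?s k, symmetric]) (simp only: shift)
  then show "fps_norm1 (fps_X ^ k * f) = fps_norm1 f"
    unfolding fps_norm1_def
    by (subst suminf_split_initial_segment[of ?s k]) (simp_all only: shift, simp add: fps_X_power_mult_nth)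
qed

lemmas fps_l1_intros = fps_l1_add fps_l1_diff fps_l1_mult fps_l1_const fps_l1_X fps_l1_1 fps_l1_power

section \<open>Evaluation at points of [-1, 1]\<close>

lemma summable_fps_value:
  assumes "fps_l1 f" "\<bar>x\<bar> \<le> 1"
  shows "summable (\<lambda>n. \<bar>fps_nth f n * x ^ n\<bar>)"
proof (rule summable_comparison_test')
  show "summable (\<lambda>n. \<bar>fps_nth f n\<bar>)" using assms(1) by (simp add: fps_l1_def)
  show "norm \<bar>fps_nth f n * x ^ n\<bar> \<le> \<bar>fps_nth f n\<bar>" if "n \<ge> 0" for n
    using assms(2) by (simp add: abs_mult power_abs mult_left_le power_le_one)
qed

lemma fps_value_sums:
  assumes "fps_l1 f" "\<bar>x\<bar> \<le> 1"
  shows "(\<lambda>n. fps_nth f n * x ^ n) sums fps_value f x"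
  unfolding fps_value_def by (rule summable_sums[OF summable_rabs_cancel[OF summable_fps_value[OF assms]]])

lemma abs_fps_value_le:
  assumes "fps_l1 f" "\<bar>x\<bar> \<le> 1"
  shows "\<bar>fps_value f x\<bar> \<le> fps_norm1 f"
proof -
  have "\<bar>fps_value f x\<bar> \<le> (\<Sum>n. \<bar>fps_nth f n * x ^ n\<bar>)"
    unfolding fps_value_def by (rule summable_rabs[OF summable_fps_value[OF assms]])
  also have "\<dots> \<le> fps_norm1 f"
    unfolding fps_norm1_def
  proof (rule suminf_le[OF _ summable_fps_value[OF assms]])
    show "summable (\<lambda>n. \<bar>fps_nth f n\<bar>)" using assms(1) by (simp add: fps_l1_def)
    show "\<bar>fps_nth f n * x ^ n\<bar> \<le> \<bar>fps_nth f n\<bar>" for n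
      using assms(2) by (simp add: abs_mult power_abs mult_left_le power_le_one)
  qed
  finally show ?thesis .
qed

lemma fps_value_const [simp]: "fps_value (fps_const c) x = c"
  unfolding fps_value_def by (subst suminf_finite[of "{0}"]) auto

lemma fps_value_X [simp]: "fps_value fps_X x = x"
  unfolding fps_value_def by (subst suminf_finite[of "{1}"]) auto

lemma fps_value_1 [simp]: "fps_value 1 x = 1"
  using fps_value_const[of 1 x] by simp

lemma fps_value_unique: "(\<lambda>n. fps_nth f n * x ^ n) sums y \<Longrightarrow> fps_value f x = y"
  unfolding fps_value_def by (rule sums_unique[symmetric])

lemma fps_value_add:
  assumes "fps_l1 f" "fps_l1 g" "\<bar>x\<bar> \<le> 1"
  shows "fps_value (f + g) x = fps_value f x + fps_value g x"
proof (rule fps_value_unique)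
  show "(\<lambda>n. fps_nth (f + g) n * x ^ n) sums (fps_value f x + fps_value g x)"
    using sums_add[OF fps_value_sums[OF assms(1,3)] fps_value_sums[OF assms(2,3)]]
    by (simp only: fps_add_nth distrib_right)
qed

lemma fps_value_mult:
  assumes "fps_l1 f" "fps_l1 g" "\<bar>x\<bar> \<le> 1"
  shows "fps_value (f * g) x = fps_value f x * fps_value g x"
proof (rule fps_value_unique)
  have "(\<Sum>i\<le>n. (fps_nth f i * x ^ i) * (fps_nth g (n - i) * x ^ (n - i))) = fps_nth (f * g) n * x ^ n" for n
    unfolding fps_mult_nth atLeast0AtMost sum_distrib_right
  proof (rule sum.cong)
    fix i assume "i \<in> {..n}"
    then have "x ^ n = x ^ i * x ^ (n - i)" by (simp flip: power_add)
    then show "fps_nth f i * x ^ i * (fps_nth g (n - i) * x ^ (n - i))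
        = fps_nth f i * fps_nth g (n - i) * x ^ n" by simp
  qed simp
  moreover have "(\<lambda>n. \<Sum>i\<le>n. (fps_nth f i * x ^ i) * (fps_nth g (n - i) * x ^ (n - i)))
      sums (fps_value f x * fps_value g x)"
    unfolding fps_value_def
    by (rule Cauchy_product_sums) (simp_all only: real_norm_def summable_fps_value assms)
  ultimately show "(\<lambda>n. fps_nth (f * g) n * x ^ n) sums (fps_value f x * fps_value g x)"
    by (simp only:)
qed

lemma fps_value_diff:
  assumes "fps_l1 f" "fps_l1 g" "\<bar>x\<bar> \<le> 1"
  shows "fps_value (f - g) x = fps_value f x - fps_value g x"
proof (rule fps_value_unique)
  show "(\<lambda>n. fps_nth (f - g) n * x ^ n) sums (fps_value f x - fps_value g x)"
    using sums_diff[OF fps_value_sums[OF assms(1,3)] fps_value_sums[OF assms(2,3)]]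
    by (simp only: fps_sub_nth left_diff_distrib)
qed

lemma fps_value_power: "fps_l1 f \<Longrightarrow> \<bar>x\<bar> \<le> 1 \<Longrightarrow> fps_value (f ^ n) x = fps_value f x ^ n"
  by (induction n) (auto simp: fps_value_mult fps_l1_power)

lemmas fps_value_simps = fps_value_add fps_value_diff fps_value_mult fps_value_power

text \<open>Dividing forwards by \<open>1 - X / x\<close> would amplify by \<open>1 / x > 1\<close>.
  The quotient is given instead by the tails of \<open>f\<close> at \<open>x\<close>, which obey a
  backward recursion damped by the factor \<open>x\<close>; summing it yields the norm
  bound.\<close>

lemma fps_l1_linear_division:
  assumes f: "fps_l1 f" and x: "0 < x" "x < 1"
  shows "\<exists>g. fps_l1 g \<and> fps_norm1 g \<le> fps_norm1 f * (x / (1 - x))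
    \<and> f = fps_const (fps_value f x) + (1 - fps_const (1 / x) * fps_X) * g"
proof -
  define t where "t = (\<lambda>n. \<Sum>k. fps_nth f (k + Suc n) * x ^ Suc k)"
  define g where "g = Abs_fps (\<lambda>n. - t n)"
  have abs_x: "\<bar>x\<bar> \<le> 1" using x by simp
  have dom: "\<bar>fps_nth f (k + n) * x ^ k\<bar> \<le> \<bar>fps_nth f (k + n)\<bar>" for k n
    using x by (simp add: abs_mult power_abs mult_left_le power_le_one)
  have sm: "summable (\<lambda>k. \<bar>fps_nth f (k + n) * x ^ k\<bar>)" for n
  proof (rule summable_comparison_test')
    show "summable (\<lambda>k. \<bar>fps_nth f (k + n)\<bar>)"
      using f unfolding fps_l1_def by (rule summable_ignore_initial_segment)
  qed (use dom in simp)
  have smt: "summable (\<lambda>k. fps_nth f (k + n) * x ^ k)" for n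
    by (rule summable_rabs_cancel[OF sm])
  have t_alt: "t n = x * (\<Sum>k. fps_nth f (k + Suc n) * x ^ k)" for n
    unfolding t_def using suminf_mult[OF smt[of "Suc n"], of x] by (simp add: mult_ac)
  have t_rec: "t n = x * (fps_nth f (Suc n) + t (Suc n))" for n
  proof -
    have "(\<Sum>k. fps_nth f (k + Suc n) * x ^ k)
        = fps_nth f (Suc n) + (\<Sum>k. fps_nth f (Suc k + Suc n) * x ^ Suc k)"
      using suminf_split_head[OF smt[of "Suc n"]] by simp
    then show ?thesis unfolding t_alt[of n] by (simp add: t_def)
  qed
  have t_abs: "\<bar>t n\<bar> \<le> fps_norm1 f" for n
  proof -
    have "\<bar>\<Sum>k. fps_nth f (k + Suc n) * x ^ k\<bar> \<le> (\<Sum>k. \<bar>fps_nth f (k + Suc n) * x ^ k\<bar>)"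
      by (rule summable_rabs[OF sm])
    also have "\<dots> \<le> fps_norm1 f"
    proof (rule suminf_le_const[OF sm])
      fix N
      have "(\<Sum>k<N. \<bar>fps_nth f (k + Suc n) * x ^ k\<bar>) \<le> (\<Sum>k<N. \<bar>fps_nth f (k + Suc n)\<bar>)"
        by (intro sum_mono dom)
      also have "\<dots> = (\<Sum>m\<in>(\<lambda>k. k + Suc n) ` {..<N}. \<bar>fps_nth f m\<bar>)"
        by (subst sum.reindex) (auto simp: inj_on_def)
      also have "\<dots> \<le> fps_norm1 f" by (rule sum_le_fps_norm1[OF f]) simp
      finally show "(\<Sum>k<N. \<bar>fps_nth f (k + Suc n) * x ^ k\<bar>) \<le> fps_norm1 f" .
    qed
    finally have "x * \<bar>\<Sum>k. fps_nth f (k + Suc n) * x ^ k\<bar> \<le> 1 * fps_norm1 f"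
      using x fps_norm1_nonneg[OF f] by (intro mult_mono) auto
    then show ?thesis unfolding t_alt using x by (simp add: abs_mult)
  qed
  have part: "(1 - x) * (\<Sum>n<N. \<bar>t n\<bar>) \<le> x * fps_norm1 f + \<bar>t N\<bar>" for N
  proof -
    have "(\<Sum>n<N. \<bar>t n\<bar>) \<le> (\<Sum>n<N. x * (\<bar>fps_nth f (Suc n)\<bar> + \<bar>t (Suc n)\<bar>))"
    proof (rule sum_mono)
      fix n
      have "\<bar>t n\<bar> = x * \<bar>fps_nth f (Suc n) + t (Suc n)\<bar>"
        using t_rec[of n] x by (simp add: abs_mult)
      also have "\<dots> \<le> x * (\<bar>fps_nth f (Suc n)\<bar> + \<bar>t (Suc n)\<bar>)"
        using x by (intro mult_left_mono abs_triangle_ineq) auto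
      finally show "\<bar>t n\<bar> \<le> x * (\<bar>fps_nth f (Suc n)\<bar> + \<bar>t (Suc n)\<bar>)" .
    qed
    also have "\<dots> = x * ((\<Sum>n<N. \<bar>fps_nth f (Suc n)\<bar>) + (\<Sum>n<N. \<bar>t (Suc n)\<bar>))"
      by (simp only: sum.distrib distrib_left sum_distrib_left)
    also have "\<dots> \<le> x * (fps_norm1 f + ((\<Sum>n<N. \<bar>t n\<bar>) + \<bar>t N\<bar>))"
    proof (intro mult_left_mono add_mono)
      have "(\<Sum>n<N. \<bar>fps_nth f (Suc n)\<bar>) = (\<Sum>m\<in>Suc ` {..<N}. \<bar>fps_nth f m\<bar>)"
        by (subst sum.reindex) auto
      also have "\<dots> \<le> fps_norm1 f" by (rule sum_le_fps_norm1[OF f]) simp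
      finally show "(\<Sum>n<N. \<bar>fps_nth f (Suc n)\<bar>) \<le> fps_norm1 f" .
      show "(\<Sum>n<N. \<bar>t (Suc n)\<bar>) \<le> (\<Sum>n<N. \<bar>t n\<bar>) + \<bar>t N\<bar>"
        using sum.lessThan_Suc_shift[of "\<lambda>n. \<bar>t n\<bar>" N] by simp
    qed (use x in auto)
    also have "\<dots> \<le> x * fps_norm1 f + x * (\<Sum>n<N. \<bar>t n\<bar>) + \<bar>t N\<bar>"
      using x mult_right_mono[of x 1 "\<bar>t N\<bar>"] by (simp add: algebra_simps)
    finally show ?thesis by (simp add: algebra_simps)
  qed
  \<comment> \<open>First a crude bound, just to see that \<open>g\<close> is summable. Then
    \<open>t N\<close> tends to 0 and drops out of \<open>part\<close>, which leaves the better
    constant \<open>x / (1 - x)\<close>.\<close>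
  have "(\<Sum>n<N. \<bar>fps_nth g n\<bar>) \<le> 2 * fps_norm1 f / (1 - x)" for N
  proof -
    have "x * fps_norm1 f \<le> 1 * fps_norm1 f"
      using x fps_norm1_nonneg[OF f] by (intro mult_right_mono) auto
    then have "(1 - x) * (\<Sum>n<N. \<bar>t n\<bar>) \<le> 2 * fps_norm1 f" using part[of N] t_abs[of N] by linarith
    then show ?thesis using x by (simp add: g_def field_simps)
  qed
  from fps_l1I(1)[OF this] have g: "fps_l1 g" .
  then have t_sm: "summable (\<lambda>n. \<bar>t n\<bar>)" by (simp add: fps_l1_def g_def)
  then have "(\<lambda>n. \<bar>t n\<bar>) \<longlonglongrightarrow> 0" by (rule summable_LIMSEQ_zero)
  then have lim1: "(\<lambda>N. x * fps_norm1 f + \<bar>t N\<bar>) \<longlonglongrightarrow> x * fps_norm1 f + 0" by (intro tendsto_intros)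
  have lim2: "(\<lambda>N. (1 - x) * (\<Sum>n<N. \<bar>t n\<bar>)) \<longlonglongrightarrow> (1 - x) * fps_norm1 g"
    using summable_LIMSEQ[OF t_sm] by (intro tendsto_intros) (simp add: fps_norm1_def g_def)
  have "(1 - x) * fps_norm1 g \<le> x * fps_norm1 f + 0"
    by (rule LIMSEQ_le[OF lim2 lim1]) (use part in blast)
  then have "fps_norm1 g \<le> fps_norm1 f * (x / (1 - x))" using x by (simp add: field_simps)
  moreover have "f = fps_const (fps_value f x) + (1 - fps_const (1 / x) * fps_X) * g"
  proof (rule fps_ext)
    fix n
    have eq: "(1 - fps_const (1 / x) * fps_X) * g = g - fps_const (1 / x) * (fps_X * g)"
      by (simp add: algebra_simps)
    show "fps_nth f n = fps_nth (fps_const (fps_value f x) + (1 - fps_const (1 / x) * fps_X) * g) n"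
    proof (cases n)
      case 0
      have "fps_value f x = fps_nth f 0 + t 0"
        using suminf_split_head[OF smt[of 0]] by (simp add: fps_value_def t_def)
      then show ?thesis unfolding eq using 0 by (simp add: g_def)
    next
      case (Suc m)
      then show ?thesis unfolding eq using t_rec[of m] x by (simp add: g_def field_simps)
    qed
  qed
  ultimately show ?thesis using g by blast
qed

text \<open>The inverse exists as a formal series; only its summability is in question. From
  \<open>g = 1 - h * g\<close> its partial sums satisfy \<open>S \<le> 1 + fps_norm1 h * S\<close>,
  which bounds them.\<close>

lemma fps_l1_inverse_near_1:
  assumes h: "fps_l1 h" and lt: "fps_norm1 h < 1"
  shows "fps_l1 (inverse (1 + h))" "(1 + h) * inverse (1 + h) = 1"
proof -
  have "\<bar>fps_nth h 0\<bar> < 1" using fps_nth_le_norm1[OF h, of 0] lt by linarith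
  then have "fps_nth (1 + h) 0 \<noteq> 0" by auto
  then show inv: "(1 + h) * inverse (1 + h) = 1" by (simp add: inverse_mult_eq_1')
  define g where "g = inverse (1 + h)"
  have g: "g = 1 - h * g" using inv unfolding g_def by (simp add: algebra_simps)
  have "(\<Sum>n<N. \<bar>fps_nth g n\<bar>) \<le> 1 / (1 - fps_norm1 h)" for N
  proof -
    define S where "S = (\<Sum>n<N. \<bar>fps_nth g n\<bar>)"
    have "\<bar>fps_nth g n\<bar> \<le> (if n = 0 then 1 else 0) + (\<Sum>i\<le>n. \<bar>fps_nth h i\<bar> * \<bar>fps_nth g (n - i)\<bar>)" for n
    proof -
      have "fps_nth g n = (if n = 0 then 1 else 0) - (\<Sum>i\<le>n. fps_nth h i * fps_nth g (n - i))"
        by (subst g) (simp add: fps_mult_nth atLeast0AtMost)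
      also have "\<bar>\<dots>\<bar> \<le> \<bar>if n = 0 then 1 else 0\<bar> + \<bar>\<Sum>i\<le>n. fps_nth h i * fps_nth g (n - i)\<bar>"
        by (rule abs_triangle_ineq4)
      also have "\<bar>\<Sum>i\<le>n. fps_nth h i * fps_nth g (n - i)\<bar> \<le> (\<Sum>i\<le>n. \<bar>fps_nth h i * fps_nth g (n - i)\<bar>)"
        by (rule sum_abs)
      finally show ?thesis by (simp add: abs_mult)
    qed
    then have "S \<le> (\<Sum>n<N. (if n = 0 then 1 else 0) + (\<Sum>i\<le>n. \<bar>fps_nth h i\<bar> * \<bar>fps_nth g (n - i)\<bar>))"
      unfolding S_def by (intro sum_mono)
    also have "\<dots> = (\<Sum>n<N. (if n = 0 then 1 else 0)) + (\<Sum>n<N. \<Sum>i\<le>n. \<bar>fps_nth h i\<bar> * \<bar>fps_nth g (n - i)\<bar>)"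
      by (rule sum.distrib)
    also have "\<dots> \<le> 1 + (\<Sum>i<N. \<Sum>j<N. \<bar>fps_nth h i\<bar> * \<bar>fps_nth g j\<bar>)"
    proof (rule add_mono)
      show "(\<Sum>n<N. if n = 0 then 1 else 0) \<le> (1::real)" by (cases N) (auto simp: sum.lessThan_Suc_shift)
      have "(\<Sum>n<N. \<Sum>i\<le>n. \<bar>fps_nth h i\<bar> * \<bar>fps_nth g (n - i)\<bar>)
          = (\<Sum>(i, j)\<in>{(i, j). i + j < N}. \<bar>fps_nth h i\<bar> * \<bar>fps_nth g j\<bar>)"
        by (rule sum.triangle_reindex[symmetric])
      also have "\<dots> \<le> (\<Sum>(i, j)\<in>{..<N} \<times> {..<N}. \<bar>fps_nth h i\<bar> * \<bar>fps_nth g j\<bar>)"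
        by (rule sum_mono2) auto
      also have "\<dots> = (\<Sum>i<N. \<Sum>j<N. \<bar>fps_nth h i\<bar> * \<bar>fps_nth g j\<bar>)"
        by (rule sum.cartesian_product[symmetric])
      finally show "(\<Sum>n<N. \<Sum>i\<le>n. \<bar>fps_nth h i\<bar> * \<bar>fps_nth g (n - i)\<bar>)
          \<le> (\<Sum>i<N. \<Sum>j<N. \<bar>fps_nth h i\<bar> * \<bar>fps_nth g j\<bar>)" .
    qed
    also have "(\<Sum>i<N. \<Sum>j<N. \<bar>fps_nth h i\<bar> * \<bar>fps_nth g j\<bar>) = (\<Sum>i<N. \<bar>fps_nth h i\<bar>) * S"
      by (simp add: S_def sum_product)
    also have "\<dots> \<le> fps_norm1 h * S"
      by (intro mult_right_mono sum_le_fps_norm1 h) (auto simp: S_def sum_nonneg)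
    finally have "S * (1 - fps_norm1 h) \<le> 1" by (simp add: algebra_simps)
    then show ?thesis using lt by (simp add: S_def field_simps)
  qed
  from fps_l1I(1)[OF this] show "fps_l1 (inverse (1 + h))" by (simp add: g_def)
qed

lemma fps_l1_geometric:
  assumes "\<bar>c\<bar> < 1"
  shows "fps_l1 (Abs_fps (\<lambda>n. c ^ n))" "fps_norm1 (Abs_fps (\<lambda>n. c ^ n)) = 1 / (1 - \<bar>c\<bar>)"
  using geometric_sums[of "\<bar>c\<bar>"] assms
  by (simp_all add: fps_l1_def fps_norm1_def power_abs sums_iff)

lemma geometric_fps_mult: "(1 - fps_const (c::'a::comm_ring_1) * fps_X) * Abs_fps (\<lambda>n. c ^ n) = 1"
proof (rule fps_ext)
  fix n
  have "(1 - fps_const c * fps_X) * Abs_fps (\<lambda>n. c ^ n)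
      = Abs_fps (\<lambda>n. c ^ n) - fps_const c * (fps_X * Abs_fps (\<lambda>n. c ^ n))"
    by (simp add: algebra_simps)
  then show "fps_nth ((1 - fps_const c * fps_X) * Abs_fps (\<lambda>n. c ^ n)) n = fps_nth 1 n"
    by (cases n) auto
qed

text \<open>If \<open>g\<close> times a series \<open>P\<close> is close to a linear polynomial without zero in the closed unit disc,
  then \<open>g\<close> is a unit of the algebra; \<open>g * P\<close> is given here only through its product with
  \<open>1 - X / x\<close>, which is close to the quadratic polynomial \<open>1 - p X + s X\<^sup>2\<close>.\<close>

lemma fps_l1_unit_criterion:
  assumes l1: "fps_l1 g" "fps_l1 P" "fps_l1 r" and x: "0 < x" "x < 1"
    and eq: "(1 - fps_const (1 / x) * fps_X) * g * P
        = 1 - fps_const p * fps_X + fps_const s * fps_X ^ 2 + r"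
    and s: "s > 0"
    and small: "fps_norm1 r * (x / (1 - x)) < x * (p - s * x) - s * x"
  shows "\<exists>g'. fps_l1 g' \<and> g * g' = 1"
proof -
  \<comment> \<open>Division of the quadratic polynomial by \<open>1 - X / x\<close>: the quotient
    is \<open>A - B X\<close> and the remainder is the value \<open>1 - A\<close> at
    \<open>x\<close>.\<close>
  define A where "A = x * (p - s * x)"
  define B where "B = s * x"
  let ?l = "1 - fps_const (1 / x) * fps_X"
  obtain d where d: "fps_l1 d" "fps_norm1 d \<le> fps_norm1 r * (x / (1 - x))"
    "r = fps_const (fps_value r x) + ?l * d"
    using fps_l1_linear_division[OF l1(3) x] by blast
  have AB: "0 < B" "B < A"
  proof -
    show "0 < B" using s x by (simp add: B_def)
    have "0 \<le> fps_norm1 r * (x / (1 - x))" using x fps_norm1_nonneg[OF l1(3)] by simp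
    then show "B < A" using small by (simp add: A_def B_def)
  qed
  have q: "1 - fps_const p * fps_X + fps_const s * fps_X ^ 2
      = fps_const (1 - A) + ?l * (fps_const A - fps_const B * fps_X)"
  proof (rule fps_ext)
    fix n
    have "?l * (fps_const A - fps_const B * fps_X) = fps_const A
        - (fps_const B + fps_const (A / x)) * fps_X + fps_const (B / x) * fps_X ^ 2"
    proof -
      have c: "fps_const (A / x) = fps_const A * fps_const (1 / x)"
        "fps_const (B / x) = fps_const B * fps_const (1 / x)" by simp_all
      show ?thesis unfolding c
        by (simp add: algebra_simps power2_eq_square del: fps_const_mult fps_const_add)
    qed
    moreover have "B + A / x = p" "B / x = s" using x by (auto simp: A_def B_def field_simps)
    ultimately have "?l * (fps_const A - fps_const B * fps_X) = fps_const A
        - fps_const p * fps_X + fps_const s * fps_X ^ 2" by simp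
    then show "fps_nth (1 - fps_const p * fps_X + fps_const s * fps_X ^ 2) n
        = fps_nth (fps_const (1 - A) + ?l * (fps_const A - fps_const B * fps_X)) n" by simp
  qed
  let ?m = "fps_const A - fps_const B * fps_X + d"
  have "?l * (g * P) = ?l * g * P" by (rule mult.assoc[symmetric])
  also note eq
  also have "1 - fps_const p * fps_X + fps_const s * fps_X ^ 2 + r
      = (fps_const (1 - A) + ?l * (fps_const A - fps_const B * fps_X))
        + (fps_const (fps_value r x) + ?l * d)"
    by (rule arg_cong2[where f = "(+)", OF q d(3)])
  also have "\<dots> = (fps_const (1 - A) + fps_const (fps_value r x)) + ?l * ?m"
    by (simp only: distrib_left add_ac)
  also have "fps_const (1 - A) + fps_const (fps_value r x) = fps_const (1 - A + fps_value r x)"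
    by (rule fps_const_add)
  finally have lgP: "?l * (g * P) = fps_const (1 - A + fps_value r x) + ?l * ?m" .
  \<comment> \<open>Everything with the factor \<open>1 - X / x\<close> vanishes at
    \<open>x\<close>, so the constant in \<open>lgP\<close> is zero. Thus the quadratic polynomial
    need not vanish exactly at \<open>x\<close>.\<close>
  have "fps_value (?l * (g * P)) x = 0" "fps_value (?l * ?m) x = 0"
    using x by (simp_all add: fps_value_simps fps_l1_intros l1 d(1))
  moreover have "fps_value (fps_const (1 - A + fps_value r x) + ?l * ?m) x
      = (1 - A + fps_value r x) + fps_value (?l * ?m) x"
    using x by (subst fps_value_add) (simp_all add: fps_l1_intros l1 d(1))
  ultimately have "1 - A + fps_value r x = 0" unfolding lgP by linarith
  then have "?l * (g * P) = ?l * ?m" unfolding lgP by simp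
  moreover have "?l \<noteq> 0"
  proof
    assume "?l = 0"
    then have "fps_nth ?l 0 = 0" by simp
    then show False by simp
  qed
  ultimately have gP: "g * P = ?m" by simp
  define w where "w = Abs_fps (\<lambda>n. (B / A) ^ n)"
  have BA: "\<bar>B / A\<bar> < 1" using AB by simp
  have w: "fps_l1 w" "fps_norm1 w = 1 / (1 - B / A)"
    using fps_l1_geometric[OF BA] AB by (simp_all add: w_def)
  \<comment> \<open>\<open>1 + h\<close> is what remains of \<open>A - B X + d\<close> after
    multiplication by the inverse of \<open>A - B X\<close>, whose norm is
    \<open>1 / (A - B)\<close>.\<close>
  define h where "h = fps_const (1 / A) * (w * d)"
  have "fps_const A - fps_const B * fps_X = fps_const A * (1 - fps_const (B / A) * fps_X)"
    using AB by (simp add: algebra_simps flip: mult.assoc)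
  then have "?m * (fps_const (1 / A) * w) = 1 + h"
    using geometric_fps_mult[of "B / A"] AB
    by (simp add: h_def w_def ring_distribs mult.assoc) (simp add: mult.left_commute flip: mult.assoc)
  moreover have h: "fps_l1 h" "fps_norm1 h < 1"
  proof -
    show "fps_l1 h" by (simp add: h_def fps_l1_intros w d(1))
    have "fps_norm1 h = (1 / A) * fps_norm1 (w * d)"
      using AB by (simp add: h_def fps_norm1_const_mult fps_l1_intros w d(1))
    also have "\<dots> \<le> (1 / A) * (fps_norm1 w * fps_norm1 d)"
      using AB by (intro mult_left_mono fps_norm1_mult w d(1)) auto
    also have "\<dots> = fps_norm1 d / (A - B)" using AB by (simp add: w field_simps)
    also have "\<dots> < 1" using AB d(2) small by (simp add: A_def B_def)
    finally show "fps_norm1 h < 1" .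
  qed
  ultimately have "g * (P * (fps_const (1 / A) * w) * inverse (1 + h)) = 1"
    using fps_l1_inverse_near_1(2)[OF h] gP by (simp flip: mult.assoc)
  moreover have "fps_l1 (P * (fps_const (1 / A) * w) * inverse (1 + h))"
    by (intro fps_l1_intros l1 w fps_l1_inverse_near_1(1) h)
  ultimately show ?thesis by blast
qed

section \<open>The infinite linear system\<close>

text \<open>The factor \<open>(3 / 2) ^ i\<close> comes from \<open>z = (3/2) X\<close>. Only
  \<open>j \<le> 2 * i\<close> is meaningful; beyond that, truncated subtraction gives
  \<open>1 / fact 0\<close>.\<close>

definition kern :: "nat \<Rightarrow> nat \<Rightarrow> real" where
  "kern i j = (3 / 2) ^ i / fact (2 * i - j)"

text \<open>The components 0, 1 and 2 are left free, so the solutions form a module over the power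
  series, parametrized by these three boundary components.\<close>

definition tail_sys :: "(nat \<Rightarrow> real fps) \<Rightarrow> bool" where
  "tail_sys e \<longleftrightarrow> (\<forall>i\<ge>3. e i = fps_X ^ i * (\<Sum>j\<le>2 * i. fps_const (kern i j) * e j))"

text \<open>The factor \<open>X ^ i\<close> lowers the coefficient index by
  \<open>i \<ge> 3\<close>. This gives termination, and by the same induction a solution is
  determined by its boundary components.\<close>

function tail_coeff :: "(nat \<Rightarrow> real fps) \<Rightarrow> nat \<Rightarrow> nat \<Rightarrow> real" where
  "tail_coeff p i n = (if i < 3 then fps_nth (p i) n else if n < i then 0
     else (\<Sum>j\<le>2 * i. kern i j * tail_coeff p j (n - i)))"
  by auto
termination by (relation "measure (\<lambda>(p, i, n). n)") auto

declare tail_coeff.simps [simp del]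

definition tail_sol :: "(nat \<Rightarrow> real fps) \<Rightarrow> nat \<Rightarrow> real fps" where
  "tail_sol p i = Abs_fps (tail_coeff p i)"

lemma kern_pos: "kern i j > 0"
  by (simp add: kern_def)

lemma tail_sol_boundary: "i < 3 \<Longrightarrow> tail_sol p i = p i"
  by (rule fps_ext) (simp add: tail_sol_def tail_coeff.simps[of p i])

lemma tail_sys_tail_sol: "tail_sys (tail_sol p)"
  unfolding tail_sys_def
proof (intro allI impI fps_ext)
  fix i n :: nat assume "i \<ge> 3"
  then show "fps_nth (tail_sol p i) n
      = fps_nth (fps_X ^ i * (\<Sum>j\<le>2 * i. fps_const (kern i j) * tail_sol p j)) n"
    by (simp add: tail_sol_def tail_coeff.simps[of p i] fps_X_power_mult_nth fps_sum_nth)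
qed

lemma tail_sys_nth:
  assumes "tail_sys e" "i \<ge> 3"
  shows "fps_nth (e i) n = (if n < i then 0 else \<Sum>j\<le>2 * i. kern i j * fps_nth (e j) (n - i))"
proof -
  have "e i = fps_X ^ i * (\<Sum>j\<le>2 * i. fps_const (kern i j) * e j)"
    using assms by (auto simp: tail_sys_def)
  then have "fps_nth (e i) n = fps_nth (fps_X ^ i * (\<Sum>j\<le>2 * i. fps_const (kern i j) * e j)) n"
    by (rule arg_cong)
  then show ?thesis by (simp add: fps_X_power_mult_nth fps_sum_nth)
qed

lemma tail_sys_unique:
  assumes e: "tail_sys e" "tail_sys e'" and eq: "\<And>i. i < 3 \<Longrightarrow> e i = e' i"
  shows "e i = e' i"
proof (rule fps_ext)
  fix n show "fps_nth (e i) n = fps_nth (e' i) n"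
  proof (induction n arbitrary: i rule: less_induct)
    case (less n)
    show ?case
    proof (cases "i < 3")
      case False
      then show ?thesis
        using less.IH[of "n - i"] by (simp add: tail_sys_nth[OF e(1)] tail_sys_nth[OF e(2)])
    qed (simp add: eq)
  qed
qed

lemma tail_sys_mult: "tail_sys e \<Longrightarrow> tail_sys (\<lambda>i. f * e i)"
  unfolding tail_sys_def by (auto simp: sum_distrib_left mult_ac)

lemma tail_sys_add: "tail_sys e \<Longrightarrow> tail_sys e' \<Longrightarrow> tail_sys (\<lambda>i. e i + e' i)"
  unfolding tail_sys_def by (auto simp: sum.distrib distrib_left)

text \<open>With the weights \<open>10 powr - i\<close> the kernel is a contraction on the components \<open>i \<ge> 3\<close>.
  (It is not on \<open>i \<ge> 2\<close>, whatever the weights, since \<open>kern 2 2 = 9 / 8 > 1\<close>.)\<close>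

lemma exp_10_le: "exp 10 \<le> (3::real) ^ 10"
proof -
  have "exp 10 = exp (1::real) ^ 10" by (simp flip: exp_of_nat_mult)
  also have "\<dots> \<le> 3 ^ 10" by (intro power_mono exp_le) auto
  finally show ?thesis .
qed

lemma kern_contraction:
  assumes "i \<ge> 3"
  shows "(\<Sum>j=3..2 * i. kern i j / 10 ^ j) \<le> 77 / 100 / 10 ^ i"
\<comment> \<open>The tight case is \<open>i = 3\<close>, with ratio about 0.768. From 6 on, the
  reversed sum is part of the series of \<open>exp 10\<close>, and
  \<open>(3 / 20) ^ 6 * 3 ^ 10\<close> is about 0.673.\<close>
proof (cases "i < 6")
  case True
  then have "i = 3 \<or> i = 4 \<or> i = 5" using assms by auto
  moreover have "(\<Sum>j=3..n. f j) = sum_list (map f [3..<Suc n])" for n and f :: "nat \<Rightarrow> real"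
    by (simp only: interv_sum_list_conv_sum_set_nat atLeastLessThanSuc_atLeastAtMost set_upt)
  ultimately show ?thesis
    by (elim disjE) (simp_all add: kern_def fact_numeral power_divide)
next
  case False
  have eq: "(\<Sum>j=3..2 * i. kern i j / 10 ^ j) = (3 / 2) ^ i / 100 ^ i * (\<Sum>j=3..2 * i. 10 ^ (2 * i - j) / fact (2 * i - j))"
    unfolding sum_distrib_left
  proof (rule sum.cong)
    fix j assume "j \<in> {3..2 * i}"
    then have "(10::real) ^ (2 * i) = 10 ^ (2 * i - j) * 10 ^ j" by (simp flip: power_add)
    then have "(100::real) ^ i = 10 ^ (2 * i - j) * 10 ^ j" by (simp add: power_mult)
    then show "kern i j / 10 ^ j = (3 / 2) ^ i / 100 ^ i * (10 ^ (2 * i - j) / fact (2 * i - j))"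
      by (simp add: kern_def field_simps)
  qed simp
  have "(\<Sum>j=3..2 * i. 10 ^ (2 * i - j) / fact (2 * i - j)) = (\<Sum>k\<in>(\<lambda>j. 2 * i - j) ` {3..2 * i}. 10 ^ k / fact k :: real)"
    by (subst sum.reindex) (auto simp: inj_on_def)
  also have "\<dots> \<le> exp 10"
    unfolding exp_def
    by (rule order.trans[OF sum_le_suminf])
       (use summable_exp_generic[of "10::real"] in \<open>auto simp: scaleR_conv_of_real field_simps\<close>)
  also have "\<dots> \<le> 3 ^ 10" by (rule exp_10_le)
  finally have "(\<Sum>j=3..2 * i. kern i j / 10 ^ j) \<le> (3 / 2) ^ i / 100 ^ i * 3 ^ 10"
    unfolding eq by (rule mult_left_mono) simp
  also have "(3 / 2) ^ i / 100 ^ i = (3 / 20) ^ i * (1 / 10 ^ i :: real)"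
  proof -
    have "(3 / 20) ^ i * 100 ^ i = (3 / 2) ^ i * (10 ^ i :: real)"
      by (simp only: power_mult_distrib[symmetric]) simp
    then show ?thesis by (simp add: divide_eq_eq mult.commute mult.left_commute)
  qed
  also have "(3 / 20) ^ i * (1 / 10 ^ i) * 3 ^ 10 \<le> (3 / 20) ^ 6 * (1 / 10 ^ i) * (3 ^ 10 :: real)"
    using False by (intro mult_right_mono power_decreasing) auto
  also have "(3 / 20) ^ 6 * (1 / 10 ^ i) * 3 ^ 10 \<le> 77 / 100 / (10 ^ i :: real)"
    by (simp add: divide_simps power_divide)
  finally show ?thesis .
qed

text \<open>With \<open>k = 2 * i - j \<ge> 4\<close>, a step of \<open>i\<close> multiplies by
  \<open>c / ((k + 1) * (k + 2))\<close>, at most 15/30. The bound 15 is the 3/2 of the kernel times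
  the base 10 of the weights.\<close>

lemma power_over_fact_antimono:
  fixes c :: real
  assumes "0 \<le> c" "c \<le> 15" "j < i0" "3 \<le> i0" "i0 \<le> i"
  shows "c ^ i / fact (2 * i - j) \<le> c ^ i0 / fact (2 * i0 - j)"
  using assms(5)
proof (induction i rule: dec_induct)
  case (step i)
  define k where "k = 2 * i - j"
  have k: "k \<ge> 4" "2 * Suc i - j = Suc (Suc k)" using assms(3,4) step.hyps by (auto simp: k_def)
  have "6 * 5 \<le> (real k + 2) * (real k + 1)" using k by (intro mult_mono) auto
  then have "c \<le> (real k + 2) * (real k + 1)" using assms by linarith
  then have "c * c ^ i \<le> (real k + 2) * (real k + 1) * c ^ i" using assms by (intro mult_right_mono) auto
  then have "c * c ^ i / ((real k + 2) * (real k + 1)) \<le> c ^ i"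
    by (subst pos_divide_le_eq) (auto simp: mult.commute)
  then have "c * c ^ i / ((real k + 2) * (real k + 1)) / fact k \<le> c ^ i / fact k"
    by (rule divide_right_mono) simp
  moreover have "fact (Suc (Suc k)) = (real k + 2) * (real k + 1) * fact k"
    by (simp add: algebra_simps)
  then have "c ^ Suc i / fact (Suc (Suc k)) = c * c ^ i / ((real k + 2) * (real k + 1)) / fact k"
    by (simp only: power_Suc divide_divide_eq_left)
  ultimately have "c ^ Suc i / fact (Suc (Suc k)) \<le> c ^ i / fact k" by (simp only:)
  then show ?case using step.IH unfolding k(2) by (simp only: k_def)
qed simp

lemma kern_tail_le:
  assumes "0 \<le> x" "x \<le> 1" "j < i0" "3 \<le> i0" "i0 \<le> i"
  shows "x ^ i * kern i j \<le> (15 * x) ^ i0 / fact (2 * i0 - j) / 10 ^ i"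
proof -
  have "x ^ i * kern i j = (15 * x) ^ i / fact (2 * i - j) / 10 ^ i"
  proof -
    have "(15 * x) ^ i = 10 ^ i * ((3 / 2) ^ i * x ^ i)"
      by (simp only: power_mult_distrib[symmetric]) simp
    then show ?thesis unfolding kern_def by (simp only:) simp
  qed
  also have "\<dots> \<le> (15 * x) ^ i0 / fact (2 * i0 - j) / 10 ^ i"
    by (intro divide_right_mono power_over_fact_antimono) (use assms in auto)
  finally show ?thesis .
qed

text \<open>Induction on the length of partial sums: because of the factor \<open>X ^ i\<close>, a
  partial sum for \<open>e i\<close> depends on strictly shorter ones, so summability comes together
  with the bound. The constant solves \<open>C = B + 77 / 100 * C\<close>, whence the divisor
  23/100.\<close>

lemma tail_sys_majorant:
  assumes e: "\<And>i. i \<ge> 3 \<Longrightarrow> e i = t i + fps_X ^ i * (\<Sum>j=3..2 * i. fps_const (kern i j) * e j)"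
    and t: "\<And>i. i \<ge> 3 \<Longrightarrow> fps_l1 (t i) \<and> fps_norm1 (t i) \<le> B / 10 ^ i" and i: "i \<ge> 3"
  shows "fps_l1 (e i)" "fps_norm1 (e i) \<le> B / (23 / 100) / 10 ^ i"
proof -
  define C where "C = B / (23 / 100)"
  have "0 \<le> B / 10 ^ 3" using t[of 3] fps_norm1_nonneg[of "t 3"] by linarith
  then have "B \<ge> 0" by simp
  have "(\<Sum>n<N. \<bar>fps_nth (e i) n\<bar>) \<le> C / 10 ^ i" for N
    using i
  proof (induction N arbitrary: i rule: less_induct)
    case (less N)
    show ?case
    proof (cases "N = 0")
      case True
      then show ?thesis using \<open>B \<ge> 0\<close> by (simp add: C_def)
    next
      case False
      let ?f = "\<Sum>j=3..2 * i. fps_const (kern i j) * e j"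
      have "(\<Sum>n<N. \<bar>fps_nth (e i) n\<bar>) \<le> (\<Sum>n<N. \<bar>fps_nth (t i) n\<bar>) + (\<Sum>n<N. \<bar>fps_nth (fps_X ^ i * ?f) n\<bar>)"
        unfolding sum.distrib[symmetric]
        by (intro sum_mono, subst e[OF less.prems]) (simp only: fps_add_nth abs_triangle_ineq)
      also have "(\<Sum>n<N. \<bar>fps_nth (t i) n\<bar>) \<le> B / 10 ^ i"
        using t[OF less.prems] sum_le_fps_norm1[of "t i" "{..<N}"] by auto
      also have "(\<Sum>n<N. \<bar>fps_nth (fps_X ^ i * ?f) n\<bar>) = (\<Sum>n | n < N \<and> i \<le> n. \<bar>fps_nth ?f (n - i)\<bar>)"
        by (rule sum.mono_neutral_cong_right) (auto simp: fps_X_power_mult_nth)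
      also have "\<dots> = (\<Sum>n<N - i. \<bar>fps_nth ?f n\<bar>)"
        by (rule sum.reindex_bij_witness[of _ "\<lambda>n. n + i" "\<lambda>n. n - i"]) auto
      also have "\<dots> \<le> (\<Sum>n<N - i. \<Sum>j=3..2 * i. kern i j * \<bar>fps_nth (e j) n\<bar>)"
      proof (rule sum_mono)
        fix n
        have "\<bar>fps_nth ?f n\<bar> \<le> (\<Sum>j=3..2 * i. \<bar>kern i j * fps_nth (e j) n\<bar>)"
          by (simp add: fps_sum_nth sum_abs)
        then show "\<bar>fps_nth ?f n\<bar> \<le> (\<Sum>j=3..2 * i. kern i j * \<bar>fps_nth (e j) n\<bar>)"
          by (simp add: abs_mult abs_of_pos[OF kern_pos])
      qed
      also have "\<dots> = (\<Sum>j=3..2 * i. kern i j * (\<Sum>n<N - i. \<bar>fps_nth (e j) n\<bar>))"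
        by (subst sum.swap) (simp add: sum_distrib_left)
      also have "\<dots> \<le> (\<Sum>j=3..2 * i. kern i j * (C / 10 ^ j))"
        using less False by (intro sum_mono mult_left_mono less.IH less_imp_le[OF kern_pos]) auto
      also have "\<dots> = C * (\<Sum>j=3..2 * i. kern i j / 10 ^ j)"
        by (simp add: sum_distrib_left mult_ac)
      also have "\<dots> \<le> C * (77 / 100 / 10 ^ i)"
        using \<open>B \<ge> 0\<close> by (intro mult_left_mono kern_contraction less.prems) (auto simp: C_def)
      also have "B / 10 ^ i + C * (77 / 100 / 10 ^ i) = C / 10 ^ i"
        by (simp add: C_def field_simps)
      finally show ?thesis by simp
    qed
  qed
  from fps_l1I[OF this] show "fps_l1 (e i)" "fps_norm1 (e i) \<le> B / (23 / 100) / 10 ^ i"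
    by (simp_all add: C_def)
qed

lemma fps_l1_sum: "(\<And>i. i \<in> A \<Longrightarrow> fps_l1 (f i)) \<Longrightarrow> fps_l1 (\<Sum>i\<in>A. f i)"
  using fps_l1_const[of 0] by (induction A rule: infinite_finite_induct) (auto intro: fps_l1_add)

lemma fps_norm1_sum:
  "(\<And>i. i \<in> A \<Longrightarrow> fps_l1 (f i)) \<Longrightarrow> fps_norm1 (\<Sum>i\<in>A. f i) \<le> (\<Sum>i\<in>A. fps_norm1 (f i))"
proof (induction A rule: infinite_finite_induct)
  case (insert a A)
  then have "fps_norm1 (f a + (\<Sum>i\<in>A. f i)) \<le> fps_norm1 (f a) + fps_norm1 (\<Sum>i\<in>A. f i)"
    by (intro fps_norm1_add fps_l1_sum) auto
  also have "\<dots> \<le> fps_norm1 (f a) + (\<Sum>i\<in>A. fps_norm1 (f i))" using insert by simp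
  finally show ?case using insert by simp
qed (use fps_norm1_const[of 0] in auto)

lemma kern_sum_split:
  "(i::nat) \<ge> 3 \<Longrightarrow> (\<Sum>j\<le>2 * i. g j :: 'a::comm_monoid_add) = (\<Sum>j<3. g j) + (\<Sum>j=3..2 * i. g j)"
proof -
  assume "(i::nat) \<ge> 3"
  then have "{..2 * i} = {..<3} \<union> {3..2 * i}" by auto
  then show ?thesis by (simp only:) (rule sum.union_disjoint; auto)
qed

text \<open>The last hypothesis bounds the residual of all the components beyond \<open>I\<close>, because
  \<open>15 ^ i / fact (2 * i - j)\<close> decreases in \<open>i\<close>.\<close>

lemma tail_sys_approx:
  assumes e: "tail_sys e" and bd: "\<And>j. j < 3 \<Longrightarrow> e j = q j"
    and q: "\<And>j. fps_l1 (q j)" "\<And>j. j > I \<Longrightarrow> q j = 0" and I: "I \<ge> 2"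
    and res: "\<And>i. 3 \<le> i \<Longrightarrow> i \<le> I \<Longrightarrow>
      fps_norm1 (fps_X ^ i * (\<Sum>j\<le>2 * i. fps_const (kern i j) * q j) - q i) \<le> B / 10 ^ i"
    and tail: "(\<Sum>j\<le>I. 15 ^ Suc I / fact (2 * Suc I - j) * fps_norm1 (q j)) \<le> B"
    and i: "i \<ge> 3"
  shows "fps_l1 (e i)" "fps_norm1 (e i - q i) \<le> B / (23 / 100) / 10 ^ i"
proof -
  define t where "t = (\<lambda>i. fps_X ^ i * (\<Sum>j\<le>2 * i. fps_const (kern i j) * q j) - q i)"
  have t_l1: "fps_l1 (t i)" for i
    unfolding t_def by (intro fps_l1_intros fps_l1_sum q)
  have diff: "e i - q i = t i + fps_X ^ i * (\<Sum>j=3..2 * i. fps_const (kern i j) * (e j - q j))"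
    if "i \<ge> 3" for i
  proof -
    have S: "(\<Sum>j\<le>2 * i. fps_const (kern i j) * (e j - q j)) = (\<Sum>j=3..2 * i. fps_const (kern i j) * (e j - q j))"
      using that by (simp add: kern_sum_split bd)
    have "fps_X ^ i * (\<Sum>j=3..2 * i. fps_const (kern i j) * (e j - q j))
        = fps_X ^ i * (\<Sum>j\<le>2 * i. fps_const (kern i j) * e j) - fps_X ^ i * (\<Sum>j\<le>2 * i. fps_const (kern i j) * q j)"
      unfolding S[symmetric] by (simp only: right_diff_distrib sum_subtractf)
    also have "fps_X ^ i * (\<Sum>j\<le>2 * i. fps_const (kern i j) * e j) = e i"
      using e that unfolding tail_sys_def by auto
    finally show ?thesis by (simp add: t_def)
  qed
  have t_norm: "fps_norm1 (t i) \<le> B / 10 ^ i" if "i \<ge> 3" for i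
  proof (cases "i \<le> I")
    case True
    then show ?thesis unfolding t_def by (rule res[OF that])
  next
    case False
    have "t i = fps_X ^ i * (\<Sum>j\<le>2 * i. fps_const (kern i j) * q j)" using False by (simp add: t_def q)
    also have "(\<Sum>j\<le>2 * i. fps_const (kern i j) * q j) = (\<Sum>j\<le>I. fps_const (kern i j) * q j)"
      using False by (intro sum.mono_neutral_right) (auto simp: q)
    finally have "fps_norm1 (t i) = fps_norm1 (\<Sum>j\<le>I. fps_const (kern i j) * q j)"
      by (simp add: fps_norm1_X_power_mult fps_l1_sum fps_l1_const_mult q)
    also have "\<dots> \<le> (\<Sum>j\<le>I. fps_norm1 (fps_const (kern i j) * q j))"
      by (intro fps_norm1_sum fps_l1_const_mult q)
    also have "\<dots> = (\<Sum>j\<le>I. 1 ^ i * kern i j * fps_norm1 (q j))"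
      by (intro sum.cong) (simp_all add: fps_norm1_const_mult q abs_of_pos[OF kern_pos])
    also have "\<dots> \<le> (\<Sum>j\<le>I. (15 * 1) ^ Suc I / fact (2 * Suc I - j) / 10 ^ i * fps_norm1 (q j))"
      using False I by (intro sum_mono mult_right_mono kern_tail_le fps_norm1_nonneg q) auto
    also have "\<dots> = (\<Sum>j\<le>I. 15 ^ Suc I / fact (2 * Suc I - j) * fps_norm1 (q j)) / 10 ^ i"
      by (simp add: sum_divide_distrib)
    also have "\<dots> \<le> B / 10 ^ i" by (intro divide_right_mono tail) simp
    finally show ?thesis .
  qed
  have *: "fps_l1 (e i - q i)" "fps_norm1 (e i - q i) \<le> B / (23 / 100) / 10 ^ i"
    using tail_sys_majorant[of "\<lambda>i. e i - q i" t B i] diff t_l1 t_norm i by auto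
  then show "fps_norm1 (e i - q i) \<le> B / (23 / 100) / 10 ^ i" by simp
  show "fps_l1 (e i)" using fps_l1_add[OF *(1) q(1)[of i]] by simp
qed

text \<open>The case of the approximation by zero from component 3 on; the condition on
  \<open>B\<close> is the tail condition for \<open>I = 2\<close>.\<close>

lemma tail_sys_l1:
  assumes e: "tail_sys e" and l1: "\<And>j. j < 3 \<Longrightarrow> fps_l1 (e j)"
    and B: "15 ^ 3 / fact 6 * fps_norm1 (e 0) + 15 ^ 3 / fact 5 * fps_norm1 (e 1)
      + 15 ^ 3 / fact 4 * fps_norm1 (e 2) \<le> B" and i: "i \<ge> 3"
  shows "fps_l1 (e i)" "fps_norm1 (e i) \<le> B / (23 / 100) / 10 ^ i"
proof -
  define q where "q = (\<lambda>j. if j < 3 then e j else 0)"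
  have q: "fps_l1 (q j)" for j using l1 fps_l1_const[of 0] by (simp add: q_def)
  have "(\<Sum>j\<le>2. 15 ^ Suc 2 / fact (2 * Suc 2 - j) * fps_norm1 (q j)) \<le> B"
    using B by (simp add: q_def eval_nat_numeral)
  from tail_sys_approx[OF e _ q _ _ _ this i] i show "fps_l1 (e i)" "fps_norm1 (e i) \<le> B / (23 / 100) / 10 ^ i"
    by (auto simp: q_def)
qed

lemma tail_sys_value:
  assumes e: "tail_sys e" and l1: "\<And>j. fps_l1 (e j)" and x: "\<bar>x\<bar> \<le> 1" and i: "i \<ge> 3"
  shows "fps_value (e i) x = x ^ i * (\<Sum>j\<le>2 * i. kern i j * fps_value (e j) x)"
proof -
  have sum: "fps_value (\<Sum>j\<in>A. fps_const (kern i j) * e j) x = (\<Sum>j\<in>A. kern i j * fps_value (e j) x)" for A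
    using fps_value_const[of 0 x] x
    by (induction A rule: infinite_finite_induct)
       (simp_all add: fps_value_simps fps_l1_sum fps_l1_intros l1)
  have "e i = fps_X ^ i * (\<Sum>j\<le>2 * i. fps_const (kern i j) * e j)"
    using e i by (auto simp: tail_sys_def)
  then have "fps_value (e i) x = fps_value (fps_X ^ i * (\<Sum>j\<le>2 * i. fps_const (kern i j) * e j)) x"
    by (rule arg_cong)
  also have "\<dots> = x ^ i * (\<Sum>j\<le>2 * i. kern i j * fps_value (e j) x)"
    using x by (simp add: fps_value_simps fps_l1_intros fps_l1_sum l1 sum del: fps_l1_X_power_mult)
  finally show ?thesis .
qed

text \<open>Numbers have no coefficient index to induct on. Instead the crude bound from
  \<open>tail_sys_l1\<close> gives a first error constant \<open>M0\<close>, and each use of the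
  contraction replaces \<open>M\<close> by \<open>B + 77 / 100 * M\<close>; the limit of these
  constants is \<open>B / (23 / 100)\<close>.\<close>

lemma tail_sys_value_approx:
  assumes e: "tail_sys e" and l1: "\<And>j. j < 3 \<Longrightarrow> fps_l1 (e j)" and x: "0 \<le> x" "x \<le> 1"
    and bd: "\<And>j. j < 3 \<Longrightarrow> fps_value (e j) x = v j"
    and v: "\<And>j. j > I \<Longrightarrow> v j = 0" and I: "I \<ge> 2"
    and res: "\<And>i. 3 \<le> i \<Longrightarrow> i \<le> I \<Longrightarrow> \<bar>x ^ i * (\<Sum>j\<le>2 * i. kern i j * v j) - v i\<bar> \<le> B / 10 ^ i"
    and tail: "(\<Sum>j\<le>I. (15 * x) ^ Suc I / fact (2 * Suc I - j) * \<bar>v j\<bar>) \<le> B"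
    and i: "i \<ge> 3"
  shows "\<bar>fps_value (e i) x - v i\<bar> \<le> B / (23 / 100) / 10 ^ i"
proof -
  have abs_x: "\<bar>x\<bar> \<le> 1" using x by simp
  define A where "A = 15 ^ 3 / fact 6 * fps_norm1 (e 0) + 15 ^ 3 / fact 5 * fps_norm1 (e 1)
      + 15 ^ 3 / fact 4 * fps_norm1 (e 2)"
  define C where "C = B / (23 / 100)"
  have "B \<ge> 0" by (rule order.trans[OF _ tail]) (use x in \<open>auto intro!: sum_nonneg\<close>)
  have e_l1: "fps_l1 (e j)" for j
    using tail_sys_l1(1)[OF e l1, of A j] l1[of j] by (cases "j < 3") (auto simp: A_def)
  define a where "a = (\<lambda>i. fps_value (e i) x - v i)"
  define r where "r = (\<lambda>i. x ^ i * (\<Sum>j\<le>2 * i. kern i j * v j) - v i)"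
  have a_eq: "a i = r i + x ^ i * (\<Sum>j=3..2 * i. kern i j * a j)" if "i \<ge> 3" for i
  proof -
    have S: "(\<Sum>j\<le>2 * i. kern i j * a j) = (\<Sum>j=3..2 * i. kern i j * a j)"
      using that by (simp add: kern_sum_split a_def bd)
    have "x ^ i * (\<Sum>j=3..2 * i. kern i j * a j)
        = x ^ i * (\<Sum>j\<le>2 * i. kern i j * fps_value (e j) x) - x ^ i * (\<Sum>j\<le>2 * i. kern i j * v j)"
      unfolding S[symmetric] by (simp only: a_def right_diff_distrib sum_subtractf)
    also have "x ^ i * (\<Sum>j\<le>2 * i. kern i j * fps_value (e j) x) = fps_value (e i) x"
      using tail_sys_value[OF e e_l1 abs_x that] by simp
    finally show ?thesis by (simp add: r_def a_def)
  qed
  have r_le: "\<bar>r i\<bar> \<le> B / 10 ^ i" if "i \<ge> 3" for i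
  proof (cases "i \<le> I")
    case True
    then show ?thesis unfolding r_def by (rule res[OF that])
  next
    case False
    have "r i = x ^ i * (\<Sum>j\<le>2 * i. kern i j * v j)" using False by (simp add: r_def v)
    also have "(\<Sum>j\<le>2 * i. kern i j * v j) = (\<Sum>j\<le>I. kern i j * v j)"
      using False by (intro sum.mono_neutral_right) (auto simp: v)
    finally have "\<bar>r i\<bar> = \<bar>\<Sum>j\<le>I. x ^ i * kern i j * v j\<bar>"
      by (simp add: sum_distrib_left mult.assoc)
    also have "\<dots> \<le> (\<Sum>j\<le>I. \<bar>x ^ i * kern i j * v j\<bar>)" by (rule sum_abs)
    also have "\<dots> = (\<Sum>j\<le>I. x ^ i * kern i j * \<bar>v j\<bar>)"
      using x by (simp add: abs_mult abs_of_pos[OF kern_pos])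
    also have "\<dots> \<le> (\<Sum>j\<le>I. (15 * x) ^ Suc I / fact (2 * Suc I - j) / 10 ^ i * \<bar>v j\<bar>)"
      using False I x by (intro sum_mono mult_right_mono kern_tail_le) auto
    also have "\<dots> = (\<Sum>j\<le>I. (15 * x) ^ Suc I / fact (2 * Suc I - j) * \<bar>v j\<bar>) / 10 ^ i"
      by (simp add: sum_divide_distrib)
    also have "\<dots> \<le> B / 10 ^ i" by (intro divide_right_mono tail) simp
    finally show ?thesis .
  qed
  have step: "\<bar>a i\<bar> \<le> (B + 77 / 100 * M) / 10 ^ i"
    if M: "\<And>i. i \<ge> 3 \<Longrightarrow> \<bar>a i\<bar> \<le> M / 10 ^ i" and i: "i \<ge> 3" for M i
  proof -
    have "0 \<le> M / 10 ^ 3" using M[of 3] by linarith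
    then have "M \<ge> 0" by simp
    have "\<bar>\<Sum>j=3..2 * i. kern i j * a j\<bar> \<le> (\<Sum>j=3..2 * i. \<bar>kern i j * a j\<bar>)" by (rule sum_abs)
    also have "\<dots> \<le> (\<Sum>j=3..2 * i. kern i j * (M / 10 ^ j))"
      unfolding abs_mult abs_of_pos[OF kern_pos]
      by (intro sum_mono mult_left_mono M less_imp_le[OF kern_pos]) auto
    also have "\<dots> = M * (\<Sum>j=3..2 * i. kern i j / 10 ^ j)" by (simp add: sum_distrib_left mult_ac)
    also have "\<dots> \<le> M * (77 / 100 / 10 ^ i)" using \<open>M \<ge> 0\<close> by (intro mult_left_mono kern_contraction i)
    finally have "\<bar>x ^ i\<bar> * \<bar>\<Sum>j=3..2 * i. kern i j * a j\<bar> \<le> 1 * (M * (77 / 100 / 10 ^ i))"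
      using x \<open>M \<ge> 0\<close> by (intro mult_mono) (auto simp: power_le_one)
    then have "\<bar>a i\<bar> \<le> B / 10 ^ i + M * (77 / 100 / 10 ^ i)"
      unfolding a_eq[OF i] abs_mult[symmetric]
      using r_le[OF i] abs_triangle_ineq[of "r i" "x ^ i * (\<Sum>j=3..2 * i. kern i j * a j)"]
      by linarith
    then show ?thesis by (simp add: field_simps)
  qed
  define M0 where "M0 = A / (23 / 100) + (\<Sum>j\<le>I. \<bar>v j\<bar> * 10 ^ j)"
  have iter: "\<bar>a i\<bar> \<le> (C + (77 / 100) ^ k * M0) / 10 ^ i" if "i \<ge> 3" for i k
    using that
  proof (induction k arbitrary: i)
    case 0
    have "\<bar>fps_value (e i) x\<bar> \<le> A / (23 / 100) / 10 ^ i"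
      using abs_fps_value_le[OF e_l1 abs_x] tail_sys_l1(2)[OF e l1, of A i] 0
      by (force simp: A_def intro: order.trans)
    moreover have "\<bar>v i\<bar> \<le> (\<Sum>j\<le>I. \<bar>v j\<bar> * 10 ^ j) / 10 ^ i"
    proof (cases "i \<le> I")
      case True
      then have "\<bar>v i\<bar> * 10 ^ i \<le> (\<Sum>j\<le>I. \<bar>v j\<bar> * 10 ^ j)" by (intro member_le_sum) auto
      then show ?thesis by (simp add: field_simps)
    qed (auto simp: v intro!: divide_nonneg_nonneg sum_nonneg)
    ultimately have "\<bar>a i\<bar> \<le> M0 / 10 ^ i" unfolding a_def M0_def by (simp add: add_divide_distrib)
    also have "\<dots> \<le> (C + (77 / 100) ^ 0 * M0) / 10 ^ i"
      using \<open>B \<ge> 0\<close> by (intro divide_right_mono) (auto simp: C_def)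
    finally show ?case .
  next
    case (Suc k)
    have "\<bar>a i\<bar> \<le> (B + 77 / 100 * (C + (77 / 100) ^ k * M0)) / 10 ^ i"
      by (rule step[OF Suc.IH Suc.prems])
    also have "B + 77 / 100 * (C + (77 / 100) ^ k * M0) = C + (77 / 100) ^ Suc k * M0"
      by (simp add: C_def field_simps)
    finally show ?case .
  qed
  have "(\<lambda>k. (C + (77 / 100) ^ k * M0) / 10 ^ i) \<longlonglongrightarrow> (C + 0 * M0) / 10 ^ i"
    by (intro tendsto_intros LIMSEQ_realpow_zero) auto
  then have "\<bar>a i\<bar> \<le> (C + 0 * M0) / 10 ^ i"
    by (rule LIMSEQ_le_const) (use iter[OF i] in auto)
  then show ?thesis by (simp add: a_def C_def)
qed

section \<open>Reduction to a single equation and polar parts\<close>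

definition scaled_fps :: "real fps" where
  "scaled_fps = Abs_fps (\<lambda>n. fps_nth lim_fps n * (3 / 2) ^ n)"

lemma scaled_fps_power_nth: "fps_nth (scaled_fps ^ s) n = fps_nth (lim_fps ^ s) n * (3 / 2) ^ n"
proof -
  have comp: "fps_nth (fps_compose f (fps_const (3 / 2) * fps_X)) n = fps_nth f n * (3 / 2) ^ n" for f :: "real fps" and n
    by (simp add: fps_compose_linear)
  have "scaled_fps = fps_compose lim_fps (fps_const (3 / 2) * fps_X)"
    by (rule fps_ext) (simp only: scaled_fps_def comp fps_nth_Abs_fps)
  then have "scaled_fps ^ s = fps_compose (lim_fps ^ s) (fps_const (3 / 2) * fps_X)"
    using fps_compose_power[of "fps_const (3 / 2) * fps_X" lim_fps s] by simp
  then show ?thesis by (simp only: comp)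
qed

text \<open>Dividing the series for \<open>2 * i\<close> by \<open>z ^ i\<close> makes the power of
  \<open>z\<close> in the recursion independent of \<open>j\<close>: the \<open>2 * i - j\<close>
  largest parts contribute \<open>z ^ (2 * i - j)\<close>, the shift of component \<open>j\<close>
  contributes \<open>z ^ j\<close>, and \<open>z ^ i\<close> cancels.\<close>

definition state_fps :: "nat \<Rightarrow> real fps" where
  "state_fps i = Abs_fps (\<lambda>n. lim_coeff (2 * i) (n + i) * (3 / 2) ^ n)"

lemma state_fps_0: "state_fps 0 = 1"
  by (rule fps_ext) (simp add: state_fps_def)

lemma state_fps_rec:
  assumes "i \<ge> 1"
  shows "state_fps i = fps_X ^ i * (\<Sum>j\<le>2 * i. fps_const (kern i j) * state_fps j)"
proof (rule fps_ext)
  fix n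
  show "fps_nth (state_fps i) n = fps_nth (fps_X ^ i * (\<Sum>j\<le>2 * i. fps_const (kern i j) * state_fps j)) n"
  proof (cases "n < i")
    case True
    then show ?thesis by (simp add: state_fps_def fps_X_power_mult_nth lim_coeff_eq_0)
  next
    case False
    have "lim_coeff (2 * i) (n + i) = (\<Sum>l\<le>2 * i. lim_coeff (2 * (2 * i - l)) (n + i - l) / fact l)"
      using False by (subst lim_coeff_rec) (simp add: min_def)
    also have "\<dots> = (\<Sum>j\<le>2 * i. lim_coeff (2 * j) (n - i + j) / fact (2 * i - j))"
      by (rule sum.reindex_bij_witness[of _ "\<lambda>j. 2 * i - j" "\<lambda>l. 2 * i - l"])
         (use False in \<open>auto simp: algebra_simps\<close>)
    finally have "fps_nth (state_fps i) n
        = (\<Sum>j\<le>2 * i. lim_coeff (2 * j) (n - i + j) / fact (2 * i - j)) * (3 / 2) ^ n"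
      by (simp add: state_fps_def)
    also have "(3 / 2 :: real) ^ n = (3 / 2) ^ i * (3 / 2) ^ (n - i)"
      using False by (simp flip: power_add)
    also have "(\<Sum>j\<le>2 * i. lim_coeff (2 * j) (n - i + j) / fact (2 * i - j)) * ((3 / 2) ^ i * (3 / 2) ^ (n - i))
        = (\<Sum>j\<le>2 * i. kern i j * fps_nth (state_fps j) (n - i))"
      unfolding sum_distrib_right
      by (rule sum.cong) (simp_all add: kern_def state_fps_def)
    finally show ?thesis using False by (simp add: fps_X_power_mult_nth fps_sum_nth)
  qed
qed

abbreviation Z :: "real fps" where "Z \<equiv> fps_const (3 / 2) * fps_X"

text \<open>A representation of 1 is the single part 1, or all its parts are at most 1/2 and
  doubling them gives a representation of 2.\<close>

lemma scaled_fps_eq: "scaled_fps = Z * (1 + state_fps 1)"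
proof (rule fps_ext)
  fix n
  show "fps_nth scaled_fps n = fps_nth (Z * (1 + state_fps 1)) n"
  proof (cases n)
    case 0
    have "lim_coeff 1 0 = 0" by (rule lim_coeff_eq_0) simp
    then show ?thesis using 0 by (simp add: scaled_fps_def lim_fps_def mult.assoc)
  next
    case (Suc m)
    have "lim_coeff 1 (Suc m) = lim_coeff 2 (Suc m) + lim_coeff 0 m"
      by (subst lim_coeff_rec) simp
    then show ?thesis using Suc
      by (simp add: scaled_fps_def lim_fps_def state_fps_def mult.assoc algebra_simps numeral_2_eq_2)
  qed
qed

text \<open>The equation for \<open>i = 1\<close> reads \<open>Z Y_2 = (1 - Z) Y_1 - Z / 2\<close>.
  So \<open>Z\<close> times \<open>(Y_0, Y_1, Y_2)\<close> is \<open>Y_1\<close> times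
  \<open>(0, Z, 1 - Z)\<close> plus \<open>Z\<close> times \<open>(1, 0, -1/2)\<close>; these
  triples are the boundary data of \<open>den_tail\<close> and \<open>num_tail\<close>. The factor
  \<open>Z\<close> avoids dividing by a non-unit.\<close>

definition den_tail :: "nat \<Rightarrow> real fps" where
  "den_tail = tail_sol (\<lambda>j. if j = 1 then Z else if j = 2 then 1 - Z else 0)"

definition num_tail :: "nat \<Rightarrow> real fps" where
  "num_tail = tail_sol (\<lambda>j. if j = 0 then 1 else if j = 2 then fps_const (- (1 / 2)) else 0)"

text \<open>From the equation for \<open>i = 2\<close>, times \<open>Z\<close>, with
  \<open>Y_2\<close>, \<open>Y_3\<close>, \<open>Y_4\<close> expressed through \<open>Y_1\<close>:
  \<open>den_fps\<close> collects the terms with \<open>Y_1\<close>, \<open>num_fps\<close> the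
  others.\<close>

definition den_fps :: "real fps" where
  "den_fps = 1 - Z - fps_const (1 / 2) * Z ^ 2 + fps_const (1 / 3) * Z ^ 3 - Z ^ 2 * (den_tail 3 + den_tail 4)"

definition num_fps :: "real fps" where
  "num_fps = fps_const (1 / 2) * Z - fps_const (5 / 24) * Z ^ 3 + Z ^ 3 * (num_tail 3 + num_tail 4)"

lemma state_fps_tail: "Z * state_fps j = state_fps 1 * den_tail j + Z * num_tail j"
proof (rule tail_sys_unique)
  have "tail_sys state_fps" unfolding tail_sys_def using state_fps_rec by auto
  then show "tail_sys (\<lambda>j. Z * state_fps j)" by (rule tail_sys_mult)
  show "tail_sys (\<lambda>j. state_fps 1 * den_tail j + Z * num_tail j)"
    unfolding den_tail_def num_tail_def by (intro tail_sys_add tail_sys_mult tail_sys_tail_sol)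
  have Y1: "state_fps 1 = fps_X * (fps_const (3 / 4) + fps_const (3 / 2) * state_fps 1 + fps_const (3 / 2) * state_fps 2)"
    using state_fps_rec[of 1] by (simp add: kern_def state_fps_0 atMost_nat_numeral eval_nat_numeral)
  have "Z * state_fps 2 = state_fps 1 * (1 - Z) + Z * fps_const (- (1 / 2))"
  proof -
    have "fps_X * fps_const (3 / 4) = Z * fps_const (1 / 2)" by simp
    moreover have "state_fps 1 = fps_X * fps_const (3 / 4) + Z * state_fps 1 + Z * state_fps 2"
      by (subst Y1) (simp only: distrib_left mult_ac)
    ultimately have "state_fps 1 = Z * fps_const (1 / 2) + Z * state_fps 1 + Z * state_fps 2"
      by (simp only:)
    moreover have "y = a + z * y + z * y2 \<Longrightarrow> z * y2 = y * (1 - z) + - a" for y a z y2 :: "real fps"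
      by algebra
    ultimately have "Z * state_fps 2 = state_fps 1 * (1 - Z) + - (Z * fps_const (1 / 2))" by blast
    then show ?thesis by (simp only: mult_minus_right[symmetric] fps_const_neg)
  qed
  then show "Z * state_fps i = state_fps 1 * den_tail i + Z * num_tail i" if "i < 3" for i
    using that
    by (auto simp: den_tail_def num_tail_def tail_sol_boundary state_fps_0 less_Suc_eq numeral_3_eq_3 numeral_2_eq_2)
qed

lemma den_times_state: "den_fps * state_fps 1 = num_fps"
proof -
  let ?Y = "state_fps 1"
  let ?h = "fps_const (1 / 2) :: real fps" and ?s = "fps_const (1 / 6) :: real fps"
    and ?t = "fps_const (1 / 24) :: real fps"
  have Y2: "Z * state_fps 2 = (1 - Z) * ?Y - ?h * Z"
  proof -
    have "den_tail 2 = 1 - Z" "num_tail 2 = - ?h"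
      by (simp_all add: den_tail_def num_tail_def tail_sol_boundary)
    then have "Z * state_fps 2 = ?Y * (1 - Z) + Z * - ?h"
      using state_fps_tail[of 2] by (simp only:)
    moreover have "a = y * (1 - z) + z * - h \<Longrightarrow> a = (1 - z) * y - h * z" for a y z h :: "real fps"
      by algebra
    ultimately show ?thesis by blast
  qed
  have "state_fps 2 = fps_X ^ 2 * (\<Sum>j\<le>2 * 2. fps_const (kern 2 j) * state_fps j)"
    by (rule state_fps_rec) simp
  have cc: "fps_const a * (fps_const b * f) = fps_const (a * b) * f" for a b :: real and f
    by (simp flip: mult.assoc)
  note \<open>state_fps 2 = fps_X ^ 2 * (\<Sum>j\<le>2 * 2. fps_const (kern 2 j) * state_fps j)\<close>
  also have "(\<Sum>j\<le>2 * 2. fps_const (kern 2 j) * state_fps j)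
      = fps_const (9 / 4) * (?t + ?s * ?Y + ?h * state_fps 2 + state_fps 3 + state_fps 4)"
    unfolding distrib_left cc by (simp add: kern_def state_fps_0 eval_nat_numeral)
  also have "fps_X ^ 2 * (fps_const (9 / 4) * (?t + ?s * ?Y + ?h * state_fps 2 + state_fps 3 + state_fps 4))
      = Z ^ 2 * (?t + ?s * ?Y + ?h * state_fps 2 + state_fps 3 + state_fps 4)"
    by (simp add: power2_eq_square mult_ac)
  finally have "state_fps 2 = Z ^ 2 * (?t + ?s * ?Y + ?h * state_fps 2 + state_fps 3 + state_fps 4)" .
  then have "Z * state_fps 2 = Z ^ 2 * (?t * Z + ?s * (Z * ?Y) + ?h * (Z * state_fps 2)
      + Z * state_fps 3 + Z * state_fps 4)"
  proof -
    have "S = u * (t + s * y + h * S + a + b) \<Longrightarrow>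
        z * S = u * (t * z + s * (z * y) + h * (z * S) + z * a + z * b)"
      for S u t s y h a b z :: "real fps" by algebra
    then show ?thesis using \<open>state_fps 2 = Z ^ 2 * (?t + ?s * ?Y + ?h * state_fps 2 + state_fps 3 + state_fps 4)\<close> by blast
  qed
  then have eq: "(1 - Z) * ?Y - ?h * Z = Z ^ 2 * (?t * Z + ?s * (Z * ?Y) + ?h * ((1 - Z) * ?Y - ?h * Z)
      + (?Y * den_tail 3 + Z * num_tail 3) + (?Y * den_tail 4 + Z * num_tail 4))"
    unfolding Y2 state_fps_tail[of 3] state_fps_tail[of 4] .
  have c: "?t - ?h * ?h = - fps_const (5 / 24)" "?h - ?s = fps_const (1 / 3)"
    by simp_all
  have id: "(1 - z - h * z ^ 2 + (h - s) * z ^ 3 - z ^ 2 * (d3 + d4)) * y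
      = (h * z + (t - h * h) * z ^ 3 + z ^ 3 * (n3 + n4))
      + (((1 - z) * y - h * z) - z ^ 2 * (t * z + s * (z * y) + h * ((1 - z) * y - h * z)
      + (y * d3 + z * n3) + (y * d4 + z * n4)))" for z y h s t d3 d4 n3 n4 :: "real fps"
    by algebra
  have "den_fps * ?Y = (1 - Z - ?h * Z ^ 2 + (?h - ?s) * Z ^ 3 - Z ^ 2 * (den_tail 3 + den_tail 4)) * ?Y"
    unfolding den_fps_def c ..
  also note id[of Z ?h ?s "den_tail 3" "den_tail 4" ?Y ?t "num_tail 3" "num_tail 4"]
  also have "(1 - Z) * ?Y - ?h * Z - Z ^ 2 * (?t * Z + ?s * (Z * ?Y) + ?h * ((1 - Z) * ?Y - ?h * Z)
      + (?Y * den_tail 3 + Z * num_tail 3) + (?Y * den_tail 4 + Z * num_tail 4)) = 0"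
    using eq by (rule eq_iff_diff_eq_0[THEN iffD1])
  finally show ?thesis unfolding num_fps_def c by (simp only: add_0_right minus_mult_left[symmetric] diff_conv_add_uminus)
qed

section \<open>Principal parts at a single pole\<close>

abbreviation geo :: "real \<Rightarrow> real fps" where "geo c \<equiv> Abs_fps (\<lambda>n. c ^ n)"

text \<open>The coefficients of \<open>1 / (1 - c X) ^ (j + 1)\<close> are \<open>c ^ n\<close>
  times this polynomial in \<open>n\<close>, which is \<open>(n + j) choose j\<close>.\<close>

primrec binomial_poly :: "nat \<Rightarrow> real poly" where
  "binomial_poly 0 = 1"
| "binomial_poly (Suc j) = smult (1 / real (Suc j)) ([:real (Suc j), 1:] * binomial_poly j)"

lemma poly_binomial_poly: "poly (binomial_poly j) (real n) = real ((n + j) choose j)"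
proof (induction j)
  case (Suc j)
  have "real (Suc j) * real ((n + Suc j) choose Suc j) = real (n + Suc j) * real ((n + j) choose j)"
    using Suc_times_binomial[of j "n + j"] by (metis add_Suc_right of_nat_mult)
  then show ?case using Suc by (simp add: field_simps)
qed simp

lemma degree_binomial_poly: "degree (binomial_poly j) = j"
  and lead_coeff_binomial_poly: "lead_coeff (binomial_poly j) = 1 / fact j"
proof (induction j)
  case (Suc j)
  have nz: "binomial_poly j \<noteq> 0" using Suc(2) by auto
  {
    case 1
    have "degree ([:real (Suc j), 1:] * binomial_poly j) = degree [:real (Suc j), 1:] + degree (binomial_poly j)"
      using nz by (intro degree_mult_eq) auto
    then show ?case using Suc by simp
  next
    case 2
    have "lead_coeff ([:real (Suc j), 1:] * binomial_poly j) = lead_coeff [:real (Suc j), 1:] * lead_coeff (binomial_poly j)"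
      by (rule lead_coeff_mult)
    then show ?case using Suc by (simp only: binomial_poly.simps lead_coeff_smult) simp
  }
qed simp_all

lemma geo_power_nth: "fps_nth (geo c ^ Suc j) n = poly (binomial_poly j) (real n) * c ^ n"
proof (induction j arbitrary: n)
  case (Suc j)
  have "fps_nth (geo c ^ Suc (Suc j)) n = (\<Sum>k\<le>n. fps_nth (geo c ^ Suc j) k * c ^ (n - k))"
    by (subst power_Suc2) (simp add: fps_mult_nth atLeast0AtMost)
  also have "\<dots> = (\<Sum>k\<le>n. real ((j + k) choose k) * c ^ n)"
  proof (rule sum.cong)
    fix k assume "k \<in> {..n}"
    then have "c ^ n = c ^ k * c ^ (n - k)" by (simp flip: power_add)
    moreover have "(k + j) choose j = (j + k) choose k"
      using binomial_symmetric[of j "k + j"] by (simp add: add.commute)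
    ultimately show "fps_nth (geo c ^ Suc j) k * c ^ (n - k) = real ((j + k) choose k) * c ^ n"
      unfolding Suc poly_binomial_poly by simp
  qed simp
  also have "\<dots> = real (\<Sum>k\<le>n. (j + k) choose k) * c ^ n" by (simp add: sum_distrib_right)
  also have "(\<Sum>k\<le>n. (j + k) choose k) = Suc (j + n) choose n" by (rule sum_choose_lower)
  also have "\<dots> = (n + Suc j) choose Suc j"
    using binomial_symmetric[of "Suc j" "n + Suc j"] by (simp add: add.commute)
  finally show ?case unfolding poly_binomial_poly .
qed simp

text \<open>A pole of order at most \<open>k\<close> at \<open>1 / c\<close> modulo summable series.
  Sums and summable factors preserve the order, \<open>geo c\<close> raises it by one.\<close>

definition polar_upto :: "real \<Rightarrow> nat \<Rightarrow> real fps \<Rightarrow> bool" where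
  "polar_upto c k f \<longleftrightarrow> (\<exists>d g. fps_l1 g \<and> f = (\<Sum>j<k. fps_const (d j) * geo c ^ Suc j) + g)"

lemma polar_upto_add:
  assumes "polar_upto c k f" "polar_upto c k f'"
  shows "polar_upto c k (f + f')"
proof -
  obtain d g where 1: "fps_l1 g" "f = (\<Sum>j<k. fps_const (d j) * geo c ^ Suc j) + g"
    using assms(1) by (auto simp: polar_upto_def)
  obtain d' g' where 2: "fps_l1 g'" "f' = (\<Sum>j<k. fps_const (d' j) * geo c ^ Suc j) + g'"
    using assms(2) by (auto simp: polar_upto_def)
  have "f + f' = (\<Sum>j<k. fps_const (d j + d' j) * geo c ^ Suc j) + (g + g')"
    unfolding 1(2) 2(2) by (simp add: sum.distrib distrib_right flip: fps_const_add)
  then show ?thesis unfolding polar_upto_def using fps_l1_add[OF 1(1) 2(1)]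
    by (intro exI[of _ "\<lambda>j. d j + d' j"] exI[of _ "g + g'"]) auto
qed

lemma polar_upto_l1: "fps_l1 g \<Longrightarrow> polar_upto c k g"
  unfolding polar_upto_def by (intro exI[of _ "\<lambda>_. 0"] exI[of _ g]) simp

lemma polar_upto_const_mult:
  assumes "polar_upto c k f"
  shows "polar_upto c k (fps_const b * f)"
proof -
  obtain d g where 1: "fps_l1 g" "f = (\<Sum>j<k. fps_const (d j) * geo c ^ Suc j) + g"
    using assms(1) by (auto simp: polar_upto_def)
  have "fps_const b * f = (\<Sum>j<k. fps_const (b * d j) * geo c ^ Suc j) + fps_const b * g"
    unfolding 1(2) distrib_left sum_distrib_left mult.assoc[symmetric] fps_const_mult ..
  then show ?thesis unfolding polar_upto_def using fps_l1_const_mult[OF 1(1), of b]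
    by (intro exI[of _ "\<lambda>j. b * d j"] exI[of _ "fps_const b * g"]) auto
qed

lemma polar_upto_mono:
  assumes "polar_upto c k f" "k \<le> k'"
  shows "polar_upto c k' f"
proof -
  obtain d g where 1: "fps_l1 g" "f = (\<Sum>j<k. fps_const (d j) * geo c ^ Suc j) + g"
    using assms(1) by (auto simp: polar_upto_def)
  have "(\<Sum>j<k. fps_const (d j) * geo c ^ Suc j)
      = (\<Sum>j<k'. fps_const (if j < k then d j else 0) * geo c ^ Suc j)"
    using assms(2) by (intro sum.mono_neutral_cong_left) auto
  then show ?thesis unfolding polar_upto_def using 1
    by (intro exI[of _ "\<lambda>j. if j < k then d j else 0"] exI[of _ g]) simp
qed

text \<open>Apart from its value at the pole, \<open>f\<close> is a multiple of
  \<open>1 - c X\<close>, and this factor cancels \<open>geo c\<close>.\<close>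

lemma geo_mult_l1:
  assumes "c > 1" "fps_l1 f"
  shows "\<exists>g. fps_l1 g \<and> geo c * f = fps_const (fps_value f (1 / c)) * geo c + g"
proof -
  have x: "0 < 1 / c" "1 / c < 1" using assms by auto
  obtain g where g: "fps_l1 g" "f = fps_const (fps_value f (1 / c)) + (1 - fps_const c * fps_X) * g"
    using fps_l1_linear_division[OF assms(2) x] by auto
  have "geo c * f = geo c * (fps_const (fps_value f (1 / c)) + (1 - fps_const c * fps_X) * g)"
    by (rule arg_cong[OF g(2)])
  also have "\<dots> = fps_const (fps_value f (1 / c)) * geo c + ((1 - fps_const c * fps_X) * geo c) * g"
    by (simp only: distrib_left mult_ac)
  finally show ?thesis using g(1) geometric_fps_mult[of c] by auto
qed

lemma polar_upto_geo_mult: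
  assumes "c > 1" "polar_upto c k f"
  shows "polar_upto c (Suc k) (geo c * f)"
proof -
  obtain d g where 1: "fps_l1 g" "f = (\<Sum>j<k. fps_const (d j) * geo c ^ Suc j) + g"
    using assms(2) by (auto simp: polar_upto_def)
  obtain h where h: "fps_l1 h" "geo c * g = fps_const (fps_value g (1 / c)) * geo c + h"
    using geo_mult_l1[OF assms(1) 1(1)] by blast
  define d' where "d' = (\<lambda>j. case j of 0 \<Rightarrow> fps_value g (1 / c) | Suc i \<Rightarrow> d i)"
  have "geo c * f = (\<Sum>j<k. fps_const (d j) * geo c ^ Suc (Suc j)) + geo c * g"
    unfolding 1(2) distrib_left sum_distrib_left by (simp add: mult_ac)
  also have "\<dots> = (\<Sum>j<Suc k. fps_const (d' j) * geo c ^ Suc j) + h"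
    unfolding h(2) sum.lessThan_Suc_shift by (simp add: d'_def)
  finally show ?thesis unfolding polar_upto_def using h(1) by blast
qed

lemma polar_upto_l1_mult:
  assumes c: "c > 1" and f: "polar_upto c k f" and h: "fps_l1 h"
  shows "polar_upto c k (h * f)"
proof -
  obtain d g where 1: "fps_l1 g" "f = (\<Sum>j<k. fps_const (d j) * geo c ^ Suc j) + g"
    using f by (auto simp: polar_upto_def)
  have pow: "polar_upto c j (geo c ^ j * h)" for j
  proof (induction j)
    case (Suc j)
    from polar_upto_geo_mult[OF c this] show ?case by (simp add: mult.assoc)
  qed (simp add: polar_upto_l1 h)
  have "polar_upto c k (\<Sum>j<i. fps_const (d j) * (geo c ^ Suc j * h))" if "i \<le> k" for i
    using that
  proof (induction i)
    case 0
    then show ?case using polar_upto_l1[OF fps_l1_const[of 0]] by simp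
  next
    case (Suc i)
    have "polar_upto c k (fps_const (d i) * (geo c ^ Suc i * h))"
      using Suc.prems by (intro polar_upto_const_mult polar_upto_mono[OF pow]) auto
    then show ?case using Suc by (simp add: polar_upto_add)
  qed
  then have "polar_upto c k ((\<Sum>j<k. fps_const (d j) * (geo c ^ Suc j * h)) + h * g)"
    by (rule polar_upto_add) (simp, intro polar_upto_l1 fps_l1_mult h 1)
  also have "(\<Sum>j<k. fps_const (d j) * (geo c ^ Suc j * h)) + h * g = h * f"
    unfolding 1(2) distrib_left sum_distrib_left by (simp only: mult_ac)
  finally show ?thesis .
qed

text \<open>Every term of the expanded power other than the pure power of the pole contains a factor
  \<open>h\<close>, hence has order at most \<open>s\<close>. So \<open>b\<close> alone fixes the
  leading coefficient of the polynomial.\<close>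

lemma polar_power:
  assumes c: "c > 1" and h: "fps_l1 h"
  shows "polar_upto c s ((fps_const b * geo c + h) ^ Suc s - fps_const (b ^ Suc s) * geo c ^ Suc s)"
proof (induction s)
  case 0
  then show ?case using h by (simp add: polar_upto_l1)
next
  case (Suc s)
  let ?w = "geo c" and ?F = "fps_const b * geo c + h"
  let ?r = "?F ^ Suc s - fps_const (b ^ Suc s) * ?w ^ Suc s"
  have "polar_upto c (Suc s) (fps_const b * (?w * ?r) + h * ?r + fps_const (b ^ Suc s) * (h * ?w ^ Suc s))"
  proof (intro polar_upto_add polar_upto_const_mult)
    show "polar_upto c (Suc s) (?w * ?r)" by (rule polar_upto_geo_mult[OF c Suc])
    show "polar_upto c (Suc s) (h * ?r)"
      by (intro polar_upto_l1_mult c h polar_upto_mono[OF Suc]) simp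
    have "polar_upto c (Suc s) (?w ^ Suc s)"
      unfolding polar_upto_def
      by (intro exI[of _ "\<lambda>j. if j = s then 1 else 0"] exI[of _ 0])
         (use fps_l1_const[of 0] in \<open>simp add: if_distrib[of fps_const] if_distribR sum.delta cong: if_cong\<close>)
    then show "polar_upto c (Suc s) (h * ?w ^ Suc s)" by (intro polar_upto_l1_mult c h)
  qed
  also have "fps_const b * (?w * ?r) + h * ?r + fps_const (b ^ Suc s) * (h * ?w ^ Suc s)
      = ?F ^ Suc (Suc s) - fps_const (b ^ Suc (Suc s)) * ?w ^ Suc (Suc s)"
  proof -
    have "b' * (w * r) + h * r + a * (h * v) = (b' * w + h) * (r + a * v) - (b' * a) * (w * v)"
      for b' w r a v :: "real fps" by (simp add: algebra_simps)
    from this[of "fps_const b" ?w ?r "fps_const (b ^ Suc s)" "?w ^ Suc s"]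
    show ?thesis by (simp only: diff_add_cancel power_Suc[symmetric] fps_const_mult)
  qed
  finally show ?case .
qed

lemma polar_power_coeffs:
  assumes c: "c > 1" and h: "fps_l1 h" and b: "b > 0" and s: "s \<ge> 1"
  shows "\<exists>P::real poly. \<exists>C. degree P = s - 1 \<and> lead_coeff P = b ^ s / fact (s - 1)
    \<and> (\<forall>n. \<bar>fps_nth ((fps_const b * geo c + h) ^ s) n - poly P (real n) * c ^ n\<bar> \<le> C)"
proof -
  obtain k where k: "s = Suc k" using s by (cases s) auto
  obtain d g where g: "fps_l1 g" "(fps_const b * geo c + h) ^ Suc k - fps_const (b ^ Suc k) * geo c ^ Suc k
      = (\<Sum>j<k. fps_const (d j) * geo c ^ Suc j) + g"
    using polar_power[OF c h, of k b] by (auto simp: polar_upto_def)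
  define Q where "Q = (\<Sum>j<k. smult (d j) (binomial_poly j))"
  define P where "P = smult (b ^ Suc k) (binomial_poly k) + Q"
  have deg: "degree (smult (b ^ Suc k) (binomial_poly k)) = k"
    using b by (simp add: degree_binomial_poly)
  have Q: "Q = 0 \<or> degree Q < k"
  proof (cases "k = 0")
    case False
    then have "degree Q < k" unfolding Q_def
      by (intro degree_sum_less) (auto intro: le_less_trans[OF degree_smult_le] simp: degree_binomial_poly)
    then show ?thesis ..
  qed (simp add: Q_def)
  have "degree P = k" using Q deg unfolding P_def by (auto simp: degree_add_eq_left)
  moreover have "lead_coeff P = b ^ Suc k / fact k"
  proof -
    have "coeff Q k = 0" using Q by (auto simp: coeff_eq_0)
    then show ?thesis using \<open>degree P = k\<close> lead_coeff_binomial_poly[of k]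
      by (simp add: P_def degree_binomial_poly)
  qed
  moreover have "\<bar>fps_nth ((fps_const b * geo c + h) ^ Suc k) n - poly P (real n) * c ^ n\<bar> \<le> fps_norm1 g" for n
  proof -
    have "(fps_const b * geo c + h) ^ Suc k = fps_const (b ^ Suc k) * geo c ^ Suc k
        + ((\<Sum>j<k. fps_const (d j) * geo c ^ Suc j) + g)"
      using g(2) by (simp only: diff_eq_eq add.commute)
    then have "fps_nth ((fps_const b * geo c + h) ^ Suc k) n = poly P (real n) * c ^ n + fps_nth g n"
      by (simp only: fps_add_nth fps_mult_left_const_nth fps_sum_nth geo_power_nth)
         (simp add: P_def Q_def poly_sum distrib_right sum_distrib_right mult.assoc)
    then show ?thesis using fps_nth_le_norm1[OF g(1), of n] by simp
  qed
  ultimately show ?thesis unfolding k by auto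
qed

lemma W2_asymptotics:
  assumes c: "c > 1" and h: "fps_l1 h" and b: "b > 0" and s: "s \<ge> 1"
    and eq: "scaled_fps = fps_const b * geo c + h"
  shows "\<exists>P::real poly. degree P = s - 1 \<and> lead_coeff P = b ^ s / fact (s - 1)
    \<and> (\<exists>\<epsilon>::nat \<Rightarrow> real. \<epsilon> \<in> O(\<lambda>n. (1 / c) ^ n) \<and> (\<forall>\<^sub>F n in sequentially.
      real (W2 s n) / fact n = poly P (real n) * (2 * c / 3) ^ n * (1 + \<epsilon> n)))"
proof -
  obtain P :: "real poly" and C where P: "degree P = s - 1" "lead_coeff P = b ^ s / fact (s - 1)"
    and C: "\<And>n. \<bar>fps_nth (scaled_fps ^ s) n - poly P (real n) * c ^ n\<bar> \<le> C"
    using polar_power_coeffs[OF c h b s] unfolding eq by blast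
  \<comment> \<open>Eventually \<open>P\<close> is at least its leading coefficient, also in degree
    0. The absolute error is bounded, so dividing it by the main term gives O((1 / c) ^ n) with no
    power of \<open>n\<close>.\<close>
  have "lead_coeff P > 0" unfolding P(2) using b by simp
  then obtain x0 where x0: "\<And>x. x \<ge> x0 \<Longrightarrow> poly P x \<ge> lead_coeff P"
    using poly_pinfty_gt_lc by blast
  have ev: "\<forall>\<^sub>F n in sequentially. poly P (real n) \<ge> lead_coeff P"
    using eventually_ge_at_top[of "nat \<lceil>x0\<rceil>"] by eventually_elim (intro x0, linarith)
  have W: "real (W2 s n) / fact n = fps_nth (scaled_fps ^ s) n * (2 / 3) ^ n" for n
  proof -
    have "(3 / 2 :: real) ^ n * (2 / 3) ^ n = 1" by (simp flip: power_mult_distrib)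
    then show ?thesis by (simp add: W2_eq_lim_fps_power[OF s] scaled_fps_power_nth mult.assoc)
  qed
  define \<epsilon> where "\<epsilon> = (\<lambda>n. (fps_nth (scaled_fps ^ s) n - poly P (real n) * c ^ n) / (poly P (real n) * c ^ n))"
  have "\<epsilon> \<in> O(\<lambda>n. (1 / c) ^ n)"
  proof (rule bigoI[of _ "C / lead_coeff P"])
    show "\<forall>\<^sub>F n in sequentially. norm (\<epsilon> n) \<le> C / lead_coeff P * norm ((1 / c) ^ n)"
      using ev
    proof eventually_elim
      case (elim n)
      have "\<bar>\<epsilon> n\<bar> = \<bar>fps_nth (scaled_fps ^ s) n - poly P (real n) * c ^ n\<bar> / (poly P (real n) * c ^ n)"
        using elim \<open>lead_coeff P > 0\<close> c by (simp add: \<epsilon>_def abs_mult)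
      also have "\<dots> \<le> C / (lead_coeff P * c ^ n)"
        using elim \<open>lead_coeff P > 0\<close> c C[of n]
        by (intro frac_le mult_right_mono) (auto intro: order.trans[OF abs_ge_zero])
      also have "\<dots> = C / lead_coeff P * norm ((1 / c) ^ n)" using c by (simp add: power_divide)
      finally show ?case by simp
    qed
  qed
  moreover have "\<forall>\<^sub>F n in sequentially.
      real (W2 s n) / fact n = poly P (real n) * (2 * c / 3) ^ n * (1 + \<epsilon> n)"
    using ev
  proof eventually_elim
    case (elim n)
    have "poly P (real n) * c ^ n \<noteq> 0" using elim \<open>lead_coeff P > 0\<close> c by auto
    then have "poly P (real n) * c ^ n * (1 + \<epsilon> n) = fps_nth (scaled_fps ^ s) n"
      by (simp add: \<epsilon>_def distrib_left)
    moreover have "(2 * c / 3) ^ n = c ^ n * (2 / 3) ^ n"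
      by (simp only: power_mult_distrib[symmetric]) (simp add: mult.commute)
    ultimately show ?case unfolding W by simp
  qed
  ultimately show ?thesis using P by blast
qed

text \<open>Besides the geometric factor there is only \<open>b * (1 + \<epsilon> n)\<close>,
  eventually between \<open>b / 2\<close> and \<open>2 * b\<close>, and the roots of these constants
  tend to 1.\<close>

lemma W2_root_limit:
  assumes c: "c > 1" and h: "fps_l1 h" and b: "b > 0"
    and eq: "scaled_fps = fps_const b * geo c + h"
  shows "(\<lambda>n. root n (real (W2 1 n) / fact n)) \<longlonglongrightarrow> 2 * c / 3"
proof -
  let ?g = "2 * c / 3"
  obtain P :: "real poly" and \<epsilon> :: "nat \<Rightarrow> real" where P: "degree P = 0" "lead_coeff P = b"
    and e: "\<epsilon> \<in> O(\<lambda>n. (1 / c) ^ n)" "\<forall>\<^sub>F n in sequentially.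
      real (W2 1 n) / fact n = poly P (real n) * ?g ^ n * (1 + \<epsilon> n)"
    using W2_asymptotics[OF c h b _ eq, of 1] by auto
  have P_eq: "poly P x = b" for x
    using P by (auto elim!: degree_eq_zeroE)
  have "(\<lambda>n. (1 / c) ^ n) \<longlonglongrightarrow> 0" using c by (intro LIMSEQ_realpow_zero) auto
  moreover obtain C where "\<forall>\<^sub>F n in sequentially. norm (\<epsilon> n) \<le> C * norm ((1 / c) ^ n)"
    using e(1) by (elim landau_o.bigE)
  ultimately have "\<epsilon> \<longlonglongrightarrow> 0"
    by (rule tendsto_0_le[where K = C, OF _ eventually_mono]) (simp add: mult.commute)
  then have "\<forall>\<^sub>F n in sequentially. dist (\<epsilon> n) 0 < 1 / 2"
    by (rule tendstoD) simp
  then have "\<forall>\<^sub>F n in sequentially. \<bar>\<epsilon> n\<bar> < 1 / 2"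
    by (simp only: dist_real_def diff_0_right)
  with e(2) eventually_gt_at_top[of 0]
  have ev: "\<forall>\<^sub>F n in sequentially. root n (b / 2) * ?g \<le> root n (real (W2 1 n) / fact n)
      \<and> root n (real (W2 1 n) / fact n) \<le> root n (2 * b) * ?g"
  proof eventually_elim
    case (elim n)
    have g: "root n (x * ?g ^ n) = root n x * ?g" for x
      using elim(2) c by (simp add: real_root_mult real_root_power_cancel)
    have b1: "b / 2 \<le> b * (1 + \<epsilon> n)" and b2: "b * (1 + \<epsilon> n) \<le> 2 * b"
      using mult_left_mono[of "1 / 2" "1 + \<epsilon> n" b] mult_left_mono[of "1 + \<epsilon> n" 2 b] elim(3) b
      by (simp_all add: abs_less_iff mult.commute)
    have g0: "0 \<le> ?g ^ n" using c by simp
    have W: "real (W2 1 n) / fact n = b * (1 + \<epsilon> n) * ?g ^ n"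
      unfolding elim(1) P_eq by (simp only: mult_ac)
    have "root n (b / 2 * ?g ^ n) \<le> root n (real (W2 1 n) / fact n)"
      "root n (real (W2 1 n) / fact n) \<le> root n (2 * b * ?g ^ n)"
      unfolding W real_root_le_iff[OF elim(2)]
      by (rule mult_right_mono[OF b1 g0], rule mult_right_mono[OF b2 g0])
    then show ?case unfolding g ..
  qed
  have lim: "(\<lambda>n. root n x * ?g) \<longlonglongrightarrow> ?g" if "x > 0" for x
    using tendsto_mult[OF LIMSEQ_root_const[OF that] tendsto_const[of ?g]] by simp
  show ?thesis
  proof (rule tendsto_sandwich)
    show "\<forall>\<^sub>F n in sequentially. root n (b / 2) * ?g \<le> root n (real (W2 1 n) / fact n)"
      "\<forall>\<^sub>F n in sequentially. root n (real (W2 1 n) / fact n) \<le> root n (2 * b) * ?g"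
      using ev unfolding eventually_conj_iff by blast+
    show "(\<lambda>n. root n (b / 2) * ?g) \<longlonglongrightarrow> ?g" "(\<lambda>n. root n (2 * b) * ?g) \<longlonglongrightarrow> ?g"
      by (rule lim; use b in simp)+
  qed
qed

section \<open>Integer certificates\<close>

fun list_add :: "int list \<Rightarrow> int list \<Rightarrow> int list" where
  "list_add [] ys = ys"
| "list_add xs [] = xs"
| "list_add (x # xs) (y # ys) = (x + y) # list_add xs ys"

text \<open>Since \<open>n (n - 1) \<dots> (n - j + 1) = fact n / fact (n - j)\<close>, the products with falling factorials below
  turn the rows of the kernel into integer computations.\<close>

fun falling_dot :: "int \<Rightarrow> int \<Rightarrow> int list \<Rightarrow> int" where
  "falling_dot n a [] = 0"
| "falling_dot n a (v # vs) = a * v + falling_dot (n - 1) (a * n) vs"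

fun falling_comb :: "int \<Rightarrow> int \<Rightarrow> int list list \<Rightarrow> int list" where
  "falling_comb n a [] = []"
| "falling_comb n a (v # vs) = list_add (map ((*) a) v) (falling_comb (n - 1) (a * n) vs)"

definition list_norm1 :: "int list \<Rightarrow> int" where
  "list_norm1 xs = sum_list (map abs xs)"

definition list_fps :: "int \<Rightarrow> int list \<Rightarrow> real fps" where
  "list_fps S xs = Abs_fps (\<lambda>n. if n < length xs then real_of_int (xs ! n) / real_of_int S else 0)"

text \<open>The value 0 for \<open>j > n\<close> switches off the entries beyond
  \<open>2 * i\<close> in row \<open>i\<close>, so that every row can run over the whole
  list.\<close>

definition falling :: "nat \<Rightarrow> nat \<Rightarrow> real" where
  "falling n j = (if j \<le> n then fact n / fact (n - j) else 0)"

lemma falling_0 [simp]: "falling n 0 = 1"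
  by (simp add: falling_def)

lemma falling_Suc [simp]: "falling (Suc n) (Suc j) = real (Suc n) * falling n j" "falling 0 (Suc j) = 0"
  by (simp_all add: falling_def)

lemma kern_eq_falling:
  "j \<le> 2 * i \<Longrightarrow> kern i j = 3 ^ i / (2 ^ i * fact (2 * i)) * falling (2 * i) j"
  by (simp add: kern_def falling_def power_divide)

lemma falling_dot_0 [simp]: "falling_dot n 0 vs = 0"
  by (induction vs arbitrary: n) auto

lemma falling_dot_eq:
  "real_of_int (falling_dot (int n) a vs) = (\<Sum>j<length vs. real_of_int a * falling n j * real_of_int (vs ! j))"
proof (induction vs arbitrary: n a)
  case (Cons v vs)
  show ?case
  proof (cases n)
    case 0
    then show ?thesis by (simp add: sum.lessThan_Suc_shift del: sum.lessThan_Suc)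
  next
    case (Suc m)
    have im: "int (Suc m) - 1 = int m" by simp
    show ?thesis
      using Cons[of m "a * int n"] Suc by (simp add: im sum.lessThan_Suc_shift mult_ac del: of_nat_Suc sum.lessThan_Suc)
  qed
qed simp

lemma list_fps_Nil [simp]: "list_fps S [] = 0"
  by (rule fps_ext) (simp add: list_fps_def)

lemma list_fps_Cons:
  "list_fps S (x # xs) = fps_const (real_of_int x / real_of_int S) + fps_X * list_fps S xs"
proof (rule fps_ext)
  fix n
  show "fps_nth (list_fps S (x # xs)) n
      = fps_nth (fps_const (real_of_int x / real_of_int S) + fps_X * list_fps S xs) n"
    by (cases n) (simp_all add: list_fps_def)
qed

lemma list_fps_add: "list_fps S (list_add xs ys) = list_fps S xs + list_fps S ys"
  by (induction xs ys rule: list_add.induct)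
     (simp_all add: list_fps_Cons add_divide_distrib algebra_simps flip: fps_const_add)

lemma list_fps_map_mult: "list_fps S (map ((*) a) xs) = fps_const (real_of_int a) * list_fps S xs"
  by (induction xs) (simp_all add: list_fps_Cons algebra_simps)

lemma list_fps_shift: "list_fps S (replicate i 0 @ xs) = fps_X ^ i * list_fps S xs"
  by (induction i) (simp_all add: list_fps_Cons mult_ac)

lemma fps_l1_list_fps [simp]: "fps_l1 (list_fps S xs)"
  by (induction xs) (auto simp: list_fps_Cons fps_l1_const[of 0, simplified] intro!: fps_l1_intros)

lemma fps_norm1_list_fps:
  assumes "S > 0"
  shows "fps_norm1 (list_fps S xs) = real_of_int (list_norm1 xs) / real_of_int S"
proof -
  have "fps_norm1 (list_fps S xs) = (\<Sum>n<length xs. \<bar>fps_nth (list_fps S xs) n\<bar>)"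
    unfolding fps_norm1_def by (rule suminf_finite) (auto simp: list_fps_def)
  also have "\<dots> = (\<Sum>n<length xs. real_of_int \<bar>xs ! n\<bar>) / real_of_int S"
    using assms by (simp add: list_fps_def sum_divide_distrib)
  finally show ?thesis
    by (simp add: list_norm1_def sum_list_sum_nth atLeast0LessThan)
qed

lemma falling_comb_0 [simp]: "list_fps S (falling_comb n 0 vs) = 0"
proof (induction vs arbitrary: n)
  case (Cons v vs)
  have "list_fps S (map ((*) 0) v) = 0" by (simp add: list_fps_map_mult)
  with Cons show ?case by (simp add: list_fps_add)
qed simp

lemma list_fps_falling_comb:
  "list_fps S (falling_comb (int n) a vs)
    = (\<Sum>j<length vs. fps_const (real_of_int a * falling n j) * list_fps S (vs ! j))"
proof (induction vs arbitrary: n a)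
  case (Cons v vs)
  show ?case
  proof (cases n)
    case 0
    then show ?thesis by (simp add: sum.lessThan_Suc_shift list_fps_add list_fps_map_mult del: sum.lessThan_Suc)
  next
    case (Suc m)
    have im: "int (Suc m) - 1 = int m" by simp
    show ?thesis
      using Cons[of m "a * int n"] Suc
      by (simp add: im sum.lessThan_Suc_shift list_fps_add list_fps_map_mult mult_ac del: of_nat_Suc sum.lessThan_Suc)
  qed
qed simp

text \<open>The residual of equation \<open>i\<close>, multiplied by
  \<open>2 ^ i * fact (2 * i)\<close> to clear the denominators of the kernel.\<close>

definition residual_list :: "int list list \<Rightarrow> nat \<Rightarrow> int list" where
  "residual_list Ls i = list_add (replicate i 0 @ map ((*) (3 ^ i)) (falling_comb (int (2 * i)) 1 Ls))
     (map ((*) (- (2 ^ i * fact (2 * i)))) (Ls ! i))"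

lemma sum_kern_restrict:
  fixes g :: "nat \<Rightarrow> 'a::semiring_0"
  assumes "\<And>j. j \<ge> n \<Longrightarrow> g j = 0" "\<And>j. j > 2 * i \<Longrightarrow> h j = 0" "\<And>j. j \<le> 2 * i \<Longrightarrow> k j = h j"
  shows "(\<Sum>j\<le>2 * i. k j * g j) = (\<Sum>j<n. h j * g j)"
proof -
  have "(\<Sum>j\<le>2 * i. k j * g j) = (\<Sum>j\<in>{..2 * i} \<inter> {..<n}. h j * g j)"
  proof (rule sum.mono_neutral_cong_right)
    show "\<forall>j\<in>{..2 * i} - {..2 * i} \<inter> {..<n}. k j * g j = 0"
    proof
      fix j assume "j \<in> {..2 * i} - {..2 * i} \<inter> {..<n}"
      then have "j \<ge> n" by auto
      then show "k j * g j = 0" by (simp only: assms(1) mult_zero_right)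
    qed
    show "k j * g j = h j * g j" if "j \<in> {..2 * i} \<inter> {..<n}" for j
      using that assms(3)[of j] by simp
  qed auto
  also have "\<dots> = (\<Sum>j<n. h j * g j)"
  proof (rule sum.mono_neutral_left)
    show "\<forall>j\<in>{..<n} - {..2 * i} \<inter> {..<n}. h j * g j = 0"
    proof
      fix j assume "j \<in> {..<n} - {..2 * i} \<inter> {..<n}"
      then have "j > 2 * i" by auto
      then show "h j * g j = 0" by (simp only: assms(2) mult_zero_left)
    qed
  qed auto
  finally show ?thesis .
qed

text \<open>The a posteriori estimate as finitely many integer inequalities: one for the residual of
  each row up to \<open>I\<close>, and a single one for all the rows beyond.\<close>

lemma tail_sys_list_approx:
  assumes e: "tail_sys e" and len: "length Ls = Suc I" and I: "I \<ge> 2" and S: "S > 0"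
    and bd: "\<And>j. j < 3 \<Longrightarrow> e j = list_fps S (Ls ! j)"
    and rows: "list_all (\<lambda>i. 10 ^ i * list_norm1 (residual_list Ls i) \<le> B * (2 ^ i * fact (2 * i))) [3..<Suc I]"
    and tail: "15 ^ Suc I * falling_dot (int (2 * Suc I)) 1 (map list_norm1 Ls) \<le> B * fact (2 * Suc I)"
    and i: "3 \<le> i" "i \<le> I"
  shows "fps_norm1 (e i - list_fps S (Ls ! i)) \<le> real_of_int B / real_of_int S / (23 / 100) / 10 ^ i"
proof -
  define q where "q = (\<lambda>j. if j \<le> I then list_fps S (Ls ! j) else 0)"
  have q_l1: "fps_l1 (q j)" for j using fps_l1_const[of 0] by (simp add: q_def)
  have res: "fps_norm1 (fps_X ^ i * (\<Sum>j\<le>2 * i. fps_const (kern i j) * q j) - q i)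
      \<le> real_of_int B / real_of_int S / 10 ^ i" if i: "3 \<le> i" "i \<le> I" for i
  proof -
    define c where "c = 2 ^ i * (fact (2 * i) :: int)"
    have c: "c > 0" by (simp add: c_def)
    have "(\<Sum>j\<le>2 * i. fps_const (kern i j) * q j)
        = (\<Sum>j<Suc I. fps_const (3 ^ i / real_of_int c * falling (2 * i) j) * q j)"
    proof (rule sum_kern_restrict)
      show "q j = 0" if "Suc I \<le> j" for j using that by (simp add: q_def)
      show "fps_const (3 ^ i / real_of_int c * falling (2 * i) j) = 0" if "2 * i < j" for j
        using that by (simp add: falling_def)
      show "fps_const (kern i j) = fps_const (3 ^ i / real_of_int c * falling (2 * i) j)" if "j \<le> 2 * i" for j
        unfolding kern_eq_falling[OF that] c_def by simp
    qed
    also have "\<dots> = fps_const (3 ^ i / real_of_int c) * (\<Sum>j<Suc I. fps_const (falling (2 * i) j) * list_fps S (Ls ! j))"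
      unfolding sum_distrib_left
      by (rule sum.cong) (simp_all only: q_def fps_const_mult[symmetric] mult.assoc lessThan_iff less_Suc_eq_le if_True)
    also have "(\<Sum>j<Suc I. fps_const (falling (2 * i) j) * list_fps S (Ls ! j))
        = list_fps S (falling_comb (int (2 * i)) 1 Ls)"
      using list_fps_falling_comb[of S "2 * i" 1 Ls] by (simp add: len del: sum.lessThan_Suc)
    finally have sum_eq: "(\<Sum>j\<le>2 * i. fps_const (kern i j) * q j)
        = fps_const (3 ^ i / real_of_int c) * list_fps S (falling_comb (int (2 * i)) 1 Ls)" .
    have k: "fps_const (3 ^ i / real_of_int c) = fps_const (1 / real_of_int c) * fps_const (3 ^ i)"
      "fps_const (1 / real_of_int c) * fps_const (- real_of_int c) = - 1"
      using c by (simp_all flip: fps_const_neg)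
    have "k * u = - 1 \<Longrightarrow> z * ((k * t) * r) - y = k * (z * (t * r) + u * y)" for k u z t r y :: "real fps"
      by algebra
    from this[OF k(2)]
    have "fps_X ^ i * (\<Sum>j\<le>2 * i. fps_const (kern i j) * q j) - q i
        = fps_const (1 / real_of_int c) * (fps_X ^ i * (fps_const (3 ^ i) * list_fps S (falling_comb (int (2 * i)) 1 Ls))
          + fps_const (- real_of_int c) * list_fps S (Ls ! i))"
      unfolding sum_eq k(1) using i by (simp only: q_def if_True)
    also have "\<dots> = fps_const (1 / real_of_int c) * list_fps S (residual_list Ls i)"
      unfolding residual_list_def list_fps_add list_fps_shift list_fps_map_mult c_def by simp
    finally have "fps_norm1 (fps_X ^ i * (\<Sum>j\<le>2 * i. fps_const (kern i j) * q j) - q i)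
        = real_of_int (list_norm1 (residual_list Ls i)) / real_of_int S / real_of_int c"
      using c S by (simp add: fps_norm1_const_mult fps_norm1_list_fps)
    also have "real_of_int (list_norm1 (residual_list Ls i)) \<le> real_of_int B * real_of_int c / 10 ^ i"
    proof -
      have "i \<in> set [3..<Suc I]" using i by auto
      then have "10 ^ i * list_norm1 (residual_list Ls i) \<le> B * c"
        using rows unfolding list_all_iff c_def by blast
      then have "real_of_int (10 ^ i * list_norm1 (residual_list Ls i)) \<le> real_of_int (B * c)"
        by (simp only: of_int_le_iff)
      then show ?thesis by (simp add: field_simps)
    qed
    finally show ?thesis using S c by (simp add: divide_right_mono field_simps)
  qed
  have tl: "(\<Sum>j\<le>I. 15 ^ Suc I / fact (2 * Suc I - j) * fps_norm1 (q j)) \<le> real_of_int B / real_of_int S"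
  proof -
    let ?F = "fact (2 * Suc I) :: real"
    have "(\<Sum>j\<le>I. 15 ^ Suc I / fact (2 * Suc I - j) * fps_norm1 (q j))
        = (\<Sum>j<Suc I. 15 ^ Suc I / ?F / real_of_int S * (falling (2 * Suc I) j * real_of_int (list_norm1 (Ls ! j))))"
      unfolding lessThan_Suc_atMost
      by (rule sum.cong) (auto simp: q_def fps_norm1_list_fps S falling_def mult_ac)
    also have "\<dots> = 15 ^ Suc I / ?F / real_of_int S * real_of_int (falling_dot (int (2 * Suc I)) 1 (map list_norm1 Ls))"
      unfolding falling_dot_eq sum_distrib_left[symmetric] using len
      by (intro arg_cong2[where f = "(*)"] sum.cong) auto
    also have "\<dots> = real_of_int (15 ^ Suc I * falling_dot (int (2 * Suc I)) 1 (map list_norm1 Ls)) / ?F / real_of_int S"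
      by simp
    also have "\<dots> \<le> real_of_int (B * fact (2 * Suc I)) / ?F / real_of_int S"
      by (intro divide_right_mono) (use tail S in \<open>simp_all only: of_int_le_iff\<close>, auto)
    also have "\<dots> = real_of_int B / real_of_int S" by simp
    finally show ?thesis .
  qed
  have "fps_norm1 (e i - q i) \<le> real_of_int B / real_of_int S / (23 / 100) / 10 ^ i"
    by (rule tail_sys_approx(2)[OF e _ q_l1 _ I res tl i(1)]) (use I in \<open>auto simp: q_def bd\<close>)
  then show ?thesis using i by (simp add: q_def)
qed

lemma tail_sys_int_value_approx:
  assumes e: "tail_sys e" and l1: "\<And>j. j < 3 \<Longrightarrow> fps_l1 (e j)"
    and len: "length V = Suc I" and I: "I \<ge> 2" and S: "S > 0"
    and x: "x = real_of_int m / real_of_int M" "0 \<le> m" "m \<le> M" "0 < M"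
    and bd: "\<And>j. j < 3 \<Longrightarrow> fps_value (e j) x = real_of_int (V ! j) / real_of_int S"
    and rows: "list_all (\<lambda>i. 10 ^ i * \<bar>(3 * m) ^ i * falling_dot (int (2 * i)) 1 V
      - (2 * M) ^ i * fact (2 * i) * V ! i\<bar> \<le> B * ((2 * M) ^ i * fact (2 * i))) [3..<Suc I]"
    and tail: "(15 * m) ^ Suc I * falling_dot (int (2 * Suc I)) 1 (map abs V) \<le> B * (M ^ Suc I * fact (2 * Suc I))"
    and i: "3 \<le> i" "i \<le> I"
  shows "\<bar>fps_value (e i) x - real_of_int (V ! i) / real_of_int S\<bar> \<le> real_of_int B / real_of_int S / (23 / 100) / 10 ^ i"
proof -
  define v where "v = (\<lambda>j. if j \<le> I then real_of_int (V ! j) / real_of_int S else 0)"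
  have x01: "0 \<le> x" "x \<le> 1" using x by auto
  have res: "\<bar>x ^ i * (\<Sum>j\<le>2 * i. kern i j * v j) - v i\<bar> \<le> real_of_int B / real_of_int S / 10 ^ i"
    if i: "3 \<le> i" "i \<le> I" for i
  proof -
    define c where "c = 2 ^ i * (fact (2 * i) :: real)"
    have c: "c > 0" by (simp add: c_def)
    define T where "T = (3 * m) ^ i * falling_dot (int (2 * i)) 1 V - (2 * M) ^ i * fact (2 * i) * V ! i"
    have "(\<Sum>j\<le>2 * i. kern i j * v j) = (\<Sum>j<Suc I. 3 ^ i / c * falling (2 * i) j * v j)"
    proof (rule sum_kern_restrict)
      show "v j = 0" if "Suc I \<le> j" for j using that by (simp add: v_def)
      show "3 ^ i / c * falling (2 * i) j = 0" if "2 * i < j" for j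
        using that by (simp add: falling_def)
      show "kern i j = 3 ^ i / c * falling (2 * i) j" if "j \<le> 2 * i" for j
        unfolding kern_eq_falling[OF that] c_def ..
    qed
    also have "\<dots> = 3 ^ i / c / real_of_int S * (\<Sum>j<Suc I. falling (2 * i) j * real_of_int (V ! j))"
      unfolding sum_distrib_left by (rule sum.cong) (auto simp: v_def)
    also have "(\<Sum>j<Suc I. falling (2 * i) j * real_of_int (V ! j)) = real_of_int (falling_dot (int (2 * i)) 1 V)"
      using falling_dot_eq[of "2 * i" 1 V] by (simp add: len del: sum.lessThan_Suc)
    finally have "x ^ i * (\<Sum>j\<le>2 * i. kern i j * v j) - v i = real_of_int T / (real_of_int M ^ i * c) / real_of_int S"
      using i c x(4) S unfolding T_def
      by (simp add: v_def x(1) power_divide power_mult_distrib c_def field_simps)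
    moreover have "\<bar>real_of_int T\<bar> / (real_of_int M ^ i * c) \<le> real_of_int B / 10 ^ i"
    proof -
      have "i \<in> set [3..<Suc I]" using i by auto
      then have "10 ^ i * \<bar>T\<bar> \<le> B * ((2 * M) ^ i * fact (2 * i))"
        using rows unfolding list_all_iff T_def by blast
      then have "real_of_int (10 ^ i * \<bar>T\<bar>) \<le> real_of_int (B * ((2 * M) ^ i * fact (2 * i)))"
        by (simp only: of_int_le_iff)
      then have "10 ^ i * \<bar>real_of_int T\<bar> \<le> real_of_int B * (real_of_int M ^ i * c)"
        by (simp add: c_def power_mult_distrib mult_ac)
      then show ?thesis using x(4) c by (simp add: divide_simps mult_ac)
    qed
    then have "\<bar>real_of_int T\<bar> / (real_of_int M ^ i * c) / real_of_int S
        \<le> real_of_int B / 10 ^ i / real_of_int S"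
      using S by (intro divide_right_mono) auto
    moreover have "\<bar>real_of_int T / (real_of_int M ^ i * c) / real_of_int S\<bar>
        = \<bar>real_of_int T\<bar> / (real_of_int M ^ i * c) / real_of_int S"
      using S x(4) c by simp
    ultimately show ?thesis by (simp only: divide_divide_eq_left mult.commute)
  qed
  have tl: "(\<Sum>j\<le>I. (15 * x) ^ Suc I / fact (2 * Suc I - j) * \<bar>v j\<bar>) \<le> real_of_int B / real_of_int S"
  proof -
    let ?F = "fact (2 * Suc I) :: real"
    have "(\<Sum>j\<le>I. (15 * x) ^ Suc I / fact (2 * Suc I - j) * \<bar>v j\<bar>)
        = (\<Sum>j<Suc I. (15 * x) ^ Suc I / ?F / real_of_int S * (falling (2 * Suc I) j * real_of_int \<bar>V ! j\<bar>))"
      unfolding lessThan_Suc_atMost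
      using S by (intro sum.cong) (auto simp: v_def falling_def mult_ac)
    also have "\<dots> = (15 * x) ^ Suc I / ?F / real_of_int S * real_of_int (falling_dot (int (2 * Suc I)) 1 (map abs V))"
      unfolding falling_dot_eq sum_distrib_left[symmetric] using len
      by (intro arg_cong2[where f = "(*)"] sum.cong) auto
    also have "(15 * x) ^ Suc I / ?F / real_of_int S
          * real_of_int (falling_dot (int (2 * Suc I)) 1 (map abs V))
        = real_of_int ((15 * m) ^ Suc I * falling_dot (int (2 * Suc I)) 1 (map abs V))
          / (real_of_int M ^ Suc I * ?F) / real_of_int S"
    proof -
      have "(15 * x) ^ Suc I = (15 * real_of_int m) ^ Suc I / real_of_int M ^ Suc I"
        unfolding x(1) power_divide[symmetric] by simp
      then show ?thesis by (simp del: power_Suc)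
    qed
    also have "\<dots> \<le> real_of_int (B * (M ^ Suc I * fact (2 * Suc I))) / (real_of_int M ^ Suc I * ?F) / real_of_int S"
      by (intro divide_right_mono) (use tail S x in \<open>simp_all only: of_int_le_iff\<close>, auto)
    also have "\<dots> = real_of_int B / real_of_int S" using x by simp
    finally show ?thesis .
  qed
  have "\<bar>fps_value (e i) x - v i\<bar> \<le> real_of_int B / real_of_int S / (23 / 100) / 10 ^ i"
    by (rule tail_sys_value_approx[OF e l1 x01 _ _ I res tl i(1)]) (use I in \<open>auto simp: v_def bd\<close>)
  then show ?thesis using i by (simp add: v_def)
qed

text \<open>Dividing at \<open>y\<close> gives \<open>f(x) - f(y) = (1 - x / y) * g(x)\<close>, so
  the norm of the quotient takes the place of a bound on the derivative.\<close>

lemma fps_value_lipschitz: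
  assumes "fps_l1 f" "0 \<le> x" "x \<le> 1" "0 < y" "y < 1"
  shows "\<bar>fps_value f x - fps_value f y\<bar> \<le> fps_norm1 f / (1 - y) * \<bar>x - y\<bar>"
proof -
  obtain g where g: "fps_l1 g" "fps_norm1 g \<le> fps_norm1 f * (y / (1 - y))"
    "f = fps_const (fps_value f y) + (1 - fps_const (1 / y) * fps_X) * g"
    using fps_l1_linear_division[OF assms(1,4,5)] by blast
  have abs_x: "\<bar>x\<bar> \<le> 1" using assms by simp
  have "fps_value f x = fps_value (fps_const (fps_value f y) + (1 - fps_const (1 / y) * fps_X) * g) x"
    by (rule arg_cong[OF g(3)])
  also have "\<dots> = fps_value f y + (1 - x / y) * fps_value g x"
    using abs_x by (simp add: fps_value_simps fps_l1_intros g(1))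
  finally have "\<bar>fps_value f x - fps_value f y\<bar> = \<bar>1 - x / y\<bar> * \<bar>fps_value g x\<bar>"
    by (simp add: abs_mult)
  also have "\<dots> \<le> \<bar>1 - x / y\<bar> * (fps_norm1 f * (y / (1 - y)))"
    using abs_fps_value_le[OF g(1) abs_x] g(2) by (intro mult_left_mono) auto
  also have "\<bar>1 - x / y\<bar> = \<bar>x - y\<bar> / y"
  proof -
    have "1 - x / y = (y - x) / y" using assms(4) by (simp add: diff_divide_distrib)
    then show ?thesis using assms(4) by (simp add: abs_minus_commute)
  qed
  also have "\<bar>x - y\<bar> / y * (fps_norm1 f * (y / (1 - y))) = fps_norm1 f / (1 - y) * \<bar>x - y\<bar>"
    using assms(4) by simp
  finally show ?thesis .
qed

section \<open>Unique zero of the denominator\<close>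

text \<open>\<open>2 * multiplier_list / 10 ^ 10\<close> is the rounded beginning of the expansion of \<open>q / den_fps\<close>, where \<open>q\<close> is
  the quadratic polynomial with the two smallest zeros of \<open>den_fps\<close>; \<open>den_list\<close> approximates
  \<open>10 ^ 10\<close> times the products of this multiplier with \<open>den_tail\<close>.\<close>

definition multiplier_list :: "int list" where
  "multiplier_list = [
    5000000000, - 6270750000, 4852100000, - 5401450000, 4411050000, - 3336700000, 2230600000,
    - 1655050000, 1323450000, - 1107450000, 862650000, - 656700000, 495850000, - 388500000,
    304750000, - 239450000, 185100000, - 143550000, 111150000, - 86750000, 67500000, - 52600000,
    40800000, - 31750000, 24650000, - 19200000, 14900000, - 11600000, 9000000]"

definition den_list :: "int list list" where
  "den_list = (let p = map ((*) 2) multiplier_list; z = 0 # map ((*) 3) multiplier_list in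
   [[], z, list_add p (map ((*) (- 1)) z),
    [
     0, 0, 0, 1406250000, - 3451148438, 3481031250, - 2365725938, 1240978535, - 764100647,
     712897553, - 679846249, 542150677, - 384351236, 278109610, - 218341957, 177418268,
     - 140809248, 108505045, - 82871309, 64059422, - 50107808, 39255829, - 30557188, 23685860,
     - 18372393, 14290667, - 11130384, 8660996, - 6728976, 5224316, - 4056745, 3155736, - 483325,
     - 1984215, 1543623, - 91860, - 1090039],
    [
     0, 0, 0, 0, 70312500, - 178584208, 181610056, - 104359420, 28926754, - 15900710, 26168549,
     - 29270537, 20624320, - 12925879, 8961960, - 7644895, 6427105, - 5143195, 3835109,
     - 2899225, 2235161, - 1779634, 1395648, - 1086817, 835390, - 649035, 504667, - 394660,
     306504, - 238202, 184494, - 143383, 111523, 11694, - 135557, 105446, 1134],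
    [
     0, 0, 0, 0, 0, 1883371, - 4873190, 4977033, - 2352675, - 83946, 8314, 568545, - 685176,
     360111, - 189435, 128435, - 135492, 114599, - 92910, 64167, - 48768, 37270, - 31001, 24003,
     - 18790, 14143, - 11113, 8600, - 6800, 5237, - 4085, 3142, - 2453, 1903, 1151, - 4411, 3430],
    [
     0, 0, 0, 0, 0, 0, 31390, - 82171, 84143, - 31306, - 14533, 4364, 9098, - 10032, 2590, - 994,
     717, - 1434, 1097, - 940, 521, - 430, 313, - 297, 215, - 174, 122, - 101, 76, - 63, 47,
     - 37, 28, - 22, 17, 31, - 84],
    [
     0, 0, 0, 0, 0, 0, 0, 357, - 941, 966, - 263, - 298, 64, 115, - 98, - 11, 6, - 3, - 10, 5,
     - 5, 1, - 2, 1, - 2, 1, - 1],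
    [
     0, 0, 0, 0, 0, 0, 0, 0, 3, - 8, 8, - 1, - 3, 0, 1, - 1]])"

text \<open>For evaluating factorials by rewriting: the default code equation of \<^const>\<open>fact\<close> uses unary
  natural numbers.\<close>

primrec int_fact :: "nat \<Rightarrow> int" where
  "int_fact 0 = 1"
| "int_fact (Suc n) = int (Suc n) * int_fact n"

lemma fact_eq_int_fact: "fact n = int_fact n"
  by (induction n) simp_all

lemmas residual_list_code [code] = residual_list_def[unfolded fact_eq_int_fact]

definition multiplier_fps :: "real fps" where
  "multiplier_fps = list_fps (10 ^ 10) (map ((*) 2) multiplier_list)"

lemma den_list_0: "den_list ! 0 = []"
  and den_list_1: "den_list ! 1 = 0 # map ((*) 3) multiplier_list"
  and den_list_2: "den_list ! 2 = list_add (map ((*) 2) multiplier_list) (map ((*) (- 1)) (0 # map ((*) 3) multiplier_list))"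
  by (simp_all add: den_list_def Let_def del: list.map)

lemma Z_times_multiplier: "multiplier_fps * Z = list_fps (10 ^ 10) (0 # map ((*) 3) multiplier_list)"
proof -
  have "multiplier_fps * Z = (fps_const 2 * fps_const (3 / 2)) * (fps_X * list_fps (10 ^ 10) multiplier_list)"
    unfolding multiplier_fps_def list_fps_map_mult by (simp only: mult_ac of_int_numeral)
  also have "fps_const 2 * fps_const (3 / 2) = (fps_const 3 :: real fps)" by simp
  finally show ?thesis by (simp add: list_fps_Cons list_fps_map_mult mult_ac)
qed

lemma multiplier_den_tail_approx:
  assumes "i = 3 \<or> i = 4"
  shows "fps_norm1 (multiplier_fps * den_tail i - list_fps (10 ^ 10) (den_list ! i)) \<le> 77 / 100 / 10 ^ i"
proof -
  have "fps_norm1 (multiplier_fps * den_tail i - list_fps (10 ^ 10) (den_list ! i))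
      \<le> real_of_int 1750642275 / real_of_int (10 ^ 10) / (23 / 100) / 10 ^ i"
  proof (rule tail_sys_list_approx)
    \<comment> \<open>The products themselves solve the tail system, with polynomial boundary data.
      Approximating them directly avoids the factor \<open>fps_norm1 multiplier_fps\<close> in the
      error.\<close>
    show "tail_sys (\<lambda>i. multiplier_fps * den_tail i)"
      unfolding den_tail_def by (intro tail_sys_mult tail_sys_tail_sol)
    show "length den_list = Suc 8" by (simp add: den_list_def Let_def)
    show "multiplier_fps * den_tail j = list_fps (10 ^ 10) (den_list ! j)" if "j < 3" for j
    proof -
      have "multiplier_fps * (1 - Z) = list_fps (10 ^ 10) (den_list ! 2)"
        unfolding den_list_2 list_fps_add list_fps_map_mult[of _ "- 1"] Z_times_multiplier[symmetric]
          right_diff_distrib multiplier_fps_def[symmetric]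
        by (simp flip: fps_const_neg)
      then show ?thesis using that Z_times_multiplier den_list_1 den_list_0
        by (auto simp: den_tail_def tail_sol_boundary less_Suc_eq numeral_3_eq_3 numeral_2_eq_2)
    qed
    show "list_all (\<lambda>i. 10 ^ i * list_norm1 (residual_list den_list i)
        \<le> 1750642275 * (2 ^ i * fact (2 * i))) [3..<Suc 8]"
      unfolding fact_eq_int_fact by code_simp
    show "15 ^ Suc 8 * falling_dot (int (2 * Suc 8)) 1 (map list_norm1 den_list) \<le> 1750642275 * fact (2 * Suc 8)"
      unfolding fact_eq_int_fact by code_simp
  qed (use assms in auto)
  \<comment> \<open>The quotient on the left is about 0.7612; the agreement of 77/100 with the
    contraction rate is accidental.\<close>
  also have "\<dots> \<le> 77 / 100 / 10 ^ i" by (intro divide_right_mono) auto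
  finally show ?thesis .
qed

lemma den_tail_l1: "fps_l1 (den_tail i)"
  and den_tail_norm: "i \<ge> 3 \<Longrightarrow> fps_norm1 (den_tail i) \<le> 1750 / 10 ^ i"
proof -
  have Z: "fps_l1 Z" "fps_norm1 Z \<le> 3 / 2"
    using fps_norm1_X_power_mult[of 1 1] fps_norm1_const[of 1] fps_norm1_const_mult[OF fps_l1_X, of "3 / 2"]
    by (simp_all add: fps_l1_const_mult fps_l1_X fps_l1_1)
  have Z1: "fps_l1 (1 - Z)" "fps_norm1 (1 - Z) \<le> 5 / 2"
    using fps_norm1_diff[OF fps_l1_1 Z(1)] Z fps_norm1_const[of 1] by (simp_all add: fps_l1_diff fps_l1_1)
  have sys: "tail_sys den_tail" unfolding den_tail_def by (rule tail_sys_tail_sol)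
  have bd: "den_tail 0 = 0" "den_tail 1 = Z" "den_tail 2 = 1 - Z"
    by (simp_all add: den_tail_def tail_sol_boundary)
  have l1: "fps_l1 (den_tail j)" if "j < 3" for j
    using that bd Z Z1 fps_l1_const[of 0] by (auto simp: less_Suc_eq numeral_3_eq_3 numeral_2_eq_2)
  \<comment> \<open>3375/120 * 3/2 + 3375/24 * 5/2 = 393.75.\<close>
  have B: "15 ^ 3 / fact 6 * fps_norm1 (den_tail 0) + 15 ^ 3 / fact 5 * fps_norm1 (den_tail 1)
      + 15 ^ 3 / fact 4 * fps_norm1 (den_tail 2) \<le> 394"
    unfolding bd using Z Z1 fps_norm1_const[of 0] by (simp add: fact_numeral)
  show "fps_l1 (den_tail i)"
    using tail_sys_l1(1)[OF sys l1 B, of i] l1[of i] by (cases "i < 3") auto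
  show "fps_norm1 (den_tail i) \<le> 1750 / 10 ^ i" if "i \<ge> 3"
  proof -
    have "fps_norm1 (den_tail i) \<le> 394 / (23 / 100) / 10 ^ i"
      by (rule tail_sys_l1(2)[OF sys _ B that]) (rule l1)
    also have "\<dots> \<le> 1750 / 10 ^ i" by (rule divide_right_mono) simp_all
    finally show ?thesis .
  qed
qed

lemma num_tail_l1: "fps_l1 (num_tail i)"
  and num_tail_norm: "i \<ge> 3 \<Longrightarrow> fps_norm1 (num_tail i) \<le> 330 / 10 ^ i"
proof -
  have sys: "tail_sys num_tail" unfolding num_tail_def by (rule tail_sys_tail_sol)
  have bd: "num_tail 0 = fps_const 1" "num_tail 1 = fps_const 0" "num_tail 2 = fps_const (- (1 / 2))"
    by (simp_all add: num_tail_def tail_sol_boundary)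
  have l1: "fps_l1 (num_tail j)" if "j < 3" for j
  proof -
    have "j = 0 \<or> j = 1 \<or> j = 2" using that by auto
    then show ?thesis using bd fps_l1_const by metis
  qed
  have B: "15 ^ 3 / fact 6 * fps_norm1 (num_tail 0) + 15 ^ 3 / fact 5 * fps_norm1 (num_tail 1)
      + 15 ^ 3 / fact 4 * fps_norm1 (num_tail 2) \<le> 75"
    unfolding bd fps_norm1_const by (simp add: fact_numeral)
  show "fps_l1 (num_tail i)"
    using tail_sys_l1(1)[OF sys l1 B, of i] l1[of i] by (cases "i < 3") auto
  show "fps_norm1 (num_tail i) \<le> 330 / 10 ^ i" if "i \<ge> 3"
  proof -
    have "fps_norm1 (num_tail i) \<le> 75 / (23 / 100) / 10 ^ i"
      by (rule tail_sys_l1(2)[OF sys _ B that]) (rule l1)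
    also have "\<dots> \<le> 330 / 10 ^ i" by (rule divide_right_mono) simp_all
    finally show ?thesis .
  qed
qed

section \<open>Norms and values of denominator and numerator\<close>

lemma den_fps_alt: "den_fps = 1 - fps_const (3 / 2) * fps_X - fps_const (9 / 8) * fps_X ^ 2
    + fps_const (9 / 8) * fps_X ^ 3 - fps_const (9 / 4) * fps_X ^ 2 * (den_tail 3 + den_tail 4)"
  by (simp add: den_fps_def power_mult_distrib fps_const_power power_divide flip: mult.assoc)

lemma num_fps_alt: "num_fps = fps_const (3 / 4) * fps_X - fps_const (45 / 64) * fps_X ^ 3
    + fps_const (27 / 8) * fps_X ^ 3 * (num_tail 3 + num_tail 4)"
  by (simp add: num_fps_def power_mult_distrib fps_const_power power_divide flip: mult.assoc)

lemma den_fps_l1: "fps_l1 den_fps" and num_fps_l1: "fps_l1 num_fps"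
  unfolding den_fps_alt num_fps_alt by (intro fps_l1_intros den_tail_l1 num_tail_l1)+

lemma fps_norm1_monom_mult: "fps_l1 f \<Longrightarrow> fps_norm1 (fps_const a * fps_X ^ k * f) = \<bar>a\<bar> * fps_norm1 f"
  by (simp only: mult.assoc fps_norm1_const_mult fps_norm1_X_power_mult fps_l1_X_power_mult)

lemma fps_norm1_monom: "fps_norm1 (fps_const a * fps_X ^ k) = \<bar>a\<bar>"
  using fps_norm1_monom_mult[OF fps_l1_1, of a k] fps_norm1_const[of 1] by simp

lemma fps_norm1_const_X: "fps_norm1 (fps_const a * fps_X) = \<bar>a\<bar>"
  using fps_norm1_monom[of a 1] by simp

lemma den_fps_norm: "fps_norm1 den_fps \<le> 10"
proof -
  let ?t = "den_tail 3 + den_tail 4"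
  have t: "fps_l1 ?t" by (intro fps_l1_add den_tail_l1)
  have "fps_norm1 ?t \<le> 1750 / 10 ^ 3 + 1750 / 10 ^ 4"
    by (rule order.trans[OF fps_norm1_add[OF den_tail_l1 den_tail_l1]]) (intro add_mono den_tail_norm; simp)
  moreover have "fps_norm1 den_fps \<le> fps_norm1 1 + fps_norm1 (fps_const (3 / 2) * fps_X ^ 1)
      + fps_norm1 (fps_const (9 / 8) * fps_X ^ 2) + fps_norm1 (fps_const (9 / 8) * fps_X ^ 3)
      + fps_norm1 (fps_const (9 / 4) * fps_X ^ 2 * ?t)"
    unfolding den_fps_alt power_one_right
    by (intro order.trans[OF fps_norm1_diff] order.trans[OF fps_norm1_add] add_mono order.refl fps_l1_intros t)
  ultimately show ?thesis
    using fps_norm1_const[of 1] by (simp add: fps_norm1_monom_mult[OF t] fps_norm1_monom fps_norm1_const_X)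
qed

lemma num_fps_norm: "fps_norm1 num_fps \<le> 3"
proof -
  let ?t = "num_tail 3 + num_tail 4"
  have t: "fps_l1 ?t" by (intro fps_l1_add num_tail_l1)
  have "fps_norm1 ?t \<le> 330 / 10 ^ 3 + 330 / 10 ^ 4"
    by (rule order.trans[OF fps_norm1_add[OF num_tail_l1 num_tail_l1]]) (intro add_mono num_tail_norm; simp)
  moreover have "fps_norm1 num_fps \<le> fps_norm1 (fps_const (3 / 4) * fps_X ^ 1)
      + fps_norm1 (fps_const (45 / 64) * fps_X ^ 3) + fps_norm1 (fps_const (27 / 8) * fps_X ^ 3 * ?t)"
    unfolding num_fps_alt power_one_right
    by (intro order.trans[OF fps_norm1_diff] order.trans[OF fps_norm1_add] add_mono order.refl fps_l1_intros t)
  ultimately show ?thesis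
    by (simp add: fps_norm1_monom_mult[OF t] fps_norm1_monom fps_norm1_const_X)
qed

lemma fps_value_den_fps: "\<bar>x\<bar> \<le> 1 \<Longrightarrow> fps_value den_fps x = 1 - 3 / 2 * x - 9 / 8 * x ^ 2 + 9 / 8 * x ^ 3
    - 9 / 4 * x ^ 2 * (fps_value (den_tail 3) x + fps_value (den_tail 4) x)"
  unfolding den_fps_alt by (simp add: fps_value_simps fps_l1_intros den_tail_l1)

lemma fps_value_num_fps: "\<bar>x\<bar> \<le> 1 \<Longrightarrow> fps_value num_fps x = 3 / 4 * x - 45 / 64 * x ^ 3
    + 27 / 8 * x ^ 3 * (fps_value (num_tail 3) x + fps_value (num_tail 4) x)"
  unfolding num_fps_alt by (simp add: fps_value_simps fps_l1_intros num_tail_l1)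

text \<open>This is \<open>8 * 10 ^ 10\<close> times the difference between the approximated product
  \<open>den_fps * multiplier_fps\<close> and the quadratic polynomial, whose coefficients form the
  last list. The factor 8 clears the denominators of \<open>den_fps_alt\<close>.\<close>

definition remainder_list :: "int list" where
  "remainder_list = (let p = map ((*) 2) multiplier_list in
     list_add (map ((*) 8) p) (list_add (0 # map ((*) (- 12)) p) (list_add (0 # 0 # map ((*) (- 9)) p)
     (list_add (0 # 0 # 0 # map ((*) 9) p) (list_add (0 # 0 # map ((*) (- 18)) (list_add (den_list ! 3) (den_list ! 4)))
     [- 80000000000, 220332160000, - 138131840000])))))"

lemma remainder_list_norm: "list_norm1 remainder_list \<le> 665000000"
  by code_simp

lemma multiplier_den_fps:
  "\<exists>r. fps_l1 r \<and> fps_norm1 r \<le> 11 / 1000 \<and> den_fps * multiplier_fps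
    = 1 - fps_const (2754152 / 10 ^ 6) * fps_X + fps_const (1726648 / 10 ^ 6) * fps_X ^ 2 + r"
proof -
  let ?S = "10 ^ 10 :: int"
  let ?P = multiplier_fps
  let ?d = "\<lambda>i. ?P * den_tail i - list_fps ?S (den_list ! i)"
  let ?L = "list_fps ?S remainder_list"
  \<comment> \<open>The deviation computed from \<open>den_list\<close>, and the error of
    \<open>den_list\<close> itself: 0.0665 / 8 + 9/4 * 0.000847 is about 0.0102.\<close>
  define r where "r = fps_const (1 / 8) * ?L - fps_const (9 / 4) * fps_X ^ 2 * (?d 3 + ?d 4)"
  have l1P: "fps_l1 ?P" by (simp add: multiplier_fps_def)
  have l1d: "fps_l1 (?d i)" for i by (intro fps_l1_intros l1P den_tail_l1 fps_l1_list_fps)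
  have l1r: "fps_l1 r" unfolding r_def by (intro fps_l1_intros l1d fps_l1_list_fps)
  have "fps_norm1 r \<le> 1 / 8 * fps_norm1 ?L + 9 / 4 * (fps_norm1 (?d 3) + fps_norm1 (?d 4))"
  proof -
    have "fps_norm1 r \<le> fps_norm1 (fps_const (1 / 8) * ?L) + fps_norm1 (fps_const (9 / 4) * fps_X ^ 2 * (?d 3 + ?d 4))"
      unfolding r_def by (intro fps_norm1_diff fps_l1_intros l1d fps_l1_list_fps)
    also have "\<dots> = 1 / 8 * fps_norm1 ?L + 9 / 4 * fps_norm1 (?d 3 + ?d 4)"
      unfolding fps_norm1_monom_mult[OF fps_l1_add[OF l1d l1d]] by (simp add: fps_norm1_const_mult)
    also have "\<dots> \<le> 1 / 8 * fps_norm1 ?L + 9 / 4 * (fps_norm1 (?d 3) + fps_norm1 (?d 4))"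
      by (intro add_mono mult_left_mono fps_norm1_add l1d) auto
    finally show ?thesis .
  qed
  moreover have "fps_norm1 ?L \<le> 665 / 10000"
  proof -
    have "real_of_int (list_norm1 remainder_list) \<le> real_of_int 665000000"
      using remainder_list_norm by (simp only: of_int_le_iff)
    then show ?thesis by (simp add: fps_norm1_list_fps)
  qed
  moreover have "fps_norm1 (?d 3) \<le> 77 / 100000" "fps_norm1 (?d 4) \<le> 77 / 1000000"
    using multiplier_den_tail_approx[of 3] multiplier_den_tail_approx[of 4] by simp_all
  moreover have "a \<le> 11 / 1000" if "a \<le> 1 / 8 * l + 9 / 4 * (d3 + d4)" "l \<le> 665 / 10000"
    "d3 \<le> 77 / 100000" "d4 \<le> 77 / 1000000" for a l d3 d4 :: real
    using that unfolding distrib_left by linarith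
  ultimately have "fps_norm1 r \<le> 11 / 1000" by blast
  moreover have "den_fps * ?P
      = 1 - fps_const (2754152 / 10 ^ 6) * fps_X + fps_const (1726648 / 10 ^ 6) * fps_X ^ 2 + r"
  proof -
    define A where "A = list_fps ?S (den_list ! 3) + list_fps ?S (den_list ! 4)"
    have cm: "fps_const a * (fps_X ^ n * (fps_const b * f)) = fps_const (a * b) * (fps_X ^ n * f)" for a b n and f :: "real fps"
    proof -
      have "fps_const a * (fps_X ^ n * (fps_const b * f)) = (fps_const a * fps_const b) * (fps_X ^ n * f)"
        by (simp only: mult_ac)
      then show ?thesis by simp
    qed
    have "?L = fps_X ^ 0 * (fps_const 8 * ?P) + (fps_X ^ 1 * (fps_const (- 12) * ?P)
        + (fps_X ^ 2 * (fps_const (- 9) * ?P) + (fps_X ^ 3 * (fps_const 9 * ?P)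
        + (fps_X ^ 2 * (fps_const (- 18) * A) + (fps_X ^ 0 * (fps_const (- 8) * 1)
        + fps_X ^ 1 * (fps_const (2754152 * 8 / 10 ^ 6) * 1) + fps_X ^ 2 * (fps_const (- (1726648 * 8 / 10 ^ 6)) * 1))))))"
      unfolding remainder_list_def Let_def list_fps_add list_fps_Cons list_fps_map_mult[of _ "- 12"]
        list_fps_map_mult[of _ "8"] list_fps_map_mult[of _ "9"] list_fps_map_mult[of _ "- 9"]
        list_fps_map_mult[of _ "- 18"] multiplier_fps_def[symmetric] A_def[symmetric]
      by (simp add: power2_eq_square power3_eq_cube mult.assoc distrib_left add.assoc)
    then have "fps_const (1 / 8) * ?L = ?P - fps_const (3 / 2) * (fps_X * ?P) - fps_const (9 / 8) * (fps_X ^ 2 * ?P)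
        + fps_const (9 / 8) * (fps_X ^ 3 * ?P) - fps_const (9 / 4) * (fps_X ^ 2 * A) - 1
        + fps_const (2754152 / 10 ^ 6) * fps_X - fps_const (1726648 / 10 ^ 6) * fps_X ^ 2"
      by (simp only: distrib_left cm) (simp flip: fps_const_neg)
    moreover have "den_fps * ?P = ?P - fps_const (3 / 2) * (fps_X * ?P) - fps_const (9 / 8) * (fps_X ^ 2 * ?P)
        + fps_const (9 / 8) * (fps_X ^ 3 * ?P) - fps_const (9 / 4) * fps_X ^ 2 * (?P * den_tail 3 + ?P * den_tail 4)"
    proof -
      have "(1 - a * x - b * x ^ 2 + b * x ^ 3 - c * x ^ 2 * (d + e)) * p
          = p - a * (x * p) - b * (x ^ 2 * p) + b * (x ^ 3 * p) - c * x ^ 2 * (p * d + p * e)"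
        for a b c d e p x :: "real fps" by algebra
      then show ?thesis unfolding den_fps_alt by blast
    qed
    moreover have "w = 1 - p + s + (v - c * x * ((d - d') + (e - e')))"
      if "v = u - c * (x * (d' + e')) - 1 + p - s" "w = u - c * x * (d + e)"
      for u v w c x d d' e e' p s :: "real fps"
      using that by algebra
    ultimately show ?thesis unfolding r_def A_def by blast
  qed
  ultimately show ?thesis using l1r by blast
qed

section \<open>Location of the zero and the residue\<close>

text \<open>Rounded values of \<open>2 ^ 124 * den_tail i\<close> at the two ends of an interval of length \<open>2 ^ -40\<close> around
  the zero of \<open>den_fps\<close>, and of \<open>2 ^ 76 * num_tail i\<close> at its left end. The denominators are powers of
  two so that the rewriting of large numerals stays cheap.\<close>

definition den_values1 :: "int list" where
  "den_values1 = [
    0, 17831898614425535605664741751798104064, 3435749318133118360796171212687409152,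
    192391047212798016141896769253516308, 5008684619686276485636049614086647,
    74642527504109718285974069024416, 717019838425290904169547843896,
    4795126642531341487703556610, 23564960360165342865237857, 88577297975102777383058,
    262646001865804144691, 629590460047534146, 1244642401012671, 2063060784347, 2907450742,
    3525449, 3716, 3]"

definition den_values2 :: "int list" where
  "den_values2 = [
    0, 17831898614454549825335492851991052288, 3435749318104104141125420112494460928,
    192391047213213293208395804659288243, 5008684619703911168727035666691522,
    74642527504497642453233489663559, 717019838430344364788621943243,
    4795126642574465521999770476, 23564960360424238565727473, 88577297976254226070075,
    262646001869747842057, 629590460058252454, 1244642401036345, 2063060784391, 2907450742,
    3525449, 3716, 3]"

definition num_values :: "int list" where
  "num_values = [
    75557863725914323419136, 0, - 37778931862957161709568, - 970331550031637929434,
    - 29652935000957456083, - 478208871381598183, - 4782159372418665, - 32604807635413,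
    - 161412685407, - 606917202, - 1792791, - 4271]"

text \<open>83 = 124 - 41, because \<open>Z\<close> takes the value \<open>3 * m / 2 ^ 41\<close> at
  \<open>x\<close>. The boundary values are thus exact, as the error estimate demands.\<close>

lemma den_tail_value:
  assumes x: "x = real_of_int m / real_of_int (2 ^ 40)" "0 \<le> m" "m \<le> 2 ^ 40"
    and V: "length V = Suc I" "I \<ge> 4"
    and bd: "V ! 0 = 0" "V ! 1 = 3 * m * 2 ^ 83" "V ! 2 = 2 ^ 124 - V ! 1"
    and rows: "list_all (\<lambda>i. 10 ^ i * \<bar>(3 * m) ^ i * falling_dot (int (2 * i)) 1 V
      - (2 * 2 ^ 40) ^ i * fact (2 * i) * V ! i\<bar> \<le> B * ((2 * 2 ^ 40) ^ i * fact (2 * i))) [3..<Suc I]"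
    and tail: "(15 * m) ^ Suc I * falling_dot (int (2 * Suc I)) 1 (map abs V)
      \<le> B * ((2 ^ 40) ^ Suc I * fact (2 * Suc I))"
    and i: "i = 3 \<or> i = 4"
  shows "\<bar>fps_value (den_tail i) x - real_of_int (V ! i) / 2 ^ 124\<bar> \<le> real_of_int B / 2 ^ 124 / (23 / 100) / 10 ^ i"
proof -
  have "\<bar>fps_value (den_tail i) x - real_of_int (V ! i) / real_of_int (2 ^ 124)\<bar>
      \<le> real_of_int B / real_of_int (2 ^ 124) / (23 / 100) / 10 ^ i"
  proof (rule tail_sys_int_value_approx[OF _ _ V(1) _ _ x _ _ rows tail])
    show "tail_sys den_tail" unfolding den_tail_def by (rule tail_sys_tail_sol)
    have "\<bar>x\<bar> \<le> 1" using x by simp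
    then have vZ: "fps_value Z x = 3 / 2 * x" "fps_value (1 - Z) x = 1 - 3 / 2 * x" "fps_value 0 x = 0"
      using fps_value_const[of 0 x] by (simp_all add: fps_value_simps fps_l1_intros)
    have V1: "real_of_int (V ! 1) = 3 * real_of_int m * 2 ^ 83" unfolding bd(2) by simp
    have V2: "real_of_int (V ! 2) = 2 ^ 124 - real_of_int (V ! 1)" unfolding bd(3) by simp
    have den: "den_tail 0 = 0" "den_tail 1 = Z" "den_tail 2 = 1 - Z"
      by (simp_all add: den_tail_def tail_sol_boundary)
    show "fps_value (den_tail j) x = real_of_int (V ! j) / real_of_int (2 ^ 124)" if "j < 3" for j
    proof -
      have "j = 0 \<or> j = 1 \<or> j = 2" using that by auto
      then show ?thesis
        by (elim disjE) (simp_all only: den vZ bd(1) V1 V2, simp_all add: x(1) field_simps)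
    qed
  qed (use V i den_tail_l1 in auto)
  then show ?thesis by simp
qed

lemma num_tail_value:
  assumes x: "x = real_of_int m / real_of_int (2 ^ 40)" "0 \<le> m" "m \<le> 2 ^ 40"
    and V: "length V = Suc I" "I \<ge> 4"
    and bd: "V ! 0 = 2 ^ 76" "V ! 1 = 0" "V ! 2 = - (2 ^ 75)"
    and rows: "list_all (\<lambda>i. 10 ^ i * \<bar>(3 * m) ^ i * falling_dot (int (2 * i)) 1 V
      - (2 * 2 ^ 40) ^ i * fact (2 * i) * V ! i\<bar> \<le> B * ((2 * 2 ^ 40) ^ i * fact (2 * i))) [3..<Suc I]"
    and tail: "(15 * m) ^ Suc I * falling_dot (int (2 * Suc I)) 1 (map abs V)
      \<le> B * ((2 ^ 40) ^ Suc I * fact (2 * Suc I))"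
    and i: "i = 3 \<or> i = 4"
  shows "\<bar>fps_value (num_tail i) x - real_of_int (V ! i) / 2 ^ 76\<bar> \<le> real_of_int B / 2 ^ 76 / (23 / 100) / 10 ^ i"
proof -
  have "\<bar>fps_value (num_tail i) x - real_of_int (V ! i) / real_of_int (2 ^ 76)\<bar>
      \<le> real_of_int B / real_of_int (2 ^ 76) / (23 / 100) / 10 ^ i"
  proof (rule tail_sys_int_value_approx[OF _ _ V(1) _ _ x _ _ rows tail])
    show "tail_sys num_tail" unfolding num_tail_def by (rule tail_sys_tail_sol)
    have num: "num_tail 0 = fps_const 1" "num_tail 1 = fps_const 0" "num_tail 2 = fps_const (- (1 / 2))"
      by (simp_all add: num_tail_def tail_sol_boundary)
    show "fps_value (num_tail j) x = real_of_int (V ! j) / real_of_int (2 ^ 76)" if "j < 3" for j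
    proof -
      have "j = 0 \<or> j = 1 \<or> j = 2" using that by auto
      then show ?thesis
        by (elim disjE) (simp_all only: num fps_value_const bd, simp_all)
    qed
  qed (use V i num_tail_l1 in auto)
  then show ?thesis by simp
qed

lemma den_tail_value_1:
  assumes "i = 3 \<or> i = 4"
  shows "\<bar>fps_value (den_tail i) (614591700786 / 2 ^ 40) - real_of_int (den_values1 ! i) / 2 ^ 124\<bar>
    \<le> real_of_int 43571830477530452 / 2 ^ 124 / (23 / 100) / 10 ^ i"
proof (rule den_tail_value)
  show "list_all (\<lambda>i. 10 ^ i * \<bar>(3 * 614591700786) ^ i * falling_dot (int (2 * i)) 1 den_values1
      - (2 * 2 ^ 40) ^ i * fact (2 * i) * den_values1 ! i\<bar>
      \<le> 43571830477530452 * ((2 * 2 ^ 40) ^ i * fact (2 * i))) [3..<Suc 17]"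
    unfolding fact_eq_int_fact by code_simp
  show "(15 * 614591700786) ^ Suc 17 * falling_dot (int (2 * Suc 17)) 1 (map abs den_values1)
      \<le> 43571830477530452 * ((2 ^ 40) ^ Suc 17 * fact (2 * Suc 17))"
    unfolding fact_eq_int_fact by code_simp
qed (use assms in \<open>simp_all add: den_values1_def\<close>)

lemma den_tail_value_2:
  assumes "i = 3 \<or> i = 4"
  shows "\<bar>fps_value (den_tail i) (614591700787 / 2 ^ 40) - real_of_int (den_values2 ! i) / 2 ^ 124\<bar>
    \<le> real_of_int 43571830487409974 / 2 ^ 124 / (23 / 100) / 10 ^ i"
proof (rule den_tail_value)
  show "list_all (\<lambda>i. 10 ^ i * \<bar>(3 * 614591700787) ^ i * falling_dot (int (2 * i)) 1 den_values2
      - (2 * 2 ^ 40) ^ i * fact (2 * i) * den_values2 ! i\<bar>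
      \<le> 43571830487409974 * ((2 * 2 ^ 40) ^ i * fact (2 * i))) [3..<Suc 17]"
    unfolding fact_eq_int_fact by code_simp
  show "(15 * 614591700787) ^ Suc 17 * falling_dot (int (2 * Suc 17)) 1 (map abs den_values2)
      \<le> 43571830487409974 * ((2 ^ 40) ^ Suc 17 * fact (2 * Suc 17))"
    unfolding fact_eq_int_fact by code_simp
qed (use assms in \<open>simp_all add: den_values2_def\<close>)

lemma num_tail_value_1:
  assumes "i = 3 \<or> i = 4"
  shows "\<bar>fps_value (num_tail i) (614591700786 / 2 ^ 40) - real_of_int (num_values ! i) / 2 ^ 76\<bar>
    \<le> real_of_int 8412340950417 / 2 ^ 76 / (23 / 100) / 10 ^ i"
proof (rule num_tail_value)
  show "list_all (\<lambda>i. 10 ^ i * \<bar>(3 * 614591700786) ^ i * falling_dot (int (2 * i)) 1 num_values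
      - (2 * 2 ^ 40) ^ i * fact (2 * i) * num_values ! i\<bar>
      \<le> 8412340950417 * ((2 * 2 ^ 40) ^ i * fact (2 * i))) [3..<Suc 11]"
    unfolding fact_eq_int_fact by code_simp
  show "(15 * 614591700786) ^ Suc 11 * falling_dot (int (2 * Suc 11)) 1 (map abs num_values)
      \<le> 8412340950417 * ((2 ^ 40) ^ Suc 11 * fact (2 * Suc 11))"
    unfolding fact_eq_int_fact by code_simp
qed (use assms in \<open>simp_all add: num_values_def\<close>)

text \<open>Across the interval of length 2 ^ -40 the value of \<open>den_fps\<close> changes by
  only about 1.6 / 10 ^ 12. The accuracy 1 / 10 ^ 23 lets the secant slope be known to about eleven
  digits.\<close>

lemma den_fps_value_1:
  "\<bar>fps_value den_fps (614591700786 / 2 ^ 40) - 61179194581794 / 10 ^ 26\<bar> \<le> 1 / 10 ^ 23"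
proof -
  let ?x = "614591700786 / 2 ^ 40 :: real"
  have "fps_value den_fps ?x = 1 - 3 / 2 * ?x - 9 / 8 * ?x ^ 2 + 9 / 8 * ?x ^ 3
      - 9 / 4 * ?x ^ 2 * (fps_value (den_tail 3) ?x + fps_value (den_tail 4) ?x)"
    by (rule fps_value_den_fps) simp
  then show ?thesis
    using den_tail_value_1[of 3, unfolded abs_le_iff] den_tail_value_1[of 4, unfolded abs_le_iff]
    unfolding abs_le_iff
    by (intro conjI; simp add: den_values1_def power2_eq_square power3_eq_cube add_divide_distrib; linarith)
qed

lemma den_fps_value_2:
  "\<bar>fps_value den_fps (614591700787 / 2 ^ 40) + 97278080288692 / 10 ^ 26\<bar> \<le> 1 / 10 ^ 23"
proof -
  let ?x = "614591700787 / 2 ^ 40 :: real"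
  have "fps_value den_fps ?x = 1 - 3 / 2 * ?x - 9 / 8 * ?x ^ 2 + 9 / 8 * ?x ^ 3
      - 9 / 4 * ?x ^ 2 * (fps_value (den_tail 3) ?x + fps_value (den_tail 4) ?x)"
    by (rule fps_value_den_fps) simp
  then show ?thesis
    using den_tail_value_2[of 3, unfolded abs_le_iff] den_tail_value_2[of 4, unfolded abs_le_iff]
    unfolding abs_le_iff
    by (intro conjI; simp add: den_values2_def power2_eq_square power3_eq_cube add_divide_distrib; linarith)
qed

text \<open>No small difference is formed with this value, so far less accuracy suffices than for
  \<open>den_fps\<close>.\<close>

lemma num_fps_value_1:
  "\<bar>fps_value num_fps (614591700786 / 2 ^ 40) - 288626442799812 / 10 ^ 15\<bar> \<le> 1 / 10 ^ 12"
proof -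
  let ?x = "614591700786 / 2 ^ 40 :: real"
  have "fps_value num_fps ?x = 3 / 4 * ?x - 45 / 64 * ?x ^ 3
      + 27 / 8 * ?x ^ 3 * (fps_value (num_tail 3) ?x + fps_value (num_tail 4) ?x)"
    by (rule fps_value_num_fps) simp
  then show ?thesis
    using num_tail_value_1[of 3, unfolded abs_le_iff] num_tail_value_1[of 4, unfolded abs_le_iff]
    unfolding abs_le_iff
    by (intro conjI; simp add: num_values_def power3_eq_cube add_divide_distrib; linarith)
qed

abbreviation left_end :: real where "left_end \<equiv> 614591700786 / 2 ^ 40"
abbreviation right_end :: real where "right_end \<equiv> 614591700787 / 2 ^ 40"

lemma ex_den_fps_zero: "\<exists>x. left_end < x \<and> x < right_end \<and> fps_value den_fps x = 0"
proof -
  have cont: "isCont (fps_value den_fps) x" if "\<bar>x\<bar> < 1" for x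
    unfolding fps_value_def
    by (rule isCont_powser[of _ 1]) (use that den_fps_l1 in \<open>auto simp: fps_l1_def intro: summable_rabs_cancel\<close>)
  have "\<exists>x. left_end \<le> x \<and> x \<le> right_end \<and> fps_value den_fps x = 0"
    by (rule IVT2) (use den_fps_value_1[unfolded abs_le_iff] den_fps_value_2[unfolded abs_le_iff] cont in auto)
  moreover have "fps_value den_fps left_end \<noteq> 0" "fps_value den_fps right_end \<noteq> 0"
    using den_fps_value_1[unfolded abs_le_iff] den_fps_value_2[unfolded abs_le_iff] by auto
  ultimately show ?thesis by (metis order_le_less)
qed

text \<open>The cofactor \<open>g\<close> of the zero is evaluated at the zero by the secant of \<open>den_fps\<close> through the two
  end points, so that no derivative is needed.\<close>

lemma den_fps_factor:
  assumes x: "left_end < x" "x < right_end" and zero: "fps_value den_fps x = 0"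
  shows "\<exists>g g'. fps_l1 g \<and> fps_l1 g' \<and> g * g' = 1 \<and> den_fps = (1 - fps_const (1 / x) * fps_X) * g
    \<and> 97386526060 / 10 ^ 11 \<le> fps_value g x \<and> fps_value g x \<le> 97386526069 / 10 ^ 11"
proof -
  have x01: "0 < x" "x < 1" using x by simp_all
  have q: "x / (1 - x) \<le> 12675 / 10000" using x by (simp add: field_simps)
  have q1: "1 / (1 - x) \<le> 22675 / 10000" using x by (simp add: field_simps)
  obtain g where g: "fps_l1 g" "fps_norm1 g \<le> fps_norm1 den_fps * (x / (1 - x))"
    "den_fps = fps_const 0 + (1 - fps_const (1 / x) * fps_X) * g"
    using fps_l1_linear_division[OF den_fps_l1 x01] unfolding zero by blast
  have den: "den_fps = (1 - fps_const (1 / x) * fps_X) * g" using g(3) by simp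
  obtain r where r: "fps_l1 r" "fps_norm1 r \<le> 11 / 1000" "den_fps * multiplier_fps
      = 1 - fps_const (2754152 / 10 ^ 6) * fps_X + fps_const (1726648 / 10 ^ 6) * fps_X ^ 2 + r"
    using multiplier_den_fps by blast
  have "\<exists>g'. fps_l1 g' \<and> g * g' = 1"
  proof (rule fps_l1_unit_criterion[OF g(1) _ r(1) x01])
    show "fps_l1 multiplier_fps" by (simp add: multiplier_fps_def)
    show "(1 - fps_const (1 / x) * fps_X) * g * multiplier_fps
        = 1 - fps_const (2754152 / 10 ^ 6) * fps_X + fps_const (1726648 / 10 ^ 6) * fps_X ^ 2 + r"
      using r(3) den by simp
    have "fps_norm1 r * (x / (1 - x)) \<le> 11 / 1000 * (12675 / 10000)"
      using r(2) q x01 by (intro mult_mono) auto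
    moreover have "x * (2754152 / 10 ^ 6 - 1726648 / 10 ^ 6 * x) - 1726648 / 10 ^ 6 * x
        = x * (1027504 / 10 ^ 6 - 1726648 / 10 ^ 6 * x)"
      by (simp add: field_simps)
    \<comment> \<open>At the zero the bracket is only about 0.062, since the second zero of the
      quadratic polynomial is close to 1. Still 0.033 exceeds 11/1000 * 1.2675, about 0.014.\<close>
    moreover have "55 / 100 * (6 / 100) \<le> x * (1027504 / 10 ^ 6 - 1726648 / 10 ^ 6 * x)"
      using x by (intro mult_mono) auto
    ultimately show "fps_norm1 r * (x / (1 - x))
        < x * (2754152 / 10 ^ 6 - 1726648 / 10 ^ 6 * x) - 1726648 / 10 ^ 6 * x" by simp
  qed simp
  then obtain g' where g': "fps_l1 g'" "g * g' = 1" by blast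
  \<comment> \<open>10 * 1.2675 * 2.2675 / 2 ^ 40 is about 26.1 / 10 ^ 12.\<close>
  have lip: "\<bar>fps_value g y - fps_value g x\<bar> \<le> 28 / 10 ^ 12"
    if y: "0 \<le> y" "y \<le> 1" "\<bar>y - x\<bar> \<le> 1 / 2 ^ 40" for y
  proof -
    have "fps_norm1 g \<le> 10 * (12675 / 10000)"
      by (rule order.trans[OF g(2)]) (use den_fps_norm q x01 in \<open>intro mult_mono, auto\<close>)
    then have "fps_norm1 g * (1 / (1 - x)) * \<bar>y - x\<bar> \<le> 10 * (12675 / 10000) * (22675 / 10000) * (1 / 2 ^ 40)"
      using q1 y x01 fps_norm1_nonneg[OF g(1)] by (intro mult_mono) auto
    then show ?thesis using fps_value_lipschitz[OF g(1) y(1,2) x01] by simp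
  qed
  have val: "fps_value den_fps y = (1 - y / x) * fps_value g y" if "\<bar>y\<bar> \<le> 1" for y
    using that unfolding den by (simp add: fps_value_simps fps_l1_intros g(1))
  \<comment> \<open>\<open>den_fps\<close> is \<open>a * ?g1\<close> at the left end and
    \<open>- b * ?g2\<close> at the right end. The difference is a nonnegative combination of two
    values close to \<open>?g\<close>, of total weight \<open>1 / (2 ^ 40 * x)\<close>.\<close>
  define a where "a = 1 - left_end / x"
  define b where "b = right_end / x - 1"
  have ab: "a \<ge> 0" "b \<ge> 0" "(a + b) * x = 1 / 2 ^ 40"
    using x x01 by (auto simp: a_def b_def field_simps)
  let ?g1 = "fps_value g left_end" and ?g2 = "fps_value g right_end" and ?g = "fps_value g x"
  have sec: "fps_value den_fps left_end - fps_value den_fps right_end = a * ?g1 + b * ?g2"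
    using val[of left_end] val[of right_end] by (simp add: a_def b_def algebra_simps)
  have g1: "\<bar>?g1 - ?g\<bar> \<le> 28 / 10 ^ 12" by (rule lip) (use x in auto)
  have g2: "\<bar>?g2 - ?g\<bar> \<le> 28 / 10 ^ 12" by (rule lip) (use x in auto)
  have g1': "?g1 \<le> ?g + 28 / 10 ^ 12" "?g - 28 / 10 ^ 12 \<le> ?g1" using g1 by linarith+
  have g2': "?g2 \<le> ?g + 28 / 10 ^ 12" "?g - 28 / 10 ^ 12 \<le> ?g2" using g2 by linarith+
  define S where "S = fps_value den_fps left_end - fps_value den_fps right_end"
  have S: "158457274868480 / 10 ^ 26 \<le> S" "S \<le> 158457274872490 / 10 ^ 26"
    using den_fps_value_1[unfolded abs_le_iff] den_fps_value_2[unfolded abs_le_iff] by (auto simp: S_def)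
  have "a * ?g1 + b * ?g2 \<le> a * (?g + 28 / 10 ^ 12) + b * (?g + 28 / 10 ^ 12)"
    by (intro add_mono mult_left_mono ab g1' g2')
  then have "S \<le> (a + b) * (?g + 28 / 10 ^ 12)" using sec by (simp only: S_def distrib_right)
  then have "S * x \<le> (a + b) * (?g + 28 / 10 ^ 12) * x" using x01 by (intro mult_right_mono) auto
  also have "\<dots> = ((a + b) * x) * (?g + 28 / 10 ^ 12)" by (simp only: mult_ac)
  finally have up: "S * x \<le> 1 / 2 ^ 40 * (?g + 28 / 10 ^ 12)" unfolding ab .
  have "a * (?g - 28 / 10 ^ 12) + b * (?g - 28 / 10 ^ 12) \<le> a * ?g1 + b * ?g2"
    by (intro add_mono mult_left_mono ab g1' g2')
  then have "(a + b) * (?g - 28 / 10 ^ 12) \<le> S" using sec by (simp only: S_def distrib_right)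
  then have "(a + b) * (?g - 28 / 10 ^ 12) * x \<le> S * x" using x01 by (intro mult_right_mono) auto
  also have "(a + b) * (?g - 28 / 10 ^ 12) * x = ((a + b) * x) * (?g - 28 / 10 ^ 12)"
    by (simp only: mult_ac)
  finally have lo: "1 / 2 ^ 40 * (?g - 28 / 10 ^ 12) \<le> S * x" unfolding ab .
  have "0 \<le> S" by (rule order.trans[OF _ S(1)]) simp
  then have "158457274868480 / 10 ^ 26 * left_end \<le> S * x"
    by (intro mult_mono S(1) less_imp_le[OF x(1)]) simp_all
  moreover have "S * x \<le> 158457274872490 / 10 ^ 26 * right_end"
    using x01 by (intro mult_mono S(2) less_imp_le[OF x(2)]) simp_all
  ultimately have "97386526060 / 10 ^ 11 \<le> ?g" "?g \<le> 97386526069 / 10 ^ 11"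
    using up lo by simp_all
  with g(1) g' den show ?thesis by blast
qed

text \<open>\<open>geo c\<close> inverts the linear factor of \<open>den_fps\<close>, so evaluating
  the remaining factor at the pole \<open>x\<close> gives \<open>b = 3/2 * x * N(x) / g(x)\<close>,
  where N is \<open>num_fps\<close>. Times \<open>2 * c / 3 = 2 / (3 * x)\<close> this is
  \<open>N(x) / g(x)\<close>, the constant to be enclosed.\<close>

lemma scaled_fps_pole:
  "\<exists>c b h. c > 1 \<and> left_end < 1 / c \<and> 1 / c < right_end \<and> fps_l1 h \<and> scaled_fps = fps_const b * geo c + h
    \<and> 0.2963720490 \<le> b * (2 * c / 3) \<and> b * (2 * c / 3) < 0.2963720491"
proof -
  obtain x where x: "left_end < x" "x < right_end" "fps_value den_fps x = 0"
    using ex_den_fps_zero by blast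
  obtain g g' where g: "fps_l1 g" "fps_l1 g'" "g * g' = 1" "den_fps = (1 - fps_const (1 / x) * fps_X) * g"
    "97386526060 / 10 ^ 11 \<le> fps_value g x" "fps_value g x \<le> 97386526069 / 10 ^ 11"
    using den_fps_factor[OF x] by blast
  have x01: "0 < x" "x < 1" using x by simp_all
  define c where "c = 1 / x"
  have c: "c > 1" "1 / c = x" using x01 by (simp_all add: c_def)
  have inv: "geo c * (1 - fps_const (1 / x) * fps_X) = 1"
    using geometric_fps_mult[of c] by (simp add: c_def mult.commute)
  have "state_fps 1 = geo c * (num_fps * g')"
  proof -
    have "(geo c * (1 - fps_const (1 / x) * fps_X)) * (g * g') * state_fps 1
        = geo c * (((1 - fps_const (1 / x) * fps_X) * g * state_fps 1) * g')"
      by (simp only: mult_ac)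
    also have "(1 - fps_const (1 / x) * fps_X) * g * state_fps 1 = num_fps"
      using den_times_state g(4) by simp
    finally show ?thesis unfolding inv g(3) by simp
  qed
  then have sc: "scaled_fps = Z + geo c * (Z * num_fps * g')"
    by (simp add: scaled_fps_eq algebra_simps)
  have l1: "fps_l1 (Z * num_fps * g')" by (intro fps_l1_intros num_fps_l1 g)
  obtain h where h: "fps_l1 h" "geo c * (Z * num_fps * g') = fps_const (fps_value (Z * num_fps * g') (1 / c)) * geo c + h"
    using geo_mult_l1[OF c(1) l1] by blast
  define b where "b = fps_value (Z * num_fps * g') x"
  have "\<bar>x\<bar> \<le> 1" using x01 by simp
  then have b: "b = 3 / 2 * x * fps_value num_fps x * fps_value g' x"
    unfolding b_def by (simp add: fps_value_simps fps_l1_intros num_fps_l1 g)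
  have gg: "fps_value g x * fps_value g' x = 1"
    using fps_value_mult[OF g(1,2) \<open>\<bar>x\<bar> \<le> 1\<close>] g(3) by simp
  have alpha: "b * (2 * c / 3) * fps_value g x = fps_value num_fps x"
  proof -
    have "b * (2 * c / 3) * fps_value g x = fps_value num_fps x * (fps_value g x * fps_value g' x)"
      using x01 by (simp add: b c_def)
    then show ?thesis unfolding gg by simp
  qed
  have N: "28862644279 / 10 ^ 11 \<le> fps_value num_fps x" "fps_value num_fps x \<le> 28862644282 / 10 ^ 11"
  proof -
    have "\<bar>fps_value num_fps left_end - fps_value num_fps x\<bar> \<le> fps_norm1 num_fps / (1 - x) * \<bar>left_end - x\<bar>"
      by (rule fps_value_lipschitz[OF num_fps_l1 _ _ x01]) simp_all
    also have "fps_norm1 num_fps / (1 - x) \<le> 3 / (4 / 10)"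
      using num_fps_norm x by (intro frac_le) auto
    then have "fps_norm1 num_fps / (1 - x) * \<bar>left_end - x\<bar> \<le> 3 / (4 / 10) * (1 / 2 ^ 40)"
      using x by (intro mult_mono) auto
    finally have "\<bar>fps_value num_fps left_end - fps_value num_fps x\<bar> \<le> 7 / 10 ^ 12" by simp
    from this[unfolded abs_le_iff]
    show "28862644279 / 10 ^ 11 \<le> fps_value num_fps x" "fps_value num_fps x \<le> 28862644282 / 10 ^ 11"
      using num_fps_value_1[unfolded abs_le_iff] by auto
  qed
  have "0.2963720490 \<le> b * (2 * c / 3)"
  proof (rule ccontr)
    assume "\<not> 0.2963720490 \<le> b * (2 * c / 3)"
    then have "b * (2 * c / 3) * fps_value g x \<le> 0.2963720490 * fps_value g x"
      using g(5) by (intro mult_right_mono) auto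
    then show False using alpha N(1) g(6) by simp
  qed
  moreover have "b * (2 * c / 3) < 0.2963720491"
  proof (rule ccontr)
    assume "\<not> b * (2 * c / 3) < 0.2963720491"
    then have "0.2963720491 * fps_value g x \<le> b * (2 * c / 3) * fps_value g x"
      using g(5) by (intro mult_right_mono) auto
    then show False using alpha N(2) g(5) by simp
  qed
  moreover have "scaled_fps = fps_const b * geo c + (Z + h)"
    using sc h(2) c(2) by (simp add: b_def add.left_commute)
  moreover have "fps_l1 (Z + h)" by (intro fps_l1_intros h)
  ultimately show ?thesis using c x by blast
qed

theorem theorem2:
  defines "\<kappa> \<equiv> 2 / (3 * gamma2)"
  shows "(\<lambda>n. root n (real (W2 1 n) / fact n)) \<longlonglongrightarrow> gamma2
    \<and> 1.1926743412 \<le> gamma2 \<and> gamma2 < 1.1926743413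
    \<and> \<kappa> < 1
    \<and> (\<exists>\<alpha>::real. 0.2963720490 \<le> \<alpha> \<and> \<alpha> < 0.2963720491
        \<and> (\<exists>\<epsilon>::nat \<Rightarrow> real. \<epsilon> \<in> O(\<lambda>n. \<kappa> ^ n)
            \<and> (\<forall>\<^sub>F n in sequentially.
                real (W2 1 n) / fact n = \<alpha> * gamma2 ^ (n - 1) * (1 + \<epsilon> n)))
        \<and> (\<forall>s\<ge>1. \<exists>P::real poly.
            degree P = s - 1 \<and> lead_coeff P = (\<alpha> / gamma2) ^ s / fact (s - 1)
            \<and> (\<exists>\<epsilon>::nat \<Rightarrow> real. \<epsilon> \<in> O(\<lambda>n. \<kappa> ^ n)
                \<and> (\<forall>\<^sub>F n in sequentially.
                    real (W2 s n) / fact n = poly P (real n) * gamma2 ^ n * (1 + \<epsilon> n)))))"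
proof -
  obtain c b h where c: "c > 1" "left_end < 1 / c" "1 / c < right_end" and h: "fps_l1 h"
    and eq: "scaled_fps = fps_const b * geo c + h"
    and \<alpha>: "0.2963720490 \<le> b * (2 * c / 3)" "b * (2 * c / 3) < 0.2963720491"
    using scaled_fps_pole by blast
  have b: "b > 0"
  proof (rule ccontr)
    assume "\<not> b > 0"
    then have "b * (2 * c / 3) \<le> 0" using c by (intro mult_nonpos_nonneg) auto
    then show False using \<alpha>(1) by simp
  qed
  have lim: "(\<lambda>n. root n (real (W2 1 n) / fact n)) \<longlonglongrightarrow> 2 * c / 3"
    by (rule W2_root_limit[OF c(1) h b eq])
  then have gamma: "gamma2 = 2 * c / 3" unfolding gamma2_def by (rule limI)
  have \<kappa>: "\<kappa> = 1 / c" using c by (simp add: \<kappa>_def gamma)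
  have gamma_bounds: "1.1926743412 \<le> gamma2" "gamma2 < 1.1926743413"
    using c by (simp_all add: gamma field_simps)
  have asym: "\<exists>P::real poly. degree P = s - 1 \<and> lead_coeff P = (b * (2 * c / 3) / gamma2) ^ s / fact (s - 1)
      \<and> (\<exists>\<epsilon>::nat \<Rightarrow> real. \<epsilon> \<in> O(\<lambda>n. \<kappa> ^ n) \<and> (\<forall>\<^sub>F n in sequentially.
        real (W2 s n) / fact n = poly P (real n) * gamma2 ^ n * (1 + \<epsilon> n)))" if "s \<ge> 1" for s
  proof -
    \<comment> \<open>The constant \<open>\<alpha>\<close> is \<open>b * gamma2\<close>, because the
      first formula is written with \<open>gamma2 ^ (n - 1)\<close>.\<close>
    have "b * (2 * c / 3) / gamma2 = b" using c by (simp add: gamma)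
    then show ?thesis using W2_asymptotics[OF c(1) h b that eq] by (simp only: gamma \<kappa>)
  qed
  have "\<exists>\<epsilon>::nat \<Rightarrow> real. \<epsilon> \<in> O(\<lambda>n. \<kappa> ^ n) \<and> (\<forall>\<^sub>F n in sequentially.
      real (W2 1 n) / fact n = b * (2 * c / 3) * gamma2 ^ (n - 1) * (1 + \<epsilon> n))"
  proof -
    obtain P :: "real poly" and \<epsilon> :: "nat \<Rightarrow> real" where P: "degree P = 0" "lead_coeff P = b"
      and \<epsilon>: "\<epsilon> \<in> O(\<lambda>n. \<kappa> ^ n)" "\<forall>\<^sub>F n in sequentially.
        real (W2 1 n) / fact n = poly P (real n) * gamma2 ^ n * (1 + \<epsilon> n)"
      using W2_asymptotics[OF c(1) h b _ eq, of 1] unfolding gamma \<kappa> by auto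
    have P_eq: "poly P x = b" for x using P by (auto elim!: degree_eq_zeroE)
    have "\<forall>\<^sub>F n in sequentially.
        real (W2 1 n) / fact n = b * (2 * c / 3) * gamma2 ^ (n - 1) * (1 + \<epsilon> n)"
      \<comment> \<open>At \<open>n = 0\<close> the truncated exponent \<open>n - 1\<close> would
        break the identity.\<close>
      using \<epsilon>(2) eventually_gt_at_top[of 0]
    proof eventually_elim
      case (elim n)
      have "gamma2 ^ n = 2 * c / 3 * gamma2 ^ (n - 1)"
        using elim(2) power_minus_mult[of n gamma2] by (simp add: gamma mult.commute)
      then show ?case unfolding elim(1) P_eq by (simp only: mult.assoc)
    qed
    with \<epsilon>(1) show ?thesis by blast
  qed
  with asym \<alpha> have "\<exists>\<alpha>::real. 0.2963720490 \<le> \<alpha> \<and> \<alpha> < 0.2963720491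
        \<and> (\<exists>\<epsilon>::nat \<Rightarrow> real. \<epsilon> \<in> O(\<lambda>n. \<kappa> ^ n)
            \<and> (\<forall>\<^sub>F n in sequentially.
                real (W2 1 n) / fact n = \<alpha> * gamma2 ^ (n - 1) * (1 + \<epsilon> n)))
        \<and> (\<forall>s\<ge>1. \<exists>P::real poly.
            degree P = s - 1 \<and> lead_coeff P = (\<alpha> / gamma2) ^ s / fact (s - 1)
            \<and> (\<exists>\<epsilon>::nat \<Rightarrow> real. \<epsilon> \<in> O(\<lambda>n. \<kappa> ^ n)
                \<and> (\<forall>\<^sub>F n in sequentially.
                    real (W2 s n) / fact n = poly P (real n) * gamma2 ^ n * (1 + \<epsilon> n))))"
    by blast
  moreover have "\<kappa> < 1" using c by (simp add: \<kappa>)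
  ultimately show ?thesis using lim gamma gamma_bounds by simp
qed

end
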